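(* Let $x,z,\mu,\lambda\in\mathbb{C}$ with $\mathrm{Re}(x)>0$, $\mathrm{Re}(z)>0$, $z\notin\mathbb{Z}$, and $\mathrm{Re}(\mu+\lambda)>0$. Then $$2\sum_{n=1}^\infty\left(\frac{nx}{2}\right)^{z-\lambda}{}_{\mu}K_{z}(nx,\lambda)+\frac{2^{z+\mu+\lambda-1}\Gamma(z)\Gamma\left(\frac{1}{2}+\lambda+\mu\right)}{\Gamma\left(\frac{1}{2}+\lambda-z\right)}-\frac{\sqrt{\pi}\,2^{\mu+z+\lambda}\,\Gamma(\lambda+\mu)\Gamma\left(\frac{1}{2}+z\right)}{x\,\Gamma(\lambda-z)}$$ $$=\frac{2^{\mu+\lambda-z}}{\sqrt{\pi}}\left(\frac{x}{\pi}\right)^{2z}\frac{\Gamma\left(z+\frac{1}{2}\right)\Gamma\left(\frac{1}{2}+\lambda+\mu+z\right)}{\Gamma\left(\frac{1}{2}+\lambda\right)}\sum_{n=1}^\infty\frac{1}{n^{2z+1}}\,{}_2F_1\left(\frac{1}{2}+z,\frac{1}{2}+\lambda+\mu+z;\frac{1}{2}+\lambda;-\frac{x^2}{4\pi^2n^2}\right).$$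
   Context: All complex powers are principal values. ${}_1F_2(a;b_1,b_2;\xi)=\sum_{n\ge0}\frac{(a)_n}{(b_1)_n(b_2)_n}\frac{\xi^n}{n!}$ with $(a)_n=a(a+1)\cdots(a+n-1)$. ${}_2F_1(a,b;c;\xi)$ is the Gauss hypergeometric function (principal branch on $|\arg(1-\xi)|<\pi$), given for $\mathrm{Re}(c)>\mathrm{Re}(b)>0$ by $\frac{\Gamma(c)}{\Gamma(b)\Gamma(c-b)}\int_0^1t^{b-1}(1-t)^{c-b-1}(1-t\xi)^{-a}\,dt$ and by analytic continuation in the parameters otherwise. $1/\Gamma$ is taken to be $0$ at the poles of $\Gamma$, and quotients such as ${}_2F_1(a,b;c;\xi)/\Gamma(c)$ or ${}_1F_2(a;b_1,b_2;\xi)/\Gamma(b_1)$ are understood by continuity when $c$ or $b_1$ is a nonpositive integer. For $z\in\mathbb{C}\setminus\mathbb{Z}$ and $x,\mu,\lambda\in\mathbb{C}$ with $\mu+\lambda\ne-\frac12,-\frac32,-\frac52,\ldots$, the two-parameter generalized modified Bessel function is $${}_{\mu}K_{z}(x,\lambda)=\frac{\pi x^\lambda 2^{\mu+z-1}}{\sin(z\pi)}\Bigg\{\left(\frac{x}{2}\right)^{-z}\frac{\Gamma(\mu+\lambda+\frac12)}{\Gamma(1-z)\Gamma(\lambda+\frac12-z)}\,{}_1F_2\left(\mu+\lambda+\tfrac12;\lambda+\tfrac12-z,1-z;\frac{x^2}{4}\right)$$ $$\qquad-\left(\frac{x}{2}\right)^{z}\frac{\Gamma(\mu+z+\lambda+\frac12)}{\Gamma(1+z)\Gamma(\lambda+\frac12)}\,{}_1F_2\left(\mu+z+\lambda+\tfrac12;\lambda+\tfrac12,1+z;\frac{x^2}{4}\right)\Bigg\}.$$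 *)

theory Defs
  imports "HOL-Complex_Analysis.Complex_Analysis"
begin

definition hyp1F2 :: "complex \<Rightarrow> complex \<Rightarrow> complex \<Rightarrow> complex \<Rightarrow> complex" where
  "hyp1F2 a b1 b2 \<xi> =
     (\<Sum>n. pochhammer a n / (pochhammer b1 n * pochhammer b2 n) * (\<xi> ^ n / fact n))"

text \<open>
  The quotient of \<^term>\<open>hyp1F2 a b1 b2 \<xi>\<close> by \<^term>\<open>Gamma b1\<close>, extended by continuity to
  nonpositive integers \<^term>\<open>b1\<close>; the factor \<^term>\<open>pochhammer b1 n * Gamma b1\<close> has become
  \<^term>\<open>Gamma (b1 + of_nat n)\<close>. See \<open>hyp1F2_reg_eq\<close> and \<open>isCont_hyp1F2_reg\<close> below.
\<close>
definition hyp1F2_reg :: "complex \<Rightarrow> complex \<Rightarrow> complex \<Rightarrow> complex \<Rightarrow> complex" where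
  "hyp1F2_reg a b1 b2 \<xi> =
     (\<Sum>n. pochhammer a n * rGamma (b1 + of_nat n) / pochhammer b2 n * (\<xi> ^ n / fact n))"

lemma summable_norm_if_ratio_tendsto_0:
  fixes f r :: "nat \<Rightarrow> complex"
  assumes f: "\<And>n. f (Suc n) = r n * f n" and r: "r \<longlonglongrightarrow> 0"
  shows "summable (\<lambda>n. norm (f n))"
proof -
  obtain N where N: "\<And>n. n \<ge> N \<Longrightarrow> norm (r n) < 1/2"
    using LIMSEQ_D[OF r, of "1/2"] by auto
  show ?thesis
  proof (rule summable_ratio_test[where c = "1/2" and N = N])
    fix n assume "n \<ge> N"
    then have "norm (r n) \<le> 1/2" using N by (meson less_imp_le)
    then show "norm (norm (f (Suc n))) \<le> 1/2 * norm (norm (f n))"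
      using mult_right_mono[of "norm (r n)" "1/2" "norm (f n)"] by (simp add: f norm_mult)
  qed simp
qed

lemma tendsto_inverse_add_of_nat: "(\<lambda>n. 1 / (b + of_nat n :: complex)) \<longlonglongrightarrow> 0"
proof -
  have "filterlim (\<lambda>n. b + of_nat n :: complex) at_infinity sequentially"
    by (intro tendsto_add_filterlim_at_infinity[OF tendsto_const] tendsto_of_nat)
  from tendsto_inverse_0 and this have "(\<lambda>n. inverse (b + of_nat n :: complex)) \<longlonglongrightarrow> 0"
    by (rule filterlim_compose)
  then show ?thesis by (simp add: divide_inverse)
qed

lemma tendsto_add_of_nat_ratio: "(\<lambda>n. (a + of_nat n) / (b + of_nat n :: complex)) \<longlonglongrightarrow> 1"
proof -
  have *: "(\<lambda>n. 1 + (a - b) * (1 / (b + of_nat n :: complex))) \<longlonglongrightarrow> 1 + (a - b) * 0"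
    by (intro tendsto_intros tendsto_inverse_add_of_nat)
  have "eventually (\<lambda>n. b + of_nat n \<noteq> (0::complex)) sequentially"
    using filterlim_at_infinity_imp_eventually_ne
      [OF tendsto_add_filterlim_at_infinity[OF tendsto_const tendsto_of_nat]] by blast
  then have "eventually (\<lambda>n. 1 + (a - b) * (1 / (b + of_nat n :: complex)) =
      (a + of_nat n) / (b + of_nat n)) sequentially"
    by eventually_elim (simp add: field_simps)
  from Lim_transform_eventually[OF * this] show ?thesis by simp
qed

lemma summable_norm_hyp1F1:
  "summable (\<lambda>n. norm (pochhammer a n / pochhammer b n * (\<xi> ^ n / fact n) :: complex))"
proof (rule summable_norm_if_ratio_tendsto_0)
  show "pochhammer a (Suc n) / pochhammer b (Suc n) * (\<xi> ^ Suc n / fact (Suc n)) =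
      (a + of_nat n) / (b + of_nat n) * (\<xi> * (1 / (1 + of_nat n))) *
      (pochhammer a n / pochhammer b n * (\<xi> ^ n / fact n))" for n
    by (simp add: pochhammer_Suc mult_ac)
  have "(\<lambda>n. (a + of_nat n) / (b + of_nat n) * (\<xi> * (1 / (1 + of_nat n)))) \<longlonglongrightarrow> 1 * (\<xi> * 0)"
    by (intro tendsto_intros tendsto_add_of_nat_ratio tendsto_inverse_add_of_nat)
  then show "(\<lambda>n. (a + of_nat n) / (b + of_nat n) * (\<xi> * (1 / (1 + of_nat n)))) \<longlonglongrightarrow> 0"
    by simp
qed

lemma summable_hyp1F2:
  "summable (\<lambda>n. pochhammer a n / (pochhammer b1 n * pochhammer b2 n) * (\<xi> ^ n / fact n) :: complex)"
proof (rule summable_norm_cancel, rule summable_norm_if_ratio_tendsto_0)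
  show "pochhammer a (Suc n) / (pochhammer b1 (Suc n) * pochhammer b2 (Suc n)) *
        (\<xi> ^ Suc n / fact (Suc n)) =
      (a + of_nat n) / (b1 + of_nat n) * (1 / (b2 + of_nat n)) * (\<xi> * (1 / (1 + of_nat n))) *
      (pochhammer a n / (pochhammer b1 n * pochhammer b2 n) * (\<xi> ^ n / fact n))" for n
    by (simp add: pochhammer_Suc mult_ac)
  have "(\<lambda>n. (a + of_nat n) / (b1 + of_nat n) * (1 / (b2 + of_nat n)) *
      (\<xi> * (1 / (1 + of_nat n)))) \<longlonglongrightarrow> 1 * 0 * (\<xi> * 0)"
    by (intro tendsto_intros tendsto_add_of_nat_ratio tendsto_inverse_add_of_nat)
  then show "(\<lambda>n. (a + of_nat n) / (b1 + of_nat n) * (1 / (b2 + of_nat n)) *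
      (\<xi> * (1 / (1 + of_nat n)))) \<longlonglongrightarrow> 0"
    by simp
qed

lemma hyp1F2_reg_eq:
  assumes "b1 \<notin> \<int>\<^sub>\<le>\<^sub>0"
  shows "hyp1F2_reg a b1 b2 \<xi> = hyp1F2 a b1 b2 \<xi> / Gamma b1"
proof -
  have p: "rGamma (b1 + of_nat n) = rGamma b1 / pochhammer b1 n" for n
  proof -
    have "pochhammer b1 n \<noteq> 0"
      using assms by (auto simp: pochhammer_eq_0_iff)
    then show ?thesis
      by (simp add: pochhammer_rGamma[of b1 n] field_simps)
  qed
  have "hyp1F2_reg a b1 b2 \<xi> =
      (\<Sum>n. rGamma b1 * (pochhammer a n / (pochhammer b1 n * pochhammer b2 n) * (\<xi> ^ n / fact n)))"
    unfolding hyp1F2_reg_def p by (simp add: field_simps)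
  also have "\<dots> = rGamma b1 * hyp1F2 a b1 b2 \<xi>"
    unfolding hyp1F2_def using summable_hyp1F2 by (rule suminf_mult)
  finally show ?thesis
    by (simp add: rGamma_inverse_Gamma field_simps)
qed

lemma isCont_hyp1F2_reg: "isCont (\<lambda>b. hyp1F2_reg a b b2 \<xi>) b1"
proof -
  define t where "t = (\<lambda>n. pochhammer a n / pochhammer b2 n * (\<xi> ^ n / fact n))"
  define B where "B = cball b1 1"
  obtain N :: nat where N: "real N \<ge> 2 - Re b1"
    using real_arch_simple by blast
  have "compact ((\<lambda>b. rGamma (b + of_nat N)) ` B)"
    unfolding B_def
    by (intro compact_continuous_image continuous_on_compose2[OF continuous_on_rGamma[of UNIV]]
        continuous_intros) auto
  then obtain C where C: "\<And>b. b \<in> B \<Longrightarrow> norm (rGamma (b + of_nat N)) \<le> C"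
    by (meson bounded_iff compact_imp_bounded image_eqI)
  have rG: "norm (rGamma (b + of_nat n)) \<le> C" if b: "b \<in> B" and "n \<ge> N" for b n
    using \<open>n \<ge> N\<close>
  proof (induction n rule: dec_induct)
    case base
    then show ?case using C b by blast
  next
    case (step n)
    let ?w = "b + of_nat n"
    have "\<bar>Re (b1 - b)\<bar> \<le> norm (b1 - b)" by (rule abs_Re_le_cmod)
    also have "\<dots> \<le> 1" using b by (simp add: B_def dist_norm)
    finally have "1 \<le> Re ?w" using N step.hyps by simp
    then have "1 \<le> norm ?w" using complex_Re_le_cmod[of ?w] by linarith
    have "norm (rGamma (?w + 1)) \<le> norm ?w * norm (rGamma (?w + 1))"
      using \<open>1 \<le> norm ?w\<close> by (simp add: mult_le_cancel_right1)
    also have "\<dots> = norm (rGamma ?w)"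
      by (metis norm_mult rGamma_plus1)
    finally show ?case using step.IH by (simp add: add.commute add.left_commute)
  qed
  have "uniform_limit B (\<lambda>n b. \<Sum>k<n. rGamma (b + of_nat k) * t k)
      (\<lambda>b. \<Sum>k. rGamma (b + of_nat k) * t k) sequentially"
  proof (rule Weierstrass_m_test_ev[where M = "\<lambda>n. C * norm (t n)"])
    show "\<forall>\<^sub>F n in sequentially. \<forall>b\<in>B. norm (rGamma (b + of_nat n) * t n) \<le> C * norm (t n)"
      using eventually_ge_at_top[of N]
      by eventually_elim (auto simp: norm_mult intro!: mult_right_mono rG)
    show "summable (\<lambda>n. C * norm (t n))"
      unfolding t_def by (intro summable_mult summable_norm_hyp1F1)
  qed
  then have "continuous_on B (\<lambda>b. \<Sum>k. rGamma (b + of_nat k) * t k)"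
    by (rule uniform_limit_theorem[rotated])
      (auto intro!: always_eventually continuous_intros
        continuous_on_compose2[OF continuous_on_rGamma[of UNIV]])
  also have "(\<lambda>b. \<Sum>k. rGamma (b + of_nat k) * t k) = (\<lambda>b. hyp1F2_reg a b b2 \<xi>)"
    unfolding hyp1F2_reg_def t_def by (simp add: field_simps)
  finally show ?thesis
    by (rule continuous_on_interior) (simp add: B_def)
qed

text \<open>
  \<open>is_hyp2F1_reg \<xi> g\<close> says that \<open>g a b c\<close> is, at the fixed point \<open>\<xi>\<close> of the plane cut along
  \<open>[1, \<infinity>)\<close>, the quotient of \<open>\<^sub>2F\<^sub>1(a, b; c; \<xi>)\<close> by \<open>\<Gamma>(c)\<close>: it is given by Euler's integral for
  \<open>Re c > Re b > 0\<close> and extended analytically in the parameters. The quotient is entire in each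
  parameter, so that the values at nonpositive integers \<open>c\<close> are those obtained by continuity.
\<close>
definition is_hyp2F1_reg :: "complex \<Rightarrow> (complex \<Rightarrow> complex \<Rightarrow> complex \<Rightarrow> complex) \<Rightarrow> bool" where
  "is_hyp2F1_reg \<xi> g \<longleftrightarrow>
     (\<forall>b c. (\<lambda>a. g a b c) holomorphic_on UNIV) \<and>
     (\<forall>a c. (\<lambda>b. g a b c) holomorphic_on UNIV) \<and>
     (\<forall>a b. (\<lambda>c. g a b c) holomorphic_on UNIV) \<and>
     (\<forall>a b c. 0 < Re b \<and> Re b < Re c \<longrightarrow>
        g a b c = 1 / (Gamma b * Gamma (c - b)) *
          integral {0..1} (\<lambda>t. complex_of_real t powr (b - 1) *
             (1 - complex_of_real t) powr (c - b - 1) * (1 - complex_of_real t * \<xi>) powr (- a)))"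

lemma is_hyp2F1_reg_unique:
  assumes g: "is_hyp2F1_reg \<xi> g" and h: "is_hyp2F1_reg \<xi> h"
  shows "g = h"
proof (intro ext)
  fix a b c
  have op: "open {w. r < Re w}" for r by (rule open_halfspace_Re_gt)
  have 1: "g a b c = h a b c" if "0 < Re b" for b c
  proof (rule analytic_continuation_open[where s = "{w. Re b < Re w}" and s' = UNIV
        and f = "\<lambda>c. g a b c" and g = "\<lambda>c. h a b c"])
    show "{w. Re b < Re w} \<noteq> {}"
      by (auto intro!: exI[of _ "b + 1"])
    show "g a b w = h a b w" if "w \<in> {w. Re b < Re w}" for w
      using g h that \<open>0 < Re b\<close> by (simp add: is_hyp2F1_reg_def)
  qed (use g h op in \<open>auto simp: is_hyp2F1_reg_def\<close>)
  show "g a b c = h a b c"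
  proof (rule analytic_continuation_open[where s = "{w. 0 < Re w}" and s' = UNIV
        and f = "\<lambda>b. g a b c" and g = "\<lambda>b. h a b c"])
    show "{w. 0 < Re w} \<noteq> {}"
      by (auto intro!: exI[of _ 1])
  qed (use g h op 1 in \<open>auto simp: is_hyp2F1_reg_def\<close>)
qed

definition hyp2F1_reg :: "complex \<Rightarrow> complex \<Rightarrow> complex \<Rightarrow> complex \<Rightarrow> complex" where
  "hyp2F1_reg a b c \<xi> = (THE g. is_hyp2F1_reg \<xi> g) a b c"

text \<open>
  The two-parameter generalized modified Bessel function, for \<open>z \<notin> \<int>\<close> and
  \<open>\<mu> + lam \<notin> {-1/2, -3/2, \<dots>}\<close>; the factors \<open>1/\<Gamma>(lam + 1/2 - z)\<close> and \<open>1/\<Gamma>(lam + 1/2)\<close> are inside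
  \<^const>\<open>hyp1F2_reg\<close>.
\<close>
definition gen_bessel_K :: "complex \<Rightarrow> complex \<Rightarrow> complex \<Rightarrow> complex \<Rightarrow> complex" where
  "gen_bessel_K \<mu> z x lam =
     of_real pi * x powr lam * 2 powr (\<mu> + z - 1) / sin (z * of_real pi) *
     ((x / 2) powr (- z) * (Gamma (\<mu> + lam + 1/2) / Gamma (1 - z)) *
        hyp1F2_reg (\<mu> + lam + 1/2) (lam + 1/2 - z) (1 - z) (x\<^sup>2 / 4)
      - (x / 2) powr z * (Gamma (\<mu> + z + lam + 1/2) / Gamma (1 + z)) *
        hyp1F2_reg (\<mu> + z + lam + 1/2) (lam + 1/2) (1 + z) (x\<^sup>2 / 4))"

end

theory Submission
  imports Defs "HOL-Probability.Probability"
begin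

text \<open>
  Put \<open>a = \<mu> + \<lambda> + 1/2\<close> and \<open>c = \<lambda> + 1/2 - z\<close> and vary \<open>c\<close>. If \<open>Re (c - a) > 0\<close>, the summand on
  the left is, up to a constant, the beta integral over \<open>t \<in> (0, 1)\<close> of \<open>(w/2)\<^sup>z K\<^sub>z(w)\<close> at
  \<open>w = n x \<surd>t\<close>; by Euler's formula the one on the right is the same beta integral of \<open>(x\<^sup>2 t)\<^sup>z\<close> times
  \<open>x\<^sup>2 t + 4 \<pi>\<^sup>2 n\<^sup>2\<close> to the power \<open>-z - 1/2\<close>. For real \<open>x\<close> the identity thus follows from Poisson
  summation for \<open>(w/2)\<^sup>z K\<^sub>z(w)\<close>, which is a Laplace transform of Jacobi's theta transformation; it
  extends to \<open>Re x > 0\<close> by the identity theorem. Finally, the operator \<open>(c - 1) + (x/2) d/dx\<close> maps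
  the identity for \<open>c\<close> to the one for \<open>c - 1\<close> (both series converge locally uniformly and may be
  differentiated termwise), so that it holds for all \<open>c\<close> without any continuation in the parameters.
\<close>

section \<open>Differentiation under integrals and of series\<close>

text \<open>The generalized Bessel function is given by power series, while Poisson summation wants
  an integral for K; the Wronskian of I and K is the bridge between the two. The assumption Re
  (\<mu> + \<lambda>) > 0 says Re a > 1/2. It makes the left series converge, whose terms are
  O(n^(-2p)) for p < Re a if Re (c - a) > 0, and it makes the beta integral of the 1/w term of the
  Poisson formula converge, which costs t^(-1/2) at w = x sqrt t. The two isolated terms on the left
  are the contribution of n = 0 to the Bessel sum and the zero frequency of its transform. Analytic
  continuation in c would demand bounds of both series that are uniform near each c, also where no
  integral represents the terms. The operator (c - 1) + (x/2) d/dx avoids this: on x^(2n) it is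
  multiplication by c - 1 + n, and rGamma (c - 1 + n) = (c - 1 + n) rGamma (c + n). Only majorants
  locally uniform in x are asked for, and Cauchy's estimate hands these on to derivatives. All
  quotients by Gamma functions of c are kept regularized, so the descent passes through their poles
  without exceptions.\<close>

lemma integrable_dominated:
  fixes f :: "real \<Rightarrow> complex"
  assumes "continuous_on S f" "open S" "g integrable_on S" "\<And>t. t \<in> S \<Longrightarrow> norm (f t) \<le> g t"
  shows "f absolutely_integrable_on S" "f integrable_on S"
proof -
  have "S \<in> sets lebesgue"
    using assms(2) by (simp add: borel_open)
  then show "f absolutely_integrable_on S"
    using measurable_bounded_by_integrable_imp_absolutely_integrable[of f S g] assms
      continuous_imp_measurable_on_sets_lebesgue by blast
  then show "f integrable_on S"
    by (rule set_lebesgue_integral_eq_integral(1))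
qed

text \<open>Cauchy's inequality on the circle of radius r/4 about v, which stays inside
  \<open>ball w r\<close> because r/2 + r/4 < r; hence the constant 4/r.\<close>

lemma norm_deriv_le_on_half_ball:
  assumes "f holomorphic_on ball w r" "\<And>u. u \<in> ball w r \<Longrightarrow> norm (f u) \<le> B"
    and "v \<in> ball w (r / 2)"
  shows "norm (deriv f v) \<le> 4 * B / r"
proof -
  have r: "r > 0" using assms(3) by (metis half_gt_zero_iff mem_ball zero_le_dist order_le_less_trans)
  have sub: "cball v (r / 4) \<subseteq> ball w r"
  proof
    fix u assume "u \<in> cball v (r / 4)"
    then have "dist w u \<le> dist w v + r / 4" using dist_triangle[of w u v] by auto
    then show "u \<in> ball w r" using assms(3) r by simp
  qed
  have "norm ((deriv ^^ 1) f v) \<le> fact 1 * B / (r / 4) ^ 1"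
  proof (rule Cauchy_inequality)
    show "f holomorphic_on ball v (r / 4)"
      using sub assms(1) ball_subset_cball holomorphic_on_subset by blast
    show "continuous_on (cball v (r / 4)) f"
      using sub assms(1) holomorphic_on_imp_continuous_on continuous_on_subset by blast
    show "norm (f x) \<le> B" if "norm (v - x) = r / 4" for x
      using that sub by (intro assms(2)) (auto simp: dist_norm subset_iff)
  qed (use r in auto)
  then show ?thesis by (simp add: field_simps)
qed

text \<open>The Cauchy estimate supplies the domination of the difference quotients.\<close>
lemma has_field_derivative_integral:
  fixes f :: "complex \<Rightarrow> real \<Rightarrow> complex"
  assumes U: "open U" "w0 \<in> U"
    and hol: "\<And>t. t \<in> S \<Longrightarrow> (\<lambda>w. f w t) holomorphic_on U"
    and int: "\<And>w. w \<in> U \<Longrightarrow> f w integrable_on S"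
    and "r > 0" and g: "g integrable_on S"
    and le: "\<And>w t. w \<in> ball w0 r \<Longrightarrow> w \<in> U \<Longrightarrow> t \<in> S \<Longrightarrow> norm (f w t) \<le> g t"
  shows "(\<lambda>t. deriv (\<lambda>w. f w t) w0) integrable_on S"
    and "((\<lambda>w. integral S (f w)) has_field_derivative integral S (\<lambda>t. deriv (\<lambda>w. f w t) w0)) (at w0)"
proof -
  obtain r' where r': "r' > 0" "ball w0 r' \<subseteq> U" using U openE by blast
  define s where "s = min r r'"
  have s: "s > 0" "ball w0 s \<subseteq> U" "\<And>w t. w \<in> ball w0 s \<Longrightarrow> t \<in> S \<Longrightarrow> norm (f w t) \<le> g t"
    using r' \<open>r > 0\<close> le by (auto simp: s_def subset_iff)
  let ?B = "ball w0 (s / 2)" and ?D = "\<lambda>t. deriv (\<lambda>w. f w t) w0"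
  \<comment> \<open>The mean value inequality on the half ball turns Cauchy's bound of the
    derivative into a bound of the difference quotients that no longer depends on w.\<close>
  have quot: "norm ((f w t - f w0 t) / (w - w0)) \<le> 4 / s * g t" if "w \<in> ?B - {w0}" "t \<in> S" for w t
  proof -
    have "norm (f w t - f w0 t) \<le> (4 * g t / s) * norm (w - w0)"
    proof (rule field_differentiable_bound[where S = ?B and f' = "deriv (\<lambda>w. f w t)"])
      show "((\<lambda>w. f w t) has_field_derivative deriv (\<lambda>w. f w t) v) (at v within ?B)" if "v \<in> ?B" for v
      proof -
        have "v \<in> ball w0 s" using that s(1) by simp
        then have "v \<in> U" using s(2) by blast
        then show ?thesis
          using hol[OF \<open>t \<in> S\<close>] U(1) holomorphic_derivI by blast
      qed
      show "norm (deriv (\<lambda>w. f w t) v) \<le> 4 * g t / s" if "v \<in> ?B" for v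
        by (rule norm_deriv_le_on_half_ball[OF holomorphic_on_subset[OF hol[OF \<open>t \<in> S\<close>] s(2)]
              s(3)[OF _ \<open>t \<in> S\<close>] that])
    qed (use that s(1) in auto)
    then show ?thesis using that s(1) by (simp add: norm_divide divide_simps)
  qed
  have lim: "((\<lambda>w. (f w t - f w0 t) / (w - w0)) \<longlongrightarrow> ?D t) (at w0)" if "t \<in> S" for t
    using holomorphic_derivI[OF hol[OF that] U] by (simp add: has_field_derivative_iff)
  have w0: "w0 \<in> ?B" using s(1) by simp
  \<comment> \<open>Dominated convergence is a statement about sequences, so the limit w -> w0 is
    tested along arbitrary sequences in the half ball.\<close>
  have key: "?D integrable_on S \<and> (\<lambda>k. integral S (\<lambda>t. (f (X k) t - f w0 t) / (X k - w0))) \<longlonglongrightarrow> integral S ?D"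
    if X: "\<And>k. X k \<in> ?B - {w0}" "X \<longlonglongrightarrow> w0" for X
  proof -
    have 1: "(\<lambda>t. (f (X k) t - f w0 t) / (X k - w0)) integrable_on S" for k
    proof -
      have "X k \<in> ball w0 s" using X(1)[of k] s(1) by simp
      then have "X k \<in> U" using s(2) by blast
      then show ?thesis
        using int[of "X k"] int[of w0] U(2) integrable_on_divide integrable_diff by blast
    qed
    have 2: "(\<lambda>t. 4 / s * g t) integrable_on S" using integrable_on_cmult_left[OF g, of "4 / s"] by simp
    have 3: "norm ((f (X k) t - f w0 t) / (X k - w0)) \<le> 4 / s * g t" if "t \<in> S" for k t
      using quot X(1) that by blast
    have 4: "(\<lambda>k. (f (X k) t - f w0 t) / (X k - w0)) \<longlonglongrightarrow> ?D t" if "t \<in> S" for t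
      using lim[OF that] X by (auto simp: tendsto_at_iff_sequentially o_def)
    show ?thesis
      using dominated_convergence[of "\<lambda>k t. (f (X k) t - f w0 t) / (X k - w0)" S "\<lambda>t. 4 / s * g t" ?D, OF 1 2 3 4]
      by blast
  qed
  \<comment> \<open>Integrability of the limit \<open>?D\<close> follows from \<open>key\<close> as
    soon as one sequence tending to w0 is exhibited.\<close>
  define X0 where "X0 = (\<lambda>k::nat. w0 + complex_of_real (s / 4 * (1 / real (Suc k))))"
  have "X0 \<longlonglongrightarrow> w0 + complex_of_real (s / 4 * 0)"
    unfolding X0_def by (intro tendsto_intros LIMSEQ_Suc[OF lim_1_over_n])
  then have "X0 \<longlonglongrightarrow> w0" by simp
  moreover have "X0 k \<in> ?B - {w0}" for k
  proof -
    have "dist w0 (X0 k) = s / 4 * (1 / real (Suc k))"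
      using s(1) by (simp add: X0_def dist_norm norm_divide norm_mult del: of_nat_Suc)
    also have "\<dots> \<le> s / 4 * 1" using s(1) by (intro mult_left_mono) (auto simp: field_simps)
    finally show ?thesis using s(1) by (auto simp: X0_def simp del: of_nat_Suc)
  qed
  ultimately show "?D integrable_on S" using key by blast
  have "((\<lambda>w. (integral S (f w) - integral S (f w0)) / (w - w0)) \<longlongrightarrow> integral S ?D) (at w0 within ?B)"
    unfolding tendsto_at_iff_sequentially
  proof (intro allI impI)
    fix X assume X: "\<forall>i. X i \<in> ?B - {w0}" "X \<longlonglongrightarrow> w0"
    have eq: "integral S (\<lambda>t. (f (X k) t - f w0 t) / (X k - w0))
        = (integral S (f (X k)) - integral S (f w0)) / (X k - w0)" for k
    proof -
      have "X k \<in> ball w0 s" using X(1)[rule_format, of k] s(1) by simp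
      then have "X k \<in> U" using s(2) by blast
      then show ?thesis using int[of "X k"] int[of w0] U(2)
        by (simp add: Henstock_Kurzweil_Integration.integral_diff)
    qed
    have "(\<lambda>k. integral S (\<lambda>t. (f (X k) t - f w0 t) / (X k - w0))) \<longlonglongrightarrow> integral S ?D"
      using key X by blast
    then show "((\<lambda>w. (integral S (f w) - integral S (f w0)) / (w - w0)) \<circ> X) \<longlonglongrightarrow> integral S ?D"
      unfolding eq by (simp add: o_def)
  qed
  then show "((\<lambda>w. integral S (f w)) has_field_derivative integral S ?D) (at w0)"
    using w0 by (simp add: has_field_derivative_iff at_within_open[of w0 ?B])
qed

lemma holomorphic_on_integral:
  fixes f :: "complex \<Rightarrow> real \<Rightarrow> complex"
  assumes U: "open U"
    and hol: "\<And>t. t \<in> S \<Longrightarrow> (\<lambda>w. f w t) holomorphic_on U"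
    and int: "\<And>w. w \<in> U \<Longrightarrow> f w integrable_on S"
    and dom: "\<And>w0. w0 \<in> U \<Longrightarrow> \<exists>r>0. \<exists>g. g integrable_on S \<and>
                 (\<forall>w\<in>ball w0 r \<inter> U. \<forall>t\<in>S. norm (f w t) \<le> g t)"
  shows "(\<lambda>w. integral S (f w)) holomorphic_on U"
proof (rule holomorphic_onI)
  fix w0 assume w0: "w0 \<in> U"
  obtain r g where "r > 0" "g integrable_on S" "\<forall>w\<in>ball w0 r \<inter> U. \<forall>t\<in>S. norm (f w t) \<le> g t"
    using dom[OF w0] by blast
  then have "((\<lambda>w. integral S (f w)) has_field_derivative integral S (\<lambda>t. deriv (\<lambda>w. f w t) w0)) (at w0)"
    by (intro has_field_derivative_integral(2)[OF U w0 hol int]) auto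
  then show "(\<lambda>w. integral S (f w)) field_differentiable at w0 within U"
    by (meson field_differentiable_at_within field_differentiable_def)
qed

lemma sums_integral:
  fixes f :: "nat \<Rightarrow> real \<Rightarrow> 'a::euclidean_space"
  assumes f: "\<And>n. f n integrable_on S" and h: "h integrable_on S"
    and le: "\<And>N t. t \<in> S \<Longrightarrow> (\<Sum>n<N. norm (f n t)) \<le> h t"
  shows "(\<lambda>t. \<Sum>n. f n t) integrable_on S"
    and "(\<lambda>n. integral S (f n)) sums integral S (\<lambda>t. \<Sum>n. f n t)"
proof -
  have sm: "summable (\<lambda>n. f n t)" if "t \<in> S" for t
    by (rule summable_norm_cancel, rule summableI_nonneg_bounded[where x = "h t"]) (simp_all add: le that)
  have 1: "(\<lambda>t. \<Sum>n<N. f n t) integrable_on S" for N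
    by (intro integrable_sum f) auto
  have 2: "norm (\<Sum>n<N. f n t) \<le> h t" if "t \<in> S" for N t
    using norm_sum le[OF that] by (rule order_trans)
  have 3: "(\<lambda>N. \<Sum>n<N. f n t) \<longlonglongrightarrow> (\<Sum>n. f n t)" if "t \<in> S" for t
    using sm[OF that] by (rule summable_LIMSEQ)
  note dc = dominated_convergence[of "\<lambda>N t. \<Sum>n<N. f n t" S h "\<lambda>t. \<Sum>n. f n t", OF 1 h 2 3]
  show "(\<lambda>t. \<Sum>n. f n t) integrable_on S" using dc(1) by blast
  have "(\<lambda>N. integral S (\<lambda>t. \<Sum>n<N. f n t)) = (\<lambda>N. \<Sum>n<N. integral S (f n))"
    by (intro ext integral_sum f) auto
  then show "(\<lambda>n. integral S (f n)) sums integral S (\<lambda>t. \<Sum>n. f n t)"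
    using dc(2) by (simp add: sums_def)
qed

text \<open>The shape of all interchanges of sum and integral below: the index sits in a summable
  factor, the variable in an integrable one, for instance a power of n times a Gamma or beta
  density.\<close>

lemma sums_integral_majorized:
  fixes f :: "nat \<Rightarrow> real \<Rightarrow> 'a::euclidean_space"
  assumes f: "\<And>n. f n integrable_on S" and h: "h integrable_on S" and s: "summable s"
    and le: "\<And>n t. t \<in> S \<Longrightarrow> norm (f n t) \<le> s n * h t"
    and nonneg: "\<And>n. 0 \<le> s n" "\<And>t. t \<in> S \<Longrightarrow> 0 \<le> h t"
  shows "(\<lambda>t. \<Sum>n. f n t) integrable_on S"
    and "(\<lambda>n. integral S (f n)) sums integral S (\<lambda>t. \<Sum>n. f n t)"
proof -
  have int: "(\<lambda>t. suminf s * h t) integrable_on S"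
    using integrable_on_cmult_left[OF h, of "suminf s"] by simp
  have dom: "(\<Sum>n<N. norm (f n t)) \<le> suminf s * h t" if t: "t \<in> S" for N t
  proof -
    have "(\<Sum>n<N. norm (f n t)) \<le> (\<Sum>n<N. s n) * h t"
      unfolding sum_distrib_right using le[OF t] by (rule sum_mono)
    also have "\<dots> \<le> suminf s * h t"
      using nonneg t by (intro mult_right_mono sum_le_suminf s) auto
    finally show ?thesis .
  qed
  show "(\<lambda>t. \<Sum>n. f n t) integrable_on S"
    and "(\<lambda>n. integral S (f n)) sums integral S (\<lambda>t. \<Sum>n. f n t)"
    using sums_integral[OF f int dom] by blast+
qed

text \<open>Weierstrass majorants on small balls. The balls lie in S so that Cauchy's estimate
  applies on them; this makes the notion stable under differentiation, as the repeated lowering of c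
  demands.\<close>

definition locally_dominated :: "complex set \<Rightarrow> (nat \<Rightarrow> complex \<Rightarrow> complex) \<Rightarrow> bool" where
  "locally_dominated S f \<longleftrightarrow> (\<forall>x\<in>S. \<exists>d>0. \<exists>h. summable h \<and> ball x d \<subseteq> S \<and>
      (\<forall>n. \<forall>y\<in>ball x d. norm (f n y) \<le> h n))"

lemma locally_dominatedE:
  assumes "locally_dominated S f" "x \<in> S"
  obtains d h where "d > 0" "summable h" "ball x d \<subseteq> S" "\<forall>n. \<forall>y\<in>ball x d. norm (f n y) \<le> h n"
proof -
  from bspec[OF assms(1)[unfolded locally_dominated_def] assms(2)]
  obtain d h where "d > 0" "summable h" "ball x d \<subseteq> S" "\<forall>n. \<forall>y\<in>ball x d. norm (f n y) \<le> h n"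
    by (elim exE conjE)
  then show thesis by (rule that)
qed

lemma locally_dominated_summable:
  assumes "locally_dominated S f" "x \<in> S"
  shows "summable (\<lambda>n. f n x)"
proof -
  obtain d h where "d > 0" and h: "summable h" and le: "\<forall>n. \<forall>y\<in>ball x d. norm (f n y) \<le> h n"
    using assms by (rule locally_dominatedE)
  then have "norm (f n x) \<le> h n" for n by simp
  then show ?thesis by (rule summable_comparison_test'[OF h])
qed

lemma locally_dominated_cong:
  assumes dom: "locally_dominated S f" and eq: "\<And>n x. x \<in> S \<Longrightarrow> g n x = f n x"
  shows "locally_dominated S g"
  unfolding locally_dominated_def
proof
  fix x assume x: "x \<in> S"
  obtain d h where d: "d > 0" "summable h" "ball x d \<subseteq> S" "\<forall>n. \<forall>y\<in>ball x d. norm (f n y) \<le> h n"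
    using dom x by (rule locally_dominatedE)
  show "\<exists>d>0. \<exists>h. summable h \<and> ball x d \<subseteq> S \<and> (\<forall>n. \<forall>y\<in>ball x d. norm (g n y) \<le> h n)"
  proof (intro exI[of _ d] exI[of _ h] conjI allI ballI)
    fix n y assume y: "y \<in> ball x d"
    then have "y \<in> S" using d(3) by blast
    then show "norm (g n y) \<le> h n" using d(4) y eq by simp
  qed (use d in auto)
qed

text \<open>Half the radius and a factor 4/d in the majorant, by Cauchy's estimate.\<close>

lemma locally_dominated_deriv:
  assumes hol: "\<And>n. f n holomorphic_on S" and dom: "locally_dominated S f"
  shows "locally_dominated S (\<lambda>n. deriv (f n))"
  unfolding locally_dominated_def
proof
  fix x assume x: "x \<in> S"
  obtain d h where d: "d > 0" "summable h" "ball x d \<subseteq> S" "\<forall>n. \<forall>y\<in>ball x d. norm (f n y) \<le> h n"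
    using dom x by (rule locally_dominatedE)
  show "\<exists>d>0. \<exists>h. summable h \<and> ball x d \<subseteq> S \<and> (\<forall>n. \<forall>y\<in>ball x d. norm (deriv (f n) y) \<le> h n)"
  proof (intro exI[of _ "d / 2"] conjI exI[of _ "\<lambda>n. 4 * h n / d"] allI ballI)
    show "summable (\<lambda>n. 4 * h n / d)" using d(2) by (intro summable_divide summable_mult)
    show "ball x (d / 2) \<subseteq> S" using d(1) d(3) subset_ball[of "d / 2" d x] by simp
    show "norm (deriv (f n) y) \<le> 4 * h n / d" if "y \<in> ball x (d / 2)" for n y
      by (rule norm_deriv_le_on_half_ball[OF holomorphic_on_subset[OF hol d(3)] d(4)[rule_format] that])
  qed (use d(1) in simp)
qed

lemma locally_dominated_has_derivative:
  assumes S: "open S" and hol: "\<And>n. f n holomorphic_on S" and dom: "locally_dominated S f" and x: "x \<in> S"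
  shows "((\<lambda>x. \<Sum>n. f n x) has_field_derivative (\<Sum>n. deriv (f n) x)) (at x)"
proof -
  have "\<exists>g g'. \<forall>x\<in>S. ((\<lambda>n. f n x) sums g x) \<and> ((\<lambda>n. deriv (f n) x) sums g' x) \<and>
      (g has_field_derivative g' x) (at x)"
  proof (rule series_and_derivative_comparison_local[OF S])
    show "(f n has_field_derivative deriv (f n) x) (at x)" if "x \<in> S" for n x
      using holomorphic_derivI[OF hol S that] .
    show "\<exists>d h. 0 < d \<and> summable h \<and> (\<forall>\<^sub>F n in sequentially. \<forall>y\<in>ball x d \<inter> S. norm (f n y) \<le> h n)"
      if xS: "x \<in> S" for x
    proof -
      obtain d h where d: "d > 0" "summable h" and le: "\<forall>n. \<forall>y\<in>ball x d. norm (f n y) \<le> h n"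
        using dom xS by (rule locally_dominatedE)
      have "\<forall>\<^sub>F n in sequentially. \<forall>y\<in>ball x d \<inter> S. norm (f n y) \<le> h n"
        using le by (intro always_eventually) simp
      with d show ?thesis by blast
    qed
  qed
  then obtain g g' where g: "\<And>x. x \<in> S \<Longrightarrow> (\<lambda>n. f n x) sums g x"
    "\<And>x. x \<in> S \<Longrightarrow> (\<lambda>n. deriv (f n) x) sums g' x" "\<And>x. x \<in> S \<Longrightarrow> (g has_field_derivative g' x) (at x)"
    by blast
  have "((\<lambda>x. \<Sum>n. f n x) has_field_derivative g' x) (at x)"
    using g(3)[OF x] by (rule has_field_derivative_transform_within_open[OF _ S x])
      (use g(1) sums_unique in blast)
  then show ?thesis using g(2)[OF x] sums_unique by metis
qed

lemma locally_dominated_holomorphic: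
  assumes "open S" "\<And>n. f n holomorphic_on S" "locally_dominated S f"
  shows "(\<lambda>x. \<Sum>n. f n x) holomorphic_on S"
  using locally_dominated_has_derivative[OF assms] assms(1)
  by (meson holomorphic_on_open)

section \<open>The theta transformation\<close>

lemma has_integral_cos_of_int:
  "((\<lambda>\<theta>. cos (of_int k * \<theta>)) has_integral (if k = 0 then pi else 0)) {0..pi}"
proof (cases "k = 0")
  case True
  then show ?thesis using has_integral_const_real[of "1::real" 0 pi] by simp
next
  case False
  have "((\<lambda>\<theta>. cos (of_int k * \<theta>)) has_integral
      (sin (of_int k * pi) / of_int k - sin (of_int k * 0) / of_int k)) {0..pi}"
    using False
    by (intro fundamental_theorem_of_calculus)
       (auto intro!: derivative_eq_intros simp flip: has_real_derivative_iff_has_vector_derivative)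
  moreover have "sin (of_int k * pi) = 0"
    using sin_zero_iff_int2 by blast
  ultimately show ?thesis using False by simp
qed

lemma has_integral_cos_times_cos:
  "((\<lambda>\<theta>. cos (real j * \<theta>) * cos (real m * \<theta>)) has_integral
     (if j = m then if m = 0 then pi else pi / 2 else 0)) {0..pi}"
proof -
  have "((\<lambda>\<theta>. (cos (of_int (int j - int m) * \<theta>) + cos (of_int (int j + int m) * \<theta>)) / 2) has_integral
     ((if int j - int m = 0 then pi else 0) + (if int j + int m = 0 then pi else 0)) / 2) {0..pi}"
    by (intro has_integral_divide has_integral_add has_integral_cos_of_int)
  moreover have "(cos (of_int (int j - int m) * \<theta>) + cos (of_int (int j + int m) * \<theta>)) / 2
      = cos (real j * \<theta>) * cos (real m * \<theta>)" for \<theta>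
    by (simp add: cos_times_cos algebra_simps)
  moreover have "((if int j - int m = 0 then pi else 0) + (if int j + int m = 0 then pi else 0)) / 2
      = (if j = m then if m = 0 then pi else pi / 2 else 0)" by auto
  ultimately show ?thesis by simp
qed

text \<open>The powers of \<open>cos\<close> are combinations of the \<open>cos (m \<theta>)\<close>, and by Weierstrass every continuous
  function of \<open>\<theta> \<in> [0, \<pi>]\<close>, being a continuous function of \<open>cos \<theta>\<close>, is a uniform limit of
  polynomials in \<open>cos \<theta>\<close>.\<close>
lemma cosine_coefficients_zero_imp_zero:
  fixes h :: "real \<Rightarrow> real"
  assumes cont: "continuous_on {0..pi} h"
    and zero: "\<And>m::nat. integral {0..pi} (\<lambda>\<theta>. h \<theta> * cos (real m * \<theta>)) = 0"
    and \<theta>: "\<theta> \<in> {0..pi}"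
  shows "h \<theta> = 0"
proof -
  have int: "(\<lambda>\<theta>. h \<theta> * g \<theta>) integrable_on {0..pi}" if "continuous_on {0..pi} g" for g
    using cont that by (intro integrable_continuous_real continuous_intros)
  have pow: "integral {0..pi} (\<lambda>\<theta>. h \<theta> * (cos \<theta> ^ k * cos (real m * \<theta>))) = 0" for k m
  proof (induction k arbitrary: m)
    case 0
    then show ?case using zero by simp
  next
    case (Suc k)
    show ?case
    proof (cases m)
      \<comment> \<open>With m = 0 the additional factor cos \<theta> is read as cos (1 \<theta>),
        which is the induction hypothesis for m = 1.\<close>
      case 0
      then show ?thesis using Suc[of 1] by (simp add: mult_ac)
    next
      case (Suc j)
      have "cos \<theta> * cos (real m * \<theta>) = (cos (real j * \<theta>) + cos (real (Suc (Suc j)) * \<theta>)) / 2" for \<theta>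
      proof -
        have "real j * \<theta> = real m * \<theta> - \<theta>" "real (Suc (Suc j)) * \<theta> = real m * \<theta> + \<theta>"
          using Suc by (simp_all add: algebra_simps)
        then show ?thesis by (simp add: cos_diff cos_add)
      qed
      note cc = this
      have "h \<theta> * (cos \<theta> ^ Suc k * cos (real m * \<theta>)) =
        (h \<theta> * (cos \<theta> ^ k * cos (real j * \<theta>)) + h \<theta> * (cos \<theta> ^ k * cos (real (Suc (Suc j)) * \<theta>))) / 2" for \<theta>
      proof -
        have "h \<theta> * (cos \<theta> ^ Suc k * cos (real m * \<theta>)) = h \<theta> * cos \<theta> ^ k * (cos \<theta> * cos (real m * \<theta>))"
          by simp
        also have "\<dots> = (h \<theta> * (cos \<theta> ^ k * cos (real j * \<theta>)) +
            h \<theta> * (cos \<theta> ^ k * cos (real (Suc (Suc j)) * \<theta>))) / 2"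
          unfolding cc by (simp add: distrib_left)
        finally show ?thesis .
      qed
      then have "integral {0..pi} (\<lambda>\<theta>. h \<theta> * (cos \<theta> ^ Suc k * cos (real m * \<theta>))) =
        integral {0..pi} (\<lambda>\<theta>. (h \<theta> * (cos \<theta> ^ k * cos (real j * \<theta>)) +
          h \<theta> * (cos \<theta> ^ k * cos (real (Suc (Suc j)) * \<theta>))) / 2)" by presburger
      also have "\<dots> = (integral {0..pi} (\<lambda>\<theta>. h \<theta> * (cos \<theta> ^ k * cos (real j * \<theta>))) +
          integral {0..pi} (\<lambda>\<theta>. h \<theta> * (cos \<theta> ^ k * cos (real (Suc (Suc j)) * \<theta>)))) / 2"
        by (subst Henstock_Kurzweil_Integration.integral_add[symmetric])
          (auto intro!: int continuous_intros)
      finally show ?thesis unfolding Suc.IH by simp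
    qed
  qed
  have poly: "integral {0..pi} (\<lambda>\<theta>. h \<theta> * (\<Sum>i\<le>n. a i * cos \<theta> ^ i)) = 0" for n :: nat and a
  proof -
    have "integral {0..pi} (\<lambda>\<theta>. h \<theta> * (\<Sum>i\<le>n. a i * cos \<theta> ^ i)) =
        integral {0..pi} (\<lambda>\<theta>. \<Sum>i\<le>n. a i * (h \<theta> * (cos \<theta> ^ i * cos (real 0 * \<theta>))))"
      by (simp add: sum_distrib_left mult_ac)
    also have "\<dots> = (\<Sum>i\<le>n. a i * integral {0..pi} (\<lambda>\<theta>. h \<theta> * (cos \<theta> ^ i * cos (real 0 * \<theta>))))"
      by (subst integral_sum) (auto intro!: cont integrable_continuous_real continuous_intros)
    also have "\<dots> = 0" by (subst pow) simp
    finally show ?thesis .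
  qed
  obtain M where M: "M > 0" "\<And>\<theta>. \<theta> \<in> {0..pi} \<Longrightarrow> \<bar>h \<theta>\<bar> \<le> M"
  proof -
    have "bounded (h ` {0..pi})"
      using cont by (intro compact_imp_bounded compact_continuous_image) auto
    then show thesis using that unfolding bounded_pos by auto
  qed
  have small: "integral {0..pi} (\<lambda>\<theta>. h \<theta> * h \<theta>) \<le> e" if "e > 0" for e
  proof -
    have "continuous_on {-1..1} (h \<circ> arccos)"
      by (intro continuous_on_compose continuous_on_arccos' continuous_on_subset[OF cont])
        (auto intro: arccos_lbound arccos_ubound)
    \<comment> \<open>As h is orthogonal to p (cos \<theta>), the integral of h^2 is that of h (h -
      p (cos \<theta>)). It is at most pi M times the tolerance, so e / (M pi) yields e.\<close>
    then obtain p where p: "real_polynomial_function p"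
        "\<And>x. x \<in> {-1..1} \<Longrightarrow> \<bar>(h \<circ> arccos) x - p x\<bar> < e / (M * pi)"
      using Stone_Weierstrass_real_polynomial_function[of "{-1..1}" "h \<circ> arccos" "e / (M * pi)"] M(1) \<open>e > 0\<close>
      by auto
    obtain a n where pa: "p = (\<lambda>x. \<Sum>i\<le>n. a i * x ^ i)"
      using p(1) real_polynomial_function_iff_sum by blast
    have near: "\<bar>h \<theta> - p (cos \<theta>)\<bar> \<le> e / (M * pi)" if "\<theta> \<in> {0..pi}" for \<theta>
      using p(2)[of "cos \<theta>"] that by (simp add: arccos_cos less_imp_le)
    have cp: "continuous_on {0..pi} (\<lambda>\<theta>. p (cos \<theta>))" unfolding pa by (intro continuous_intros)
    have "integral {0..pi} (\<lambda>\<theta>. h \<theta> * h \<theta>) =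
        integral {0..pi} (\<lambda>\<theta>. h \<theta> * h \<theta>) - integral {0..pi} (\<lambda>\<theta>. h \<theta> * p (cos \<theta>))"
      using poly unfolding pa by simp
    also have "\<dots> = integral {0..pi} (\<lambda>\<theta>. h \<theta> * h \<theta> - h \<theta> * p (cos \<theta>))"
      by (rule Henstock_Kurzweil_Integration.integral_diff[symmetric]) (intro int cont cp)+
    also have "\<dots> \<le> integral {0..pi} (\<lambda>\<theta>. e / pi)"
    proof (rule integral_le)
      show "(\<lambda>\<theta>. h \<theta> * h \<theta> - h \<theta> * p (cos \<theta>)) integrable_on {0..pi}"
        by (intro integrable_diff int cont cp)
      fix \<theta> assume \<theta>: "\<theta> \<in> {0..pi}"
      have "h \<theta> * h \<theta> - h \<theta> * p (cos \<theta>) \<le> \<bar>h \<theta> * (h \<theta> - p (cos \<theta>))\<bar>"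
        by (simp add: right_diff_distrib)
      also have "\<dots> \<le> M * (e / (M * pi))"
        unfolding abs_mult using M near \<theta> by (intro mult_mono) auto
      also have "\<dots> = e / pi" using M(1) by simp
      finally show "h \<theta> * h \<theta> - h \<theta> * p (cos \<theta>) \<le> e / pi" .
    qed auto
    also have "\<dots> = e" by simp
    finally show ?thesis .
  qed
  have "integral {0..pi} (\<lambda>\<theta>. h \<theta> * h \<theta>) = 0"
  proof (rule antisym)
    show "integral {0..pi} (\<lambda>\<theta>. h \<theta> * h \<theta>) \<le> 0"
    proof (rule field_le_epsilon)
      show "integral {0..pi} (\<lambda>\<theta>. h \<theta> * h \<theta>) \<le> 0 + e" if "e > 0" for e
        using small[OF that] by simp
    qed
    show "0 \<le> integral {0..pi} (\<lambda>\<theta>. h \<theta> * h \<theta>)"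
      by (rule integral_nonneg[OF int[OF cont]]) simp
  qed
  moreover have "continuous_on {0..pi} (\<lambda>\<theta>. h \<theta> * h \<theta>)" by (intro continuous_intros cont)
  ultimately have "\<forall>\<theta>\<in>{0..pi}. h \<theta> * h \<theta> = 0"
    using integral_eq_0_iff[of 0 pi "\<lambda>\<theta>. h \<theta> * h \<theta>"] by simp
  then show ?thesis using \<theta> by simp
qed

text \<open>The real part of the characteristic function exp (- t^2 / 2) of the standard normal
  distribution at t = s/r, after the substitution x -> r x with r^2 = 2 q, which turns the exponent
  x^2 / 2 into q x^2.\<close>

lemma integral_gaussian_cos:
  fixes q s :: real
  assumes "q > 0"
  shows "((\<lambda>x. exp (- q * x\<^sup>2) * cos (s * x)) has_integral sqrt (pi / q) * exp (- s\<^sup>2 / (4 * q))) UNIV"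
proof -
  define r where "r = sqrt (2 * q)"
  have r: "r > 0" "r\<^sup>2 = 2 * q"
    using assms real_sqrt_gt_zero[of "2 * q"] real_sqrt_pow2[of "2 * q"] unfolding r_def by auto
  have int: "integrable lborel (\<lambda>x. std_normal_density x *\<^sub>R iexp (s / r * x))"
  proof (rule Bochner_Integration.integrable_bound[of lborel std_normal_density])
    show "integrable lborel std_normal_density" by simp
    show "(\<lambda>x. std_normal_density x *\<^sub>R iexp (s / r * x)) \<in> borel_measurable lborel" by measurable
    show "AE x in lborel. norm (std_normal_density x *\<^sub>R iexp (s / r * x)) \<le> norm (std_normal_density x)"
      by (rule AE_I2) (simp add: norm_exp_eq_Re)
  qed
  have "char std_normal_distribution (s / r) = (CLINT x|lborel. std_normal_density x *\<^sub>R iexp (s / r * x))"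
    unfolding char_def by (subst integral_density) auto
  then have "has_bochner_integral lborel (\<lambda>x. std_normal_density x *\<^sub>R iexp (s / r * x))
      (of_real (exp (- (s / r)\<^sup>2 / 2)))"
    using int by (simp add: char_std_normal_distribution has_bochner_integral_iff)
  from has_bochner_integral_bounded_linear[OF bounded_linear_Re this]
  have "has_bochner_integral lborel (\<lambda>x. std_normal_density x * cos (s / r * x)) (exp (- (s / r)\<^sup>2 / 2))"
    by (simp add: Re_exp)
  from lborel_has_bochner_integral_real_affine_iff[THEN iffD1, OF _ this, of r 0]
  have "has_bochner_integral lborel (\<lambda>x. std_normal_density (r * x) * cos (s / r * (r * x)))
      (exp (- (s / r)\<^sup>2 / 2) / r)"
    using r(1) by (simp add: inverse_eq_divide)
  then have "has_bochner_integral lborel (\<lambda>x. sqrt (2 * pi) * (std_normal_density (r * x) * cos (s / r * (r * x))))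
      (sqrt (2 * pi) * (exp (- (s / r)\<^sup>2 / 2) / r))"
    by (rule has_bochner_integral_mult_right)
  then have "has_bochner_integral lborel (\<lambda>x. exp (- q * x\<^sup>2) * cos (s * x))
      (sqrt (2 * pi) * (exp (- (s / r)\<^sup>2 / 2) / r))"
    using r by (simp add: normal_density_def power_mult_distrib mult_ac)
  moreover have "sqrt (2 * pi) * (exp (- (s / r)\<^sup>2 / 2) / r) = sqrt (pi / q) * exp (- s\<^sup>2 / (4 * q))"
    using assms r by (simp add: power_divide r_def real_sqrt_divide real_sqrt_mult)
  ultimately have "integrable lborel (\<lambda>x. exp (- q * x\<^sup>2) * cos (s * x))"
    "integral\<^sup>L lborel (\<lambda>x. exp (- q * x\<^sup>2) * cos (s * x)) = sqrt (pi / q) * exp (- s\<^sup>2 / (4 * q))"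
    by (simp_all add: has_bochner_integral_iff)
  then show ?thesis
    using has_integral_integral_lborel by metis
qed

text \<open>Half of the Gaussian integral, by evenness. Integers serve as endpoints because the
  unfolded integrals in the theta transformation telescope at integers.\<close>

lemma integral_gaussian_cos_at_top:
  fixes q s :: real
  assumes "q > 0"
  shows "(\<lambda>N. integral {0..real N} (\<lambda>x. exp (- q * x\<^sup>2) * cos (s * x)))
      \<longlonglongrightarrow> sqrt (pi / q) * exp (- s\<^sup>2 / (4 * q)) / 2"
proof -
  define g where "g = (\<lambda>x. exp (- q * x\<^sup>2) * cos (s * x))"
  define I where "I = sqrt (pi / q) * exp (- s\<^sup>2 / (4 * q))"
  have gI: "(g has_integral I) UNIV"
    unfolding g_def I_def by (rule integral_gaussian_cos[OF assms])
  have int: "g integrable_on {a..b}" for a b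
    unfolding g_def by (intro integrable_continuous_real continuous_intros)
  have even: "g (- x) = g x" for x by (simp add: g_def)
  have half: "integral {- real N..real N} g = 2 * integral {0..real N} g" for N
  proof -
    have "integral {- real N..real N} g = integral {- real N..0} g + integral {0..real N} g"
      by (subst Henstock_Kurzweil_Integration.integral_combine) (auto intro: int)
    also have "integral {- real N..0} g = integral {0..real N} g"
      using Henstock_Kurzweil_Integration.integral_reflect_real[of "real N" 0 g] even by simp
    finally show ?thesis by simp
  qed
  have "(\<lambda>N. integral {- real N..real N} g) \<longlonglongrightarrow> I"
  proof (rule LIMSEQ_I)
    fix e :: real assume "e > 0"
    then obtain B where B: "B > 0" "\<And>a b. ball 0 B \<subseteq> cbox a b \<Longrightarrow>
        \<exists>z. ((\<lambda>x. if x \<in> UNIV then g x else 0) has_integral z) (cbox a b) \<and> norm (z - I) < e"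
      using gI unfolding has_integral'[of g I UNIV] by metis
    obtain N0 where N0: "real N0 \<ge> B" using real_arch_simple by blast
    show "\<exists>no. \<forall>n\<ge>no. norm (integral {- real n..real n} g - I) < e"
    proof (intro exI allI impI)
      fix n assume "n \<ge> N0"
      then have "ball 0 B \<subseteq> cbox (- real n) (real n)" using N0 by (auto simp: dist_real_def)
      from B(2)[OF this] obtain z where "(g has_integral z) {- real n..real n}" "norm (z - I) < e" by auto
      then show "norm (integral {- real n..real n} g - I) < e" by (simp add: integral_unique)
    qed
  qed
  then have "(\<lambda>N. 2 * integral {0..real N} g / 2) \<longlonglongrightarrow> I / 2"
    unfolding half by (intro tendsto_intros) auto
  then show ?thesis by (simp add: g_def I_def)
qed

text \<open>The left side is the sum of exp (- q k^2) over all integers k, listed as the pairs k = n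
  and k = - (n + 1). It is the value at \<theta> = 0 of the periodization \<open>f\<close> of the
  Gaussian; the right side is the value at 0 of the cosine series \<open>Q\<close>. Both functions
  are continuous on [0, pi] and have the same cosine coefficients.\<close>

lemma theta_transformation:
  fixes q :: real
  assumes q: "q > 0"
  shows "(\<Sum>n. exp (- q * (real n)\<^sup>2) + exp (- q * (real (Suc n))\<^sup>2)) =
     sqrt (pi / q) * (1 + 2 * (\<Sum>m. exp (- pi\<^sup>2 * (real (Suc m))\<^sup>2 / q)))"
    and "summable (\<lambda>n. exp (- q * (real (Suc n))\<^sup>2))"
proof -
  have geo: "summable (\<lambda>n. exp (- c * real n))" if "c > 0" for c :: real
  proof -
    have "exp (- c * real n) = exp (- c) ^ n" for n
      using exp_of_nat_mult[of n "- c"] by (simp add: mult.commute)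
    then show ?thesis using that by (simp add: summable_geometric)
  qed
  have sq: "exp (- c * x\<^sup>2) \<le> exp (- c * real n)" if "c > 0" "real n + 1 / 2 \<le> x \<or> real n \<le> x" for c x n
  proof -
    have "real n \<le> (real n)\<^sup>2" by (cases n) (auto simp: power2_eq_square)
    also have "\<dots> \<le> x\<^sup>2" using that(2) by (intro power_mono) auto
    finally show ?thesis using that(1) by simp
  qed
  have sm: "summable (\<lambda>n. exp (- c * (real (Suc n))\<^sup>2))" if "c > 0" for c
    by (rule summable_comparison_test'[OF geo[OF that], of 0]) (use sq[OF that] in auto)
  then show "summable (\<lambda>n. exp (- q * (real (Suc n))\<^sup>2))" using q by blast
  define g where "g = (\<lambda>x. exp (- q * x\<^sup>2))"
  define e where "e = (\<lambda>m::nat. exp (- pi\<^sup>2 * (real m)\<^sup>2 / q))"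
  define A where "A = sqrt (pi / q)"
  \<comment> \<open>With u = \<theta> / (2 pi) the second summand is g (u - (n + 1)), as g is even;
    the sum over n is therefore the sum of g (k + u) over all integers k.\<close>
  define F where "F = (\<lambda>n \<theta>. g (real n + \<theta> / (2 * pi)) + g (real (Suc n) - \<theta> / (2 * pi)))"
  define f where "f = (\<lambda>\<theta>. \<Sum>n. F n \<theta>)"
  define C where "C = (\<lambda>m \<theta>. e (Suc m) * cos (real (Suc m) * \<theta>))"
  define Q where "Q = (\<lambda>\<theta>. A * (1 + 2 * (\<Sum>m. C m \<theta>)))"
  have F: "norm (F n \<theta>) \<le> 2 * exp (- q * real n)" if "\<theta> \<in> {0..pi}" for n \<theta>
  proof -
    have "0 \<le> \<theta> / (2 * pi)" "\<theta> / (2 * pi) \<le> 1 / 2" using that by (auto simp: field_simps)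
    then have "g (real n + \<theta> / (2 * pi)) \<le> exp (- q * real n)" "g (real (Suc n) - \<theta> / (2 * pi)) \<le> exp (- q * real n)"
      unfolding g_def by (intro sq q; simp)+
    moreover have "0 \<le> g x" for x by (simp add: g_def)
    ultimately show ?thesis by (simp add: F_def)
  qed
  have e: "summable e"
    unfolding e_def using sm[of "pi\<^sup>2 / q"] q by (subst summable_Suc_iff[symmetric]) simp
  have C: "norm (C n \<theta>) \<le> e (Suc n)" for n \<theta>
    by (simp add: C_def abs_mult e_def mult_left_le)
  have Fs: "summable (\<lambda>n. 2 * exp (- q * real n))" by (intro summable_mult geo q)
  have es: "summable (\<lambda>n. e (Suc n))" using e by (simp add: summable_Suc_iff)
  have cF: "continuous_on S (F n)" for n S
    unfolding F_def g_def by (intro continuous_intros) auto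
  have cC: "continuous_on S (C n)" for n S
    unfolding C_def by (intro continuous_intros)
  have cont_f: "continuous_on {0..pi} f"
    unfolding f_def
    by (rule uniform_limit_theorem[OF _ Weierstrass_m_test[OF F Fs]])
      (auto intro!: always_eventually continuous_on_sum cF)
  have "continuous_on {0..pi} (\<lambda>\<theta>. \<Sum>m. C m \<theta>)"
    by (rule uniform_limit_theorem[OF _ Weierstrass_m_test[OF C es]])
      (auto intro!: always_eventually continuous_on_sum cC)
  then have cont_Q: "continuous_on {0..pi} Q" unfolding Q_def by (intro continuous_intros)
  have coeff_f: "integral {0..pi} (\<lambda>\<theta>. f \<theta> * cos (real m * \<theta>)) = pi * (A * e m)" for m
  proof -
    define gc where "gc = (\<lambda>x. exp (- q * x\<^sup>2) * cos (2 * pi * real m * x))"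
    have cgc: "continuous_on S gc" for S unfolding gc_def by (intro continuous_intros)
    \<comment> \<open>A primitive of \<open>gc\<close>; the lower limit -1 makes t = 0 an interior
      point, where a two-sided derivative exists.\<close>
    define G where "G = (\<lambda>t. integral {-1..t} gc)"
    have G: "(G has_real_derivative gc t) (at t)" if "t \<ge> 0" for t
    proof -
      have "(G has_real_derivative gc t) (at t within {-1..t+1})"
        unfolding G_def using that by (intro integral_has_real_derivative cgc) auto
      then show ?thesis using that by (simp add: at_within_Icc_at)
    qed
    have trm: "((\<lambda>\<theta>. F n \<theta> * cos (real m * \<theta>)) has_integral 2 * pi * (G (real (Suc n)) - G (real n))) {0..pi}" for n
    proof -
      \<comment> \<open>As \<theta> runs over [0, pi], n + \<theta> / (2 pi) covers the left half of
        [n, n + 1] and n + 1 - \<theta> / (2 pi) the right half. The two arguments meet at \<theta>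
        = pi, so H pi = 0 and - H 0 is 2 pi times the integral of \<open>gc\<close> over
        [n, n + 1].\<close>
      define H where "H = (\<lambda>\<theta>. 2 * pi * (G (real n + \<theta> / (2 * pi)) - G (real (Suc n) - \<theta> / (2 * pi))))"
      have per: "cos (2 * pi * real m * (real k + \<theta> / (2 * pi))) = cos (real m * \<theta>)"
        "cos (2 * pi * real m * (real k - \<theta> / (2 * pi))) = cos (real m * \<theta>)" for k \<theta>
      proof -
        have "2 * pi * real m * (real k + \<theta> / (2 * pi)) = real m * \<theta> + 2 * pi * real (m * k)"
          "2 * pi * real m * (real k - \<theta> / (2 * pi)) = - (real m * \<theta>) + 2 * pi * real (m * k)"
          by (simp_all add: field_simps)
        moreover have "sin (2 * pi * real (m * k)) = 0" "cos (2 * pi * real (m * k)) = 1"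
          using sin_2npi[of "m * k"] cos_2npi[of "m * k"] by (simp_all only: mult.commute mult.left_commute)
        ultimately show "cos (2 * pi * real m * (real k + \<theta> / (2 * pi))) = cos (real m * \<theta>)"
          "cos (2 * pi * real m * (real k - \<theta> / (2 * pi))) = cos (real m * \<theta>)"
          by (simp_all only: cos_add) simp_all
      qed
      have "((\<lambda>\<theta>. F n \<theta> * cos (real m * \<theta>)) has_integral (H pi - H 0)) {0..pi}"
      proof (intro fundamental_theorem_of_calculus)
        fix \<theta> assume \<theta>: "\<theta> \<in> {0..pi}"
        then have b: "0 \<le> \<theta> / (2 * pi)" "\<theta> / (2 * pi) \<le> 1 / 2" by (auto simp: field_simps)
        have "(H has_real_derivative
            2 * pi * (gc (real n + \<theta> / (2 * pi)) * (1 / (2 * pi)) - gc (real (Suc n) - \<theta> / (2 * pi)) * (- (1 / (2 * pi)))))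
            (at \<theta> within {0..pi})"
        proof -
          have 1: "((\<lambda>\<theta>. G (real n + \<theta> / (2 * pi))) has_real_derivative gc (real n + \<theta> / (2 * pi)) * (1 / (2 * pi))) (at \<theta> within {0..pi})"
            using b(1) by (intro DERIV_chain2[OF G]) (auto intro!: derivative_eq_intros)
          have "0 \<le> real (Suc n) - \<theta> / (2 * pi)" using b(2) of_nat_Suc[of n, where 'a = real] by linarith
          then have 2: "((\<lambda>\<theta>. G (real (Suc n) - \<theta> / (2 * pi))) has_real_derivative gc (real (Suc n) - \<theta> / (2 * pi)) * (- (1 / (2 * pi)))) (at \<theta> within {0..pi})"
            by (intro DERIV_chain2[OF G]) (auto intro!: derivative_eq_intros)
          show ?thesis unfolding H_def by (intro DERIV_cmult DERIV_diff 1 2)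
        qed
        also have "2 * pi * (gc (real n + \<theta> / (2 * pi)) * (1 / (2 * pi)) - gc (real (Suc n) - \<theta> / (2 * pi)) * (- (1 / (2 * pi))))
            = F n \<theta> * cos (real m * \<theta>)"
          unfolding gc_def per F_def g_def by (simp add: field_simps)
        finally show "(H has_vector_derivative F n \<theta> * cos (real m * \<theta>)) (at \<theta> within {0..pi})"
          by (simp add: has_real_derivative_iff_has_vector_derivative)
      qed simp
      also have "H pi - H 0 = 2 * pi * (G (real (Suc n)) - G (real n))"
      proof -
        have "real (Suc n) - pi / (2 * pi) = real n + pi / (2 * pi)" by simp
        then show ?thesis by (simp add: H_def right_diff_distrib add.commute)
      qed
      finally show ?thesis .
    qed
    have "(\<lambda>n. integral {0..pi} (\<lambda>\<theta>. F n \<theta> * cos (real m * \<theta>))) sums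
        integral {0..pi} (\<lambda>\<theta>. \<Sum>n. F n \<theta> * cos (real m * \<theta>))"
    proof (rule sums_integral_majorized(2)[OF _ _ Fs, where h = "\<lambda>_. 1"])
      show "(\<lambda>\<theta>. F n \<theta> * cos (real m * \<theta>)) integrable_on {0..pi}" for n using trm by blast
      show "(\<lambda>_. 1 :: real) integrable_on {0..pi}" by (intro integrable_continuous_real continuous_on_const)
      fix n \<theta> assume \<theta>: "\<theta> \<in> {0..pi}"
      have "norm (F n \<theta> * cos (real m * \<theta>)) \<le> norm (F n \<theta>)"
        unfolding norm_mult by (simp add: mult_left_le)
      then show "norm (F n \<theta> * cos (real m * \<theta>)) \<le> 2 * exp (- q * real n) * 1" using F[OF \<theta>, of n] by linarith
    qed auto
    moreover have "integral {0..pi} (\<lambda>\<theta>. \<Sum>n. F n \<theta> * cos (real m * \<theta>)) = integral {0..pi} (\<lambda>\<theta>. f \<theta> * cos (real m * \<theta>))"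
    proof (rule Henstock_Kurzweil_Integration.integral_cong)
      fix \<theta> assume "\<theta> \<in> {0..pi}"
      then have "summable (\<lambda>n. F n \<theta>)" by (intro summable_comparison_test'[OF Fs F])
      then show "(\<Sum>n. F n \<theta> * cos (real m * \<theta>)) = f \<theta> * cos (real m * \<theta>)"
        unfolding f_def by (rule suminf_mult2[symmetric])
    qed
    ultimately have 1: "(\<lambda>n. 2 * pi * (G (real (Suc n)) - G (real n))) sums integral {0..pi} (\<lambda>\<theta>. f \<theta> * cos (real m * \<theta>))"
      using integral_unique[OF trm] by simp
    \<comment> \<open>The intervals [n, n + 1] join to [0, N], so that the coefficient becomes a
      limit of truncated Gaussian integrals.\<close>
    have "(\<Sum>n<N. 2 * pi * (G (real (Suc n)) - G (real n))) = 2 * pi * integral {0..real N} gc" for N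
    proof -
      have "(\<Sum>n<N. 2 * pi * (G (real (Suc n)) - G (real n))) = 2 * pi * (G (real N) - G 0)"
        by (simp add: sum_distrib_left[symmetric] sum_lessThan_telescope[of "\<lambda>n. G (real n)"] del: of_nat_Suc)
      also have "G (real N) = G 0 + integral {0..real N} gc"
        unfolding G_def
        by (rule Henstock_Kurzweil_Integration.integral_combine[symmetric])
          (auto intro!: integrable_continuous_real cgc)
      finally show ?thesis by simp
    qed
    with 1 have "(\<lambda>N. 2 * pi * integral {0..real N} gc) \<longlonglongrightarrow> integral {0..pi} (\<lambda>\<theta>. f \<theta> * cos (real m * \<theta>))"
      by (simp add: sums_def)
    moreover have "(\<lambda>N. 2 * pi * integral {0..real N} gc) \<longlonglongrightarrow> 2 * pi * (A * exp (- (2 * pi * real m)\<^sup>2 / (4 * q)) / 2)"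
      unfolding gc_def A_def by (intro tendsto_intros integral_gaussian_cos_at_top q)
    ultimately have "integral {0..pi} (\<lambda>\<theta>. f \<theta> * cos (real m * \<theta>)) = 2 * pi * (A * exp (- (2 * pi * real m)\<^sup>2 / (4 * q)) / 2)"
      using LIMSEQ_unique by blast
    also have "\<dots> = pi * (A * e m)"
      by (simp add: e_def power_mult_distrib)
    finally show ?thesis .
  qed
  have coeff_Q: "integral {0..pi} (\<lambda>\<theta>. Q \<theta> * cos (real m * \<theta>)) = pi * (A * e m)" for m
  proof -
    have hi: "((\<lambda>\<theta>. C n \<theta> * cos (real m * \<theta>)) has_integral e (Suc n) * (if Suc n = m then pi / 2 else 0)) {0..pi}" for n
    proof -
      have "((\<lambda>\<theta>. e (Suc n) * (cos (real (Suc n) * \<theta>) * cos (real m * \<theta>))) has_integral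
          e (Suc n) * (if Suc n = m then if m = 0 then pi else pi / 2 else 0)) {0..pi}"
        by (intro has_integral_mult_right has_integral_cos_times_cos)
      moreover have "(if Suc n = m then if m = 0 then pi else pi / 2 else 0) = (if Suc n = m then pi / 2 else 0)" by auto
      ultimately show ?thesis by (simp only: C_def mult.assoc)
    qed
    have 1: "(\<lambda>\<theta>. C n \<theta> * cos (real m * \<theta>)) integrable_on {0..pi}" for n using hi by blast
    have 2: "(\<lambda>_. 1 :: real) integrable_on {0..pi}" by (intro integrable_continuous_real continuous_on_const)
    have 3: "norm (C n \<theta> * cos (real m * \<theta>)) \<le> e (Suc n) * 1" for n \<theta>
    proof -
      have "norm (C n \<theta> * cos (real m * \<theta>)) \<le> norm (C n \<theta>)"
        unfolding norm_mult by (simp add: mult_left_le)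
      then show ?thesis using C[of n \<theta>] by linarith
    qed
    have 4: "0 \<le> e (Suc n)" for n by (simp add: e_def)
    note S = sums_integral_majorized[OF 1 2 es 3 4 zero_le_one]
    \<comment> \<open>Orthogonality leaves the term with n + 1 = m. For m = 0 there is none although
      m - 1 is 0 on the naturals, hence the nested case distinction.\<close>
    have "integral {0..pi} (\<lambda>\<theta>. C n \<theta> * cos (real m * \<theta>)) = (if n = m - 1 then if m = 0 then 0 else e m * (pi / 2) else 0)" for n
      using integral_unique[OF hi[of n]] by (cases m) auto
    then have "(\<lambda>n. integral {0..pi} (\<lambda>\<theta>. C n \<theta> * cos (real m * \<theta>))) sums (if m = 0 then 0 else e m * (pi / 2))"
      using sums_single[of "m - 1" "\<lambda>n. if m = 0 then 0 else e m * (pi / 2)"] by simp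
    with S(2) have I: "integral {0..pi} (\<lambda>\<theta>. \<Sum>n. C n \<theta> * cos (real m * \<theta>)) = (if m = 0 then 0 else e m * (pi / 2))"
      using sums_unique2 by blast
    have "((\<lambda>\<theta>. A * (cos (real 0 * \<theta>) * cos (real m * \<theta>) + 2 * (\<Sum>n. C n \<theta> * cos (real m * \<theta>)))) has_integral
        A * ((if 0 = m then if m = 0 then pi else pi / 2 else 0) + 2 * (if m = 0 then 0 else e m * (pi / 2)))) {0..pi}"
      by (intro has_integral_mult_right has_integral_add has_integral_cos_times_cos)
        (use S(1) I in \<open>auto simp: has_integral_integral\<close>)
    moreover have "A * (cos (real 0 * \<theta>) * cos (real m * \<theta>) + 2 * (\<Sum>n. C n \<theta> * cos (real m * \<theta>))) = Q \<theta> * cos (real m * \<theta>)" for \<theta>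
    proof -
      have "summable (\<lambda>n. C n \<theta>)" by (rule summable_comparison_test'[OF es C])
      then have "(\<Sum>n. C n \<theta> * cos (real m * \<theta>)) = (\<Sum>n. C n \<theta>) * cos (real m * \<theta>)"
        by (rule suminf_mult2[symmetric])
      then show ?thesis by (simp add: Q_def algebra_simps)
    qed
    ultimately have "integral {0..pi} (\<lambda>\<theta>. Q \<theta> * cos (real m * \<theta>)) =
        A * ((if 0 = m then if m = 0 then pi else pi / 2 else 0) + 2 * (if m = 0 then 0 else e m * (pi / 2)))"
      by (simp add: integral_unique)
    also have "\<dots> = pi * (A * e m)" by (simp add: e_def)
    finally show ?thesis .
  qed
  have "f 0 - Q 0 = 0"
  proof (rule cosine_coefficients_zero_imp_zero[of "\<lambda>\<theta>. f \<theta> - Q \<theta>"])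
    show "continuous_on {0..pi} (\<lambda>\<theta>. f \<theta> - Q \<theta>)" by (intro continuous_intros cont_f cont_Q)
    show "integral {0..pi} (\<lambda>\<theta>. (f \<theta> - Q \<theta>) * cos (real m * \<theta>)) = 0" for m
    proof -
      have "integral {0..pi} (\<lambda>\<theta>. f \<theta> * cos (real m * \<theta>) - Q \<theta> * cos (real m * \<theta>)) =
        integral {0..pi} (\<lambda>\<theta>. f \<theta> * cos (real m * \<theta>)) - integral {0..pi} (\<lambda>\<theta>. Q \<theta> * cos (real m * \<theta>))"
        by (intro Henstock_Kurzweil_Integration.integral_diff integrable_continuous_real continuous_intros cont_f cont_Q)
      then show ?thesis by (simp add: left_diff_distrib coeff_f coeff_Q)
    qed
  qed simp
  then show "(\<Sum>n. exp (- q * (real n)\<^sup>2) + exp (- q * (real (Suc n))\<^sup>2)) =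
     sqrt (pi / q) * (1 + 2 * (\<Sum>m. exp (- pi\<^sup>2 * (real (Suc m))\<^sup>2 / q)))"
    by (simp add: f_def F_def g_def Q_def C_def A_def e_def)
qed

section \<open>The Gauss hypergeometric function\<close>

text \<open>The last parameter \<open>d\<close> stands for c - b: convergence then reads Re b > 0
  and Re d > 0, and the contiguous relations shift \<open>b\<close> and \<open>d\<close>
  independently.\<close>

abbreviation euler_integrand :: "complex \<Rightarrow> complex \<Rightarrow> complex \<Rightarrow> complex \<Rightarrow> real \<Rightarrow> complex" where
  "euler_integrand \<xi> a b d t \<equiv> complex_of_real t powr (b - 1) * (1 - complex_of_real t) powr (d - 1) *
     (1 - complex_of_real t * \<xi>) powr (- a)"

abbreviation beta_density :: "real \<Rightarrow> real \<Rightarrow> real \<Rightarrow> real" where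
  "beta_density p r t \<equiv> t powr (p - 1) * (1 - t) powr (r - 1)"

definition euler_integral :: "complex \<Rightarrow> complex \<Rightarrow> complex \<Rightarrow> complex \<Rightarrow> complex" where
  "euler_integral \<xi> a b d = integral {0..1} (\<lambda>t. euler_integrand \<xi> a b d t)"

text \<open>1 - t \<xi> runs along the segment from 1 to 1 - \<xi>, and the slit plane is
  star-shaped about 1.\<close>

lemma one_minus_mult_notin_nonpos_Reals:
  assumes "1 - \<xi> \<notin> \<real>\<^sub>\<le>\<^sub>0" "t \<in> {0..1}"
  shows "1 - complex_of_real t * \<xi> \<notin> \<real>\<^sub>\<le>\<^sub>0"
proof
  assume *: "1 - complex_of_real t * \<xi> \<in> \<real>\<^sub>\<le>\<^sub>0"
  then have re: "1 \<le> t * Re \<xi>" and im: "t * Im \<xi> = 0"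
    by (auto simp: complex_nonpos_Reals_iff)
  from re have "t \<noteq> 0" by auto
  then have "Im \<xi> = 0" using im by simp
  moreover have "1 \<le> Re \<xi>"
  proof (rule ccontr)
    assume "\<not> 1 \<le> Re \<xi>"
    then have "t * Re \<xi> \<le> t * 1" using assms(2) by (intro mult_left_mono) auto
    then have "t = 1" using re assms(2) by auto
    then show False using re \<open>\<not> 1 \<le> Re \<xi>\<close> by simp
  qed
  ultimately show False using assms(1) by (auto simp: complex_nonpos_Reals_iff)
qed

lemma open_slit_plane: "open {\<xi>::complex. 1 - \<xi> \<notin> \<real>\<^sub>\<le>\<^sub>0}"
proof -
  have "{\<xi>::complex. 1 - \<xi> \<notin> \<real>\<^sub>\<le>\<^sub>0} = (\<lambda>\<xi>. 1 - \<xi>) -` (- \<real>\<^sub>\<le>\<^sub>0)" by auto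
  moreover have "open ((\<lambda>\<xi>. 1 - \<xi>) -` (- \<real>\<^sub>\<le>\<^sub>0 :: complex set))"
    by (intro open_vimage continuous_intros) (simp add: closed_nonpos_Reals_complex)
  ultimately show ?thesis by simp
qed

section \<open>Integrability of Euler's integrand and holomorphy of Euler's integral in all its
  parameters\<close>

lemma continuous_on_powr_slit:
  fixes f g :: "'a::topological_space \<Rightarrow> complex"
  assumes "\<And>x. x \<in> S \<Longrightarrow> f x \<notin> \<real>\<^sub>\<le>\<^sub>0" "continuous_on S f" "continuous_on S g"
  shows "continuous_on S (\<lambda>x. f x powr g x)"
proof (rule continuous_on_powr_complex[OF _ _ assms(2,3)])
  show "S \<subseteq> {x. 0 \<le> Re (f x) \<or> Im (f x) \<noteq> 0}"
    using assms(1) by (force simp: complex_nonpos_Reals_iff)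
  show "0 < Re (g x)" if "x \<in> S" "f x = 0" for x
    using assms(1)[OF that(1)] that(2) by simp
qed

lemma norm_beta_weight:
  assumes "t \<in> {0<..<1::real}"
  shows "norm (complex_of_real t powr (b - 1) * (1 - complex_of_real t) powr (d - 1)) =
    beta_density (Re b) (Re d) t"
proof -
  have "1 - complex_of_real t = complex_of_real (1 - t)" by simp
  then show ?thesis using assms by (simp only: norm_mult) (simp add: norm_powr_real_powr del: of_real_diff)
qed

lemma beta_weight_integrable:
  assumes "0 < p" "0 < r"
  shows "(\<lambda>t. M * beta_density p r t) integrable_on {0<..<1::real}"
proof -
  have "(\<lambda>t. beta_density p r t) integrable_on {0<..<1::real}"
    using integrable_Beta'[OF assms] by (simp add: integrable_on_Icc_iff_Ioo)
  from integrable_on_cmult_left[OF this, of M] show ?thesis by simp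
qed

lemma beta_weight_mono:
  assumes "t \<in> {0<..<1::real}" "p \<le> p'" "r \<le> r'"
  shows "beta_density p' r' t \<le> beta_density p r t"
  using assms by (intro mult_mono powr_mono') auto

lemma continuous_on_beta_weight:
  "continuous_on {0<..<1} (\<lambda>t. complex_of_real t powr (b - 1) * (1 - complex_of_real t) powr (d - 1))"
proof -
  have "1 - complex_of_real t \<notin> \<real>\<^sub>\<le>\<^sub>0" "complex_of_real t \<notin> \<real>\<^sub>\<le>\<^sub>0" if "t \<in> {0<..<1}" for t
    using that by (auto simp: complex_nonpos_Reals_iff)
  then show ?thesis by (intro continuous_intros) auto
qed

lemma euler_integrand_integrable:
  assumes "1 - \<xi> \<notin> \<real>\<^sub>\<le>\<^sub>0" "Re b > 0" "Re d > 0"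
  shows "(\<lambda>t. euler_integrand \<xi> a b d t) integrable_on {0<..<1}"
proof -
  have nz: "1 - complex_of_real t * \<xi> \<notin> \<real>\<^sub>\<le>\<^sub>0" if "t \<in> {0..1}" for t
    using one_minus_mult_notin_nonpos_Reals[OF assms(1) that] .
  have c: "continuous_on {0..1} (\<lambda>t. (1 - complex_of_real t * \<xi>) powr (- a))"
    using nz by (intro continuous_on_powr_slit continuous_intros)
  then have "bounded ((\<lambda>t. (1 - complex_of_real t * \<xi>) powr (- a)) ` {0..1})"
    by (intro compact_imp_bounded compact_continuous_image) auto
  then obtain M where M: "\<And>t. t \<in> {0..1} \<Longrightarrow> norm ((1 - complex_of_real t * \<xi>) powr (- a)) \<le> M"
    unfolding bounded_iff by blast
  show ?thesis
  proof (rule integrable_dominated(2)[OF _ _ beta_weight_integrable[OF assms(2,3), of M]])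
    show "continuous_on {0<..<1} (\<lambda>t. euler_integrand \<xi> a b d t)"
      by (intro continuous_on_mult continuous_on_beta_weight continuous_on_subset[OF c]) auto
    fix t :: real assume t: "t \<in> {0<..<1}"
    then show "norm (euler_integrand \<xi> a b d t) \<le> M * beta_density (Re b) (Re d) t"
      unfolding norm_mult[of "_ * _"] norm_beta_weight[OF t] using M[of t]
      by (subst mult.commute) (auto intro!: mult_right_mono)
  qed simp
qed

lemma euler_integral_Ioo:
  "euler_integral \<xi> a b d = integral {0<..<1} (\<lambda>t. euler_integrand \<xi> a b d t)"
  unfolding euler_integral_def by (simp add: integral_open_interval_real)

text \<open>The argument and all parameters are functions of one variable s, so that the same
  majorant serves for the derivative in \<xi> and for holomorphy in each parameter. Near s0 the real
  parts of \<open>B\<close> and \<open>D\<close> exceed half their values at s0, which gives a beta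
  density independent of s; the third factor is bounded by compactness of [0, 1] times a closed
  ball.\<close>

lemma euler_integrand_dominated:
  fixes X A B D :: "complex \<Rightarrow> complex"
  assumes U: "open U" "s0 \<in> U" and cont: "continuous_on U X" "continuous_on U A" "continuous_on U B" "continuous_on U D"
    and dom: "\<And>s. s \<in> U \<Longrightarrow> 1 - X s \<notin> \<real>\<^sub>\<le>\<^sub>0" and pos: "Re (B s0) > 0" "Re (D s0) > 0"
  obtains r g where "r > 0" "g integrable_on {0<..<1::real}"
    "\<And>s t. s \<in> ball s0 r \<Longrightarrow> s \<in> U \<Longrightarrow> t \<in> {0<..<1} \<Longrightarrow>
      norm (euler_integrand (X s) (A s) (B s) (D s) t) \<le> g t"
proof -
  have "isCont B s0" "isCont D s0" using U cont by (auto simp: continuous_on_eq_continuous_at)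
  then have "(\<lambda>s. Re (B s)) \<midarrow>s0\<rightarrow> Re (B s0)" "(\<lambda>s. Re (D s)) \<midarrow>s0\<rightarrow> Re (D s0)"
    unfolding isCont_def by (auto intro: tendsto_Re)
  then have "eventually (\<lambda>s. Re (B s) > Re (B s0) / 2) (at s0)" "eventually (\<lambda>s. Re (D s) > Re (D s0) / 2) (at s0)"
    using pos order_tendstoD(1)[of "\<lambda>s. Re (B s)" "Re (B s0)" "at s0" "Re (B s0) / 2"]
      order_tendstoD(1)[of "\<lambda>s. Re (D s)" "Re (D s0)" "at s0" "Re (D s0) / 2"] by auto
  then have "eventually (\<lambda>s. Re (B s) > Re (B s0) / 2 \<and> Re (D s) > Re (D s0) / 2) (nhds s0)"
    using pos by (auto simp: eventually_at_filter eventually_conj_iff elim: eventually_mono)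
  then obtain r1 where r1: "r1 > 0" "\<And>s. dist s s0 < r1 \<Longrightarrow> Re (B s) > Re (B s0) / 2 \<and> Re (D s) > Re (D s0) / 2"
    unfolding eventually_nhds_metric by blast
  obtain r2 where r2: "r2 > 0" "cball s0 r2 \<subseteq> U" using U open_contains_cball_eq by blast
  let ?f = "\<lambda>p. (1 - complex_of_real (fst p) * X (snd p)) powr (- A (snd p))"
  have nz: "1 - complex_of_real t * X s \<notin> \<real>\<^sub>\<le>\<^sub>0" if "t \<in> {0..1}" "s \<in> cball s0 r2" for t s
    using that r2 by (intro one_minus_mult_notin_nonpos_Reals dom) auto
  have c2: "continuous_on ({0..1} \<times> cball s0 r2) (\<lambda>p. X (snd p))" "continuous_on ({0..1} \<times> cball s0 r2) (\<lambda>p. A (snd p))"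
    using r2 cont by (auto intro!: continuous_on_compose2[of U _ _ snd] continuous_intros)
  have "continuous_on ({0..1} \<times> cball s0 r2) ?f"
    by (intro continuous_on_powr_slit continuous_intros c2) (use nz in auto)
  then have "bounded (?f ` ({0..1} \<times> cball s0 r2))"
    by (intro compact_imp_bounded compact_continuous_image compact_Times) auto
  then obtain M where M0: "\<And>p. p \<in> {0..1} \<times> cball s0 r2 \<Longrightarrow> norm (?f p) \<le> M"
    unfolding bounded_iff by blast
  have M: "norm ((1 - complex_of_real t * X s) powr (- A s)) \<le> M" if "t \<in> {0..1}" "s \<in> cball s0 r2" for t s
    using M0[of "(t, s)"] that by simp
  show thesis
  proof (rule that[of "min r1 r2" "\<lambda>t. M * beta_density (Re (B s0) / 2) (Re (D s0) / 2) t"])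
    show "min r1 r2 > 0" using r1 r2 by simp
    show "(\<lambda>t. M * beta_density (Re (B s0) / 2) (Re (D s0) / 2) t) integrable_on {0<..<1}"
      using pos by (intro beta_weight_integrable) auto
    fix s t assume s: "s \<in> ball s0 (min r1 r2)" and t: "t \<in> {0<..<1::real}"
    have f1: "norm ((1 - complex_of_real t * X s) powr (- A s)) \<le> M" using M[of t s] s t by auto
    have f2: "beta_density (Re (B s)) (Re (D s)) t \<le>
       beta_density (Re (B s0) / 2) (Re (D s0) / 2) t"
      using r1(2)[of s] s by (intro beta_weight_mono t) (auto simp: dist_commute)
    show "norm (euler_integrand (X s) (A s) (B s) (D s) t) \<le> M * beta_density (Re (B s0) / 2) (Re (D s0) / 2) t"
      unfolding norm_mult[of "_ * _"] norm_beta_weight[OF t] mult.commute[of M]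
      by (rule mult_mono[OF f2 f1]) auto
  qed
qed

lemma euler_integrand_holomorphic:
  assumes "X holomorphic_on U" "A holomorphic_on U" "B holomorphic_on U" "D holomorphic_on U"
    and dom: "\<And>s. s \<in> U \<Longrightarrow> 1 - X s \<notin> \<real>\<^sub>\<le>\<^sub>0" and t: "t \<in> {0<..<1::real}"
  shows "(\<lambda>s. euler_integrand (X s) (A s) (B s) (D s) t) holomorphic_on U"
proof -
  have "1 - complex_of_real t * X s \<notin> \<real>\<^sub>\<le>\<^sub>0" if "s \<in> U" for s
    using one_minus_mult_notin_nonpos_Reals[OF dom[OF that], of t] t by auto
  moreover have "1 - complex_of_real t \<notin> \<real>\<^sub>\<le>\<^sub>0" "complex_of_real t \<notin> \<real>\<^sub>\<le>\<^sub>0"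
    using t by (auto simp: complex_nonpos_Reals_iff)
  ultimately show ?thesis using assms(1-4) by (intro holomorphic_intros) auto
qed

lemma holomorphic_on_euler_integral:
  assumes U: "open U" and hol: "X holomorphic_on U" "A holomorphic_on U" "B holomorphic_on U" "D holomorphic_on U"
    and dom: "\<And>s. s \<in> U \<Longrightarrow> 1 - X s \<notin> \<real>\<^sub>\<le>\<^sub>0"
    and pos: "\<And>s. s \<in> U \<Longrightarrow> Re (B s) > 0" "\<And>s. s \<in> U \<Longrightarrow> Re (D s) > 0"
  shows "(\<lambda>s. euler_integral (X s) (A s) (B s) (D s)) holomorphic_on U"
  unfolding euler_integral_Ioo
proof (rule holomorphic_on_integral[OF U])
  fix s0 assume s0: "s0 \<in> U"
  obtain r g where "r > 0" "g integrable_on {0<..<1::real}"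
    "\<And>s t. s \<in> ball s0 r \<Longrightarrow> s \<in> U \<Longrightarrow> t \<in> {0<..<1} \<Longrightarrow>
      norm (euler_integrand (X s) (A s) (B s) (D s) t) \<le> g t"
    using euler_integrand_dominated[of U s0 X A B D thesis] U s0 hol holomorphic_on_imp_continuous_on dom pos
    by blast
  then show "\<exists>r>0. \<exists>g. g integrable_on {0<..<1::real} \<and> (\<forall>s\<in>ball s0 r \<inter> U. \<forall>t\<in>{0<..<1}.
      norm (euler_integrand (X s) (A s) (B s) (D s) t) \<le> g t)"
    by (intro exI[of _ r] conjI exI[of _ g] ballI) auto
qed (use euler_integrand_holomorphic[OF hol dom] euler_integrand_integrable dom pos in auto)

lemma euler_integral_has_field_derivative:
  assumes \<xi>: "1 - \<xi> \<notin> \<real>\<^sub>\<le>\<^sub>0" and pos: "Re b > 0" "Re d > 0"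
  shows "((\<lambda>\<xi>. euler_integral \<xi> a b d) has_field_derivative a * euler_integral \<xi> (a + 1) (b + 1) d) (at \<xi>)"
proof -
  define U where "U = {\<xi>::complex. 1 - \<xi> \<notin> \<real>\<^sub>\<le>\<^sub>0}"
  have U: "open U" "\<xi> \<in> U" using \<xi> open_slit_plane by (auto simp: U_def)
  have dom: "\<And>s. s \<in> U \<Longrightarrow> 1 - s \<notin> \<real>\<^sub>\<le>\<^sub>0" by (auto simp: U_def)
  let ?f = "\<lambda>s t. euler_integrand s a b d t"
  obtain r g where g: "r > 0" "g integrable_on {0<..<1::real}"
    "\<And>s t. s \<in> ball \<xi> r \<Longrightarrow> s \<in> U \<Longrightarrow> t \<in> {0<..<1} \<Longrightarrow> norm (?f s t) \<le> g t"
    using euler_integrand_dominated[of U \<xi> "\<lambda>s. s" "\<lambda>s. a" "\<lambda>s. b" "\<lambda>s. d" thesis] U dom pos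
      continuous_on_id continuous_on_const by blast
  have "((\<lambda>s. integral {0<..<1} (?f s)) has_field_derivative integral {0<..<1} (\<lambda>t. deriv (\<lambda>s. ?f s t) \<xi>)) (at \<xi>)"
  proof (rule has_field_derivative_integral(2)[OF U _ _ g(1,2)])
    show "(\<lambda>s. ?f s t) holomorphic_on U" if "t \<in> {0<..<1}" for t
      using euler_integrand_holomorphic[of "\<lambda>s. s" U "\<lambda>s. a" "\<lambda>s. b" "\<lambda>s. d" t] that dom by auto
    show "?f s integrable_on {0<..<1}" if "s \<in> U" for s
      using euler_integrand_integrable[OF dom[OF that] pos] .
  qed (use g(3) in auto)
  also have "integral {0<..<1} (\<lambda>t. deriv (\<lambda>s. ?f s t) \<xi>) = integral {0<..<1} (\<lambda>t. a * euler_integrand \<xi> (a + 1) (b + 1) d t)"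
  proof (rule Henstock_Kurzweil_Integration.integral_cong, rule DERIV_imp_deriv)
    fix t :: real assume t: "t \<in> {0<..<1}"
    have "1 - complex_of_real t * \<xi> \<notin> \<real>\<^sub>\<le>\<^sub>0" using one_minus_mult_notin_nonpos_Reals[OF \<xi>, of t] t by auto
    then have D: "((\<lambda>s. (1 - complex_of_real t * s) powr (- a)) has_field_derivative
        (- a * (1 - complex_of_real t * \<xi>) powr (- a - 1)) * (- complex_of_real t)) (at \<xi>)"
      by (intro DERIV_chain2[where f = "\<lambda>u. u powr (- a)", OF has_field_derivative_powr])
        (auto intro!: derivative_eq_intros)
    have "complex_of_real t powr b = complex_of_real t * complex_of_real t powr (b - 1)"
      using t by (simp add: powr_diff)
    then have eq: "complex_of_real t powr (b - 1) * (1 - complex_of_real t) powr (d - 1) * ((- a * (1 - complex_of_real t * \<xi>) powr (- a - 1)) * (- complex_of_real t))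
      = a * euler_integrand \<xi> (a + 1) (b + 1) d t"
      by (simp add: mult_ac)
    from DERIV_cmult[OF D, of "complex_of_real t powr (b - 1) * (1 - complex_of_real t) powr (d - 1)"]
    show "((\<lambda>s. ?f s t) has_field_derivative a * euler_integrand \<xi> (a + 1) (b + 1) d t) (at \<xi>)"
      unfolding eq .
  qed
  finally show ?thesis by (simp add: euler_integral_Ioo)
qed

text \<open>The integral over [0, 1] of the derivative of t^b (1 - t)^d (1 - t \<xi>)^(-a), which
  vanishes at both ends as Re b > 0 and Re d > 0.\<close>

lemma euler_integral_by_parts:
  assumes \<xi>: "1 - \<xi> \<notin> \<real>\<^sub>\<le>\<^sub>0" and pos: "Re b > 0" "Re d > 0"
  shows "b * euler_integral \<xi> a b (d + 1) - d * euler_integral \<xi> a (b + 1) d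
    + a * \<xi> * euler_integral \<xi> (a + 1) (b + 1) (d + 1) = 0"
proof -
  let ?w = "\<lambda>a b d t. euler_integrand \<xi> a b d t"
  let ?\<Phi> = "\<lambda>t. complex_of_real t powr b * (1 - complex_of_real t) powr d * (1 - complex_of_real t * \<xi>) powr (- a)"
  have nz: "1 - complex_of_real t * \<xi> \<notin> \<real>\<^sub>\<le>\<^sub>0" if "t \<in> {0..1}" for t
    using one_minus_mult_notin_nonpos_Reals[OF \<xi> that] .
  have "((\<lambda>t. b * ?w a b (d + 1) t - d * ?w a (b + 1) d t + a * \<xi> * ?w (a + 1) (b + 1) (d + 1) t)
      has_integral (?\<Phi> 1 - ?\<Phi> 0)) {0..1}"
  proof (rule fundamental_theorem_of_calculus_interior)
    have "continuous_on {0..1} (\<lambda>t. complex_of_real t powr b)" "continuous_on {0..1} (\<lambda>t. (1 - complex_of_real t) powr d)"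
      using pos by (auto intro!: continuous_on_powr_complex continuous_intros)
    moreover have "continuous_on {0..1} (\<lambda>t. (1 - complex_of_real t * \<xi>) powr (- a))"
      using nz by (intro continuous_on_powr_slit continuous_intros)
    ultimately show "continuous_on {0..1} ?\<Phi>" by (intro continuous_on_mult)
    fix t :: real assume t: "t \<in> {0<..<1}"
    have n: "complex_of_real t \<notin> \<real>\<^sub>\<le>\<^sub>0" "1 - complex_of_real t \<notin> \<real>\<^sub>\<le>\<^sub>0" "1 - complex_of_real t * \<xi> \<notin> \<real>\<^sub>\<le>\<^sub>0"
      using t nz[of t] by (auto simp: complex_nonpos_Reals_iff)
    have "((\<lambda>u. u powr b * (1 - u) powr d * (1 - u * \<xi>) powr (- a)) has_field_derivative
       (b * complex_of_real t powr (b - 1)) * (1 - complex_of_real t) powr d * (1 - complex_of_real t * \<xi>) powr (- a)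
       + complex_of_real t powr b * (- (d * (1 - complex_of_real t) powr (d - 1))) * (1 - complex_of_real t * \<xi>) powr (- a)
       + complex_of_real t powr b * (1 - complex_of_real t) powr d * (a * \<xi> * (1 - complex_of_real t * \<xi>) powr (- a - 1)))
       (at (complex_of_real t))"
      using n by (auto intro!: derivative_eq_intros simp: algebra_simps)
    note D = has_vector_derivative_real_field[OF this, of UNIV]
    have m: "- (a + 1) = - a - 1" by simp
    show "(?\<Phi> has_vector_derivative
        b * ?w a b (d + 1) t - d * ?w a (b + 1) d t + a * \<xi> * ?w (a + 1) (b + 1) (d + 1) t) (at t)"
      unfolding m using D by (simp add: algebra_simps)
  qed simp
  then have I: "((\<lambda>t. b * ?w a b (d + 1) t - d * ?w a (b + 1) d t + a * \<xi> * ?w (a + 1) (b + 1) (d + 1) t)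
      has_integral 0) {0<..<1}"
    using pos by (simp add: has_integral_Icc_iff_Ioo)
  have "Re (b + 1) > 0" "Re (d + 1) > 0" using pos by auto
  note int = euler_integrand_integrable[OF \<xi>, THEN integrable_integral]
  have "((\<lambda>t. b * ?w a b (d + 1) t - d * ?w a (b + 1) d t + a * \<xi> * ?w (a + 1) (b + 1) (d + 1) t)
      has_integral (b * euler_integral \<xi> a b (d + 1) - d * euler_integral \<xi> a (b + 1) d
    + a * \<xi> * euler_integral \<xi> (a + 1) (b + 1) (d + 1))) {0<..<1}"
    unfolding euler_integral_Ioo
    by (intro has_integral_add has_integral_diff has_integral_mult_right int) (use pos in auto)
  with I show ?thesis using has_integral_unique by blast
qed

text \<open>Insert 1 = t + (1 - t) into the integrand.\<close>

lemma euler_integral_split: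
  assumes \<xi>: "1 - \<xi> \<notin> \<real>\<^sub>\<le>\<^sub>0" and pos: "Re b > 0" "Re d > 0"
  shows "euler_integral \<xi> a b d = euler_integral \<xi> a (b + 1) d + euler_integral \<xi> a b (d + 1)"
proof -
  note int = euler_integrand_integrable[OF \<xi>]
  have "euler_integral \<xi> a (b + 1) d + euler_integral \<xi> a b (d + 1) = integral {0<..<1}
     (\<lambda>t. euler_integrand \<xi> a (b + 1) d t
        + euler_integrand \<xi> a b (d + 1) t)"
    unfolding euler_integral_Ioo
    by (rule Henstock_Kurzweil_Integration.integral_add[symmetric]) (use int[of "b + 1" d a] int[of b "d + 1" a] pos in simp_all)
  also have "\<dots> = euler_integral \<xi> a b d"
    unfolding euler_integral_Ioo
  proof (rule Henstock_Kurzweil_Integration.integral_cong)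
    fix t :: real assume t: "t \<in> {0<..<1}"
    then have "1 - complex_of_real t \<noteq> 0" "complex_of_real t \<noteq> 0" by auto
    then have *: "complex_of_real t powr b = complex_of_real t powr (b - 1) * complex_of_real t"
      "(1 - complex_of_real t) powr d = (1 - complex_of_real t) powr (d - 1) * (1 - complex_of_real t)"
      by (simp_all add: powr_diff)
    show "euler_integrand \<xi> a (b + 1) d t
        + euler_integrand \<xi> a b (d + 1) t
      = euler_integrand \<xi> a b d t"
      by (simp only: add_diff_cancel_right' *) (simp add: algebra_simps)
  qed
  finally show ?thesis ..
qed

text \<open>\<open>beta_ext \<xi> N a b d\<close> continues \<open>\<^sub>2F\<^sub>1(a, b; b + d; \<xi>) / \<Gamma>(b + d)\<close> from \<open>Re b, Re d > 0\<close> to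
  \<open>Re b, Re d > -N\<close> by means of two contiguous relations, of which the first raises \<open>b\<close> and the
  second \<open>d\<close>.\<close>
primrec beta_ext :: "complex \<Rightarrow> nat \<Rightarrow> complex \<Rightarrow> complex \<Rightarrow> complex \<Rightarrow> complex" where
  "beta_ext \<xi> 0 a b d = rGamma b * rGamma d * euler_integral \<xi> a b d"
| "beta_ext \<xi> (Suc N) a b d =
     (b + d) * ((b + d + 1) * beta_ext \<xi> N a (b + 1) (d + 1) + a * (b + 1) * \<xi> * beta_ext \<xi> N (a + 1) (b + 2) (d + 1))
     - a * d * \<xi> * beta_ext \<xi> N (a + 1) (b + 1) (d + 1)"

text \<open>Eliminating the integral at (b + 1, d) between integration by parts and splitting leaves
  a relation with d raised in every term on the right. The reciprocal Gamma factors absorb d on the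
  left and give the factor b in the last term.\<close>

lemma beta_ext_0_raise_d:
  assumes \<xi>: "1 - \<xi> \<notin> \<real>\<^sub>\<le>\<^sub>0" and pos: "Re b > 0" "Re d > 0"
  shows "beta_ext \<xi> 0 a b d = (b + d) * beta_ext \<xi> 0 a b (d + 1) + a * b * \<xi> * beta_ext \<xi> 0 (a + 1) (b + 1) (d + 1)"
proof -
  have "d * euler_integral \<xi> a b d = (b + d) * euler_integral \<xi> a b (d + 1) + a * \<xi> * euler_integral \<xi> (a + 1) (b + 1) (d + 1)"
    using euler_integral_by_parts[OF assms, of a] euler_integral_split[OF assms, of a] by (simp add: algebra_simps)
  note * = this
  have rb: "rGamma b = b * rGamma (b + 1)" and rd: "rGamma d = d * rGamma (d + 1)"
    by (simp_all add: rGamma_plus1)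
  have "beta_ext \<xi> 0 a b d = rGamma b * rGamma (d + 1) * (d * euler_integral \<xi> a b d)"
    by (simp add: rd)
  also have "\<dots> = (b + d) * beta_ext \<xi> 0 a b (d + 1) + a * b * \<xi> * beta_ext \<xi> 0 (a + 1) (b + 1) (d + 1)"
    unfolding * by (simp add: rb algebra_simps)
  finally show ?thesis .
qed

text \<open>The same elimination, now of the integral at (b, d + 1), so that b is raised in every
  term.\<close>

lemma beta_ext_0_raise_b:
  assumes \<xi>: "1 - \<xi> \<notin> \<real>\<^sub>\<le>\<^sub>0" and pos: "Re b > 0" "Re d > 0"
  shows "beta_ext \<xi> 0 a b d = (b + d) * beta_ext \<xi> 0 a (b + 1) d - a * d * \<xi> * beta_ext \<xi> 0 (a + 1) (b + 1) (d + 1)"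
proof -
  have "b * euler_integral \<xi> a b d = (b + d) * euler_integral \<xi> a (b + 1) d - a * \<xi> * euler_integral \<xi> (a + 1) (b + 1) (d + 1)"
    using euler_integral_by_parts[OF assms, of a] euler_integral_split[OF assms, of a] by (simp add: algebra_simps)
  note * = this
  have rb: "rGamma b = b * rGamma (b + 1)" and rd: "rGamma d = d * rGamma (d + 1)"
    by (simp_all add: rGamma_plus1)
  have "beta_ext \<xi> 0 a b d = rGamma (b + 1) * rGamma d * (b * euler_integral \<xi> a b d)"
    by (simp add: rb)
  also have "\<dots> = (b + d) * beta_ext \<xi> 0 a (b + 1) d - a * d * \<xi> * beta_ext \<xi> 0 (a + 1) (b + 1) (d + 1)"
    unfolding * by (simp add: rd algebra_simps)
  finally show ?thesis .
qed

text \<open>For N = 0 this is the relation that raises b, followed in its first term by the one that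
  raises d. For larger N both sides unfold by the same recursion to arguments with real parts raised
  by at least 1, where the induction hypothesis applies.\<close>

lemma beta_ext_Suc:
  assumes \<xi>: "1 - \<xi> \<notin> \<real>\<^sub>\<le>\<^sub>0" and "Re b > - real N" "Re d > - real N"
  shows "beta_ext \<xi> (Suc N) a b d = beta_ext \<xi> N a b d"
  using assms(2,3)
proof (induction N arbitrary: a b d)
  case 0
  then have 1: "Re b > 0" "Re d > 0" by auto
  have 2: "Re (b + 1) > 0" using 1 by simp
  show ?case
    unfolding beta_ext.simps(2)[of _ 0] beta_ext_0_raise_b[OF \<xi> 1, of a] beta_ext_0_raise_d[OF \<xi> 2 1(2), of a]
    by (simp add: algebra_simps del: beta_ext.simps)
next
  case (Suc N)
  then have "Re (b + 1) > - real N" "Re (b + 2) > - real N" "Re (d + 1) > - real N" by auto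
  then show ?case
    unfolding beta_ext.simps(2)[of _ "Suc N"] beta_ext.simps(2)[of _ N a b d] by (simp only: Suc.IH)
qed

lemma beta_ext_add:
  assumes \<xi>: "1 - \<xi> \<notin> \<real>\<^sub>\<le>\<^sub>0" and "Re b > - real N" "Re d > - real N"
  shows "beta_ext \<xi> (N + k) a b d = beta_ext \<xi> N a b d"
proof (induction k)
  case (Suc k)
  then show ?case using beta_ext_Suc[OF \<xi>, of "N + k" b d a] assms by simp
qed simp

lemma holomorphic_on_beta_ext:
  assumes \<xi>: "1 - \<xi> \<notin> \<real>\<^sub>\<le>\<^sub>0" and U: "open U"
    and "A holomorphic_on U" "B holomorphic_on U" "D holomorphic_on U"
    and "\<And>s. s \<in> U \<Longrightarrow> Re (B s) > - real N" "\<And>s. s \<in> U \<Longrightarrow> Re (D s) > - real N"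
  shows "(\<lambda>s. beta_ext \<xi> N (A s) (B s) (D s)) holomorphic_on U"
  using assms(3-)
proof (induction N arbitrary: A B D)
  case 0
  then show ?case
    unfolding beta_ext.simps
    by (intro holomorphic_intros holomorphic_on_euler_integral[OF U]) (use \<xi> in auto)
next
  case (Suc N)
  show ?case
    unfolding beta_ext.simps
    by (intro holomorphic_intros Suc.IH Suc.prems(1-3))
      (use Suc.prems(4,5) in \<open>fastforce simp: algebra_simps\<close>)+
qed

text \<open>The level lies beyond both - Re b and - Re (c - b). Since all sufficiently high levels
  agree, the function coincides locally with one fixed level, and holomorphy is inherited from
  there.\<close>

definition hyp2F1_ext :: "complex \<Rightarrow> complex \<Rightarrow> complex \<Rightarrow> complex \<Rightarrow> complex" where
  "hyp2F1_ext \<xi> a b c = beta_ext \<xi> (Suc (nat \<lceil>max (- Re b) (- Re (c - b))\<rceil>)) a b (c - b)"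

lemma hyp2F1_ext_eq:
  assumes \<xi>: "1 - \<xi> \<notin> \<real>\<^sub>\<le>\<^sub>0" and N: "Re b > - real N" "Re (c - b) > - real N"
  shows "hyp2F1_ext \<xi> a b c = beta_ext \<xi> N a b (c - b)"
proof -
  define K where "K = Suc (nat \<lceil>max (- Re b) (- Re (c - b))\<rceil>)"
  have "max (- Re b) (- Re (c - b)) < real K" unfolding K_def by linarith
  then have K: "Re b > - real K" "Re (c - b) > - real K" by auto
  have "beta_ext \<xi> K a b (c - b) = beta_ext \<xi> (K + N) a b (c - b)"
    using beta_ext_add[OF \<xi> K] by simp
  also have "\<dots> = beta_ext \<xi> N a b (c - b)"
    using beta_ext_add[OF \<xi> N, of K] by (simp add: add.commute)
  finally show ?thesis by (simp add: hyp2F1_ext_def K_def)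
qed

lemma holomorphic_on_hyp2F1_ext:
  assumes \<xi>: "1 - \<xi> \<notin> \<real>\<^sub>\<le>\<^sub>0" and hol: "A holomorphic_on UNIV" "B holomorphic_on UNIV" "C holomorphic_on UNIV"
  shows "(\<lambda>s. hyp2F1_ext \<xi> (A s) (B s) (C s)) holomorphic_on UNIV"
proof -
  define U where "U N = {s. Re (B s) > - real N} \<inter> {s. Re (C s - B s) > - real N}" for N
  have "open (U N)" for N
    unfolding U_def using hol
    by (intro open_Int open_Collect_less continuous_intros holomorphic_on_imp_continuous_on)
  moreover have "(\<lambda>s. hyp2F1_ext \<xi> (A s) (B s) (C s)) holomorphic_on U N" for N
  proof (rule holomorphic_transform)
    show "(\<lambda>s. beta_ext \<xi> N (A s) (B s) (C s - B s)) holomorphic_on U N"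
      using \<open>open (U N)\<close> hol
      by (intro holomorphic_on_beta_ext[OF \<xi>] holomorphic_intros) (auto simp: U_def intro: holomorphic_on_subset)
  qed (use hyp2F1_ext_eq[OF \<xi>] in \<open>auto simp: U_def\<close>)
  ultimately have "(\<lambda>s. hyp2F1_ext \<xi> (A s) (B s) (C s)) holomorphic_on (\<Union>N. U N)"
    by (intro holomorphic_on_UN_open) auto
  moreover have "(\<Union>N. U N) = UNIV"
  proof (intro equalityI subsetI UNIV_I)
    fix s
    obtain N where "max (- Re (B s)) (- Re (C s - B s)) < real N" using reals_Archimedean2 by blast
    then have "s \<in> U N" by (auto simp: U_def)
    then show "s \<in> (\<Union>N. U N)" by blast
  qed
  ultimately show ?thesis by simp
qed

text \<open>\<open>hyp2F1_reg\<close> is a definite description, about which nothing is known until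
  some function with the property exists; \<open>hyp2F1_ext\<close> is such a function.\<close>

lemma is_hyp2F1_reg_hyp2F1_reg:
  assumes \<xi>: "1 - \<xi> \<notin> \<real>\<^sub>\<le>\<^sub>0"
  shows "is_hyp2F1_reg \<xi> (\<lambda>a b c. hyp2F1_reg a b c \<xi>)"
proof -
  have "is_hyp2F1_reg \<xi> (hyp2F1_ext \<xi>)"
    unfolding is_hyp2F1_reg_def
  proof (intro conjI allI impI)
    fix a b c assume "0 < Re b \<and> Re b < Re c"
    then have "hyp2F1_ext \<xi> a b c = beta_ext \<xi> 0 a b (c - b)" by (intro hyp2F1_ext_eq[OF \<xi>]) auto
    then show "hyp2F1_ext \<xi> a b c = 1 / (Gamma b * Gamma (c - b)) *
        integral {0..1} (\<lambda>t. euler_integrand \<xi> a b (c - b) t)"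
      by (simp add: euler_integral_def rGamma_inverse_Gamma divide_inverse)
  qed (intro holomorphic_on_hyp2F1_ext[OF \<xi>] holomorphic_intros)+
  then have "\<exists>!g. is_hyp2F1_reg \<xi> g" using is_hyp2F1_reg_unique by blast
  from theI'[OF this] show ?thesis unfolding hyp2F1_reg_def .
qed

section \<open>Contiguous relation and derivative of the Gauss function for an arbitrary third
  parameter\<close>

lemma hyp2F1_reg_Euler:
  assumes "1 - \<xi> \<notin> \<real>\<^sub>\<le>\<^sub>0" "0 < Re b" "Re b < Re c"
  shows "hyp2F1_reg a b c \<xi> = rGamma b * rGamma (c - b) * euler_integral \<xi> a b (c - b)"
  using is_hyp2F1_reg_hyp2F1_reg[OF assms(1)] assms(2,3)
  by (simp add: is_hyp2F1_reg_def euler_integral_def rGamma_inverse_Gamma divide_inverse)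

text \<open>For Re c > Re b this is the relation that raises d = c - b; both sides are entire in
  c.\<close>

lemma hyp2F1_reg_contiguous:
  assumes \<xi>: "1 - \<xi> \<notin> \<real>\<^sub>\<le>\<^sub>0" and b: "0 < Re b"
  shows "hyp2F1_reg a b c \<xi> = c * hyp2F1_reg a b (c + 1) \<xi> + a * b * \<xi> * hyp2F1_reg (a + 1) (b + 1) (c + 2) \<xi>"
proof -
  have hol: "(\<lambda>c. hyp2F1_reg a' b' c \<xi>) holomorphic_on UNIV" for a' b'
    using is_hyp2F1_reg_hyp2F1_reg[OF \<xi>] by (simp add: is_hyp2F1_reg_def)
  have hol': "(\<lambda>c. hyp2F1_reg a' b' (c + k) \<xi>) holomorphic_on UNIV" for a' b' k
  proof -
    have "(\<lambda>c. c + k) holomorphic_on UNIV" by (intro holomorphic_intros)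
    from holomorphic_on_compose_gen[OF this hol[of a' b']] show ?thesis by (simp add: o_def)
  qed
  show ?thesis
  proof (rule analytic_continuation_open[where s = "{w. Re b < Re w}" and s' = UNIV
        and f = "\<lambda>c. hyp2F1_reg a b c \<xi>"
        and g = "\<lambda>c. c * hyp2F1_reg a b (c + 1) \<xi> + a * b * \<xi> * hyp2F1_reg (a + 1) (b + 1) (c + 2) \<xi>"])
    show "{w. Re b < Re w} \<noteq> {}" by (auto intro!: exI[of _ "b + 1"])
    show "(\<lambda>c. c * hyp2F1_reg a b (c + 1) \<xi> + a * b * \<xi> * hyp2F1_reg (a + 1) (b + 1) (c + 2) \<xi>) holomorphic_on UNIV"
      by (intro holomorphic_intros hol')
    fix w assume "w \<in> {w. Re b < Re w}"
    then have w: "Re b < Re w" by simp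
    have e: "w + 1 - b = w - b + 1" "w + 2 - (b + 1) = w - b + 1" by auto
    show "hyp2F1_reg a b w \<xi> = w * hyp2F1_reg a b (w + 1) \<xi> + a * b * \<xi> * hyp2F1_reg (a + 1) (b + 1) (w + 2) \<xi>"
      using beta_ext_0_raise_d[OF \<xi> b, of "w - b" a] w b
      by (simp add: hyp2F1_reg_Euler[OF \<xi>] e)
  qed (auto intro: hol open_halfspace_Re_gt)
qed

text \<open>The characterization \<open>is_hyp2F1_reg\<close> concerns one fixed \<xi>, so
  differentiability in \<xi> has to come from Euler's integral. Beyond its range the contiguous
  relation expresses the function, at every point of the slit plane, by two functions for which c -
  b is larger by 1; hence the induction on a bound for Re (b - c).\<close>

lemma hyp2F1_reg_has_field_derivative:
  assumes \<xi>: "1 - \<xi> \<notin> \<real>\<^sub>\<le>\<^sub>0" and b: "0 < Re b"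
  shows "((\<lambda>\<xi>. hyp2F1_reg a b c \<xi>) has_field_derivative a * b * hyp2F1_reg (a + 1) (b + 1) (c + 1) \<xi>) (at \<xi>)"
proof -
  define U where "U = {\<xi>::complex. 1 - \<xi> \<notin> \<real>\<^sub>\<le>\<^sub>0}"
  have U: "open U" "\<xi> \<in> U" using \<xi> open_slit_plane by (auto simp: U_def)
  obtain N :: nat where "Re b - Re c < real N" using reals_Archimedean2 by blast
  then have "Re (c - b) > - real N" by simp
  then show ?thesis using b
  proof (induction N arbitrary: a b c)
    case 0
    then have pos: "Re b > 0" "Re (c - b) > 0" by auto
    have "((\<lambda>\<xi>. rGamma b * rGamma (c - b) * euler_integral \<xi> a b (c - b)) has_field_derivative
        rGamma b * rGamma (c - b) * (a * euler_integral \<xi> (a + 1) (b + 1) (c - b))) (at \<xi>)"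
      by (intro DERIV_cmult euler_integral_has_field_derivative \<xi> pos)
    also have "rGamma b * rGamma (c - b) * (a * euler_integral \<xi> (a + 1) (b + 1) (c - b)) =
        a * b * hyp2F1_reg (a + 1) (b + 1) (c + 1) \<xi>"
      using pos by (simp add: hyp2F1_reg_Euler[OF \<xi>] rGamma_plus1[of b, symmetric])
    finally show ?case
      by (rule has_field_derivative_transform_within_open[OF _ U])
        (use pos in \<open>auto simp: U_def hyp2F1_reg_Euler\<close>)
  next
    case (Suc N)
    have e: "c + 1 - b = c - b + 1" "c + 2 - (b + 1) = c - b + 1" by auto
    have 1: "((\<lambda>\<xi>. hyp2F1_reg a b (c + 1) \<xi>) has_field_derivative
        a * b * hyp2F1_reg (a + 1) (b + 1) (c + 1 + 1) \<xi>) (at \<xi>)"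
      by (rule Suc.IH) (use Suc.prems in \<open>auto simp: e\<close>)
    have 2: "((\<lambda>\<xi>. hyp2F1_reg (a + 1) (b + 1) (c + 2) \<xi>) has_field_derivative
        (a + 1) * (b + 1) * hyp2F1_reg (a + 1 + 1) (b + 1 + 1) (c + 2 + 1) \<xi>) (at \<xi>)"
      by (rule Suc.IH) (use Suc.prems in \<open>auto simp: e\<close>)
    have "((\<lambda>\<xi>. c * hyp2F1_reg a b (c + 1) \<xi> + a * b * (\<xi> * hyp2F1_reg (a + 1) (b + 1) (c + 2) \<xi>)) has_field_derivative
        c * (a * b * hyp2F1_reg (a + 1) (b + 1) (c + 1 + 1) \<xi>) +
        a * b * (1 * hyp2F1_reg (a + 1) (b + 1) (c + 2) \<xi> + (a + 1) * (b + 1) * hyp2F1_reg (a + 1 + 1) (b + 1 + 1) (c + 2 + 1) \<xi> * \<xi>)) (at \<xi>)"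
      by (intro DERIV_add DERIV_cmult DERIV_mult 1 2 DERIV_ident)
    also have "c * (a * b * hyp2F1_reg (a + 1) (b + 1) (c + 1 + 1) \<xi>) +
        a * b * (1 * hyp2F1_reg (a + 1) (b + 1) (c + 2) \<xi> + (a + 1) * (b + 1) * hyp2F1_reg (a + 1 + 1) (b + 1 + 1) (c + 2 + 1) \<xi> * \<xi>)
      = a * b * hyp2F1_reg (a + 1) (b + 1) (c + 1) \<xi>"
    proof -
      have "c + 1 + 1 = c + 2" "c + 2 + 1 = c + 1 + 2" by auto
      then show ?thesis
        \<comment> \<open>The contiguous relation at the raised parameters collects the
          differentiated terms into one function.\<close>
        using hyp2F1_reg_contiguous[OF \<xi>, of "b + 1" "a + 1" "c + 1"] Suc.prems(2)
        by (simp add: algebra_simps)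
    qed
    finally have D: "((\<lambda>\<xi>. c * hyp2F1_reg a b (c + 1) \<xi> + a * b * (\<xi> * hyp2F1_reg (a + 1) (b + 1) (c + 2) \<xi>)) has_field_derivative
        a * b * hyp2F1_reg (a + 1) (b + 1) (c + 1) \<xi>) (at \<xi>)" .
    show ?case
    proof (rule has_field_derivative_transform_within_open[OF D U])
      fix x assume "x \<in> U"
      then show "c * hyp2F1_reg a b (c + 1) x + a * b * (x * hyp2F1_reg (a + 1) (b + 1) (c + 2) x) = hyp2F1_reg a b c x"
        using hyp2F1_reg_contiguous[of x b a c] Suc.prems(2) by (simp add: U_def mult.assoc)
    qed
  qed
qed

text \<open>The accumulation point for the identity theorem whenever an identity is known on the
  positive reals.\<close>

lemma one_islimpt_pos_reals: "(1::complex) islimpt of_real ` {0<..}"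
  unfolding islimpt_sequential
proof (intro exI[of _ "\<lambda>n. complex_of_real (1 + 1 / real (Suc n))"] conjI allI)
  show "complex_of_real (1 + 1 / real (Suc n)) \<in> of_real ` {0<..} - {1}" for n
    by (auto intro!: imageI add_pos_pos simp del: of_nat_Suc simp: complex_eq_iff)
  have "(\<lambda>n. complex_of_real (1 + 1 / real (Suc n))) \<longlonglongrightarrow> complex_of_real (1 + 0)"
    by (intro tendsto_intros LIMSEQ_Suc[OF lim_1_over_n])
  then show "(\<lambda>n. complex_of_real (1 + 1 / real (Suc n))) \<longlonglongrightarrow> 1" by simp
qed

text \<open>Euler's beta integral for complex parameters: from the real case by the identity
  theorem, in b with d real and afterwards in d with b complex. The factor with exponent - a equals
  1 at \<xi> = 0.\<close>

lemma euler_integral_zero: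
  assumes "Re b > 0" "Re d > 0"
  shows "euler_integral 0 a b d = Gamma b * Gamma d * rGamma (b + d)"
proof -
  have e0: "euler_integral 0 a b d = euler_integral 0 0 b d" for b d
    by (simp add: euler_integral_def)
  have real: "euler_integral 0 0 (of_real p) (of_real r) = Gamma (of_real p) * Gamma (of_real r) * rGamma (of_real p + of_real r)"
    if "p > 0" "r > 0" for p r
  proof -
    have "((\<lambda>t. complex_of_real (beta_density p r t)) has_integral of_real (Beta p r)) {0..1}"
      using has_integral_linear[OF has_integral_Beta_real[OF that] bounded_linear_of_real] by (simp add: o_def)
    then have "((\<lambda>t. euler_integrand 0 0 (of_real p) (of_real r) t) has_integral of_real (Beta p r)) {0<..<1}"
      unfolding has_integral_Icc_iff_Ioo
    proof (rule has_integral_eq[rotated])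
      fix t :: real assume t: "t \<in> {0<..<1}"
      then have "complex_of_real (t powr (p - 1)) = complex_of_real t powr (of_real p - 1)"
        "complex_of_real ((1 - t) powr (r - 1)) = (1 - complex_of_real t) powr (of_real r - 1)"
        using powr_of_real[of t "p - 1"] powr_of_real[of "1 - t" "r - 1"] by simp_all
      then show "complex_of_real (beta_density p r t) = euler_integrand 0 0 (of_real p) (of_real r) t"
        by simp
    qed
    then have "euler_integral 0 0 (of_real p) (of_real r) = of_real (Beta p r)"
      unfolding euler_integral_Ioo by (rule integral_unique)
    then show ?thesis
      by (simp only: Beta_complex_of_real Beta_altdef[symmetric])
  qed
  let ?H = "{s. 0 < Re s}"
  have op: "open ?H" "connected ?H" by (auto intro: open_halfspace_Re_gt convex_connected convex_halfspace_Re_gt)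
  have nG: "s \<notin> \<int>\<^sub>\<le>\<^sub>0" if "s \<in> ?H" for s :: complex using that by (auto elim!: nonpos_Ints_cases)
  have step1: "euler_integral 0 0 b (of_real r) - Gamma b * Gamma (of_real r) * rGamma (b + of_real r) = 0"
    if "Re b > 0" "r > 0" for b r
  proof (rule analytic_continuation[OF _ op, where U = "of_real ` {0<..}" and \<xi> = 1 and w = b
        and f = "\<lambda>s. euler_integral 0 0 s (of_real r) - Gamma s * Gamma (of_real r) * rGamma (s + of_real r)"])
    show "(\<lambda>s. euler_integral 0 0 s (of_real r) - Gamma s * Gamma (of_real r) * rGamma (s + of_real r)) holomorphic_on ?H"
      by (intro holomorphic_intros holomorphic_on_euler_integral[OF op(1)]) (use that nG in auto)
  qed (use one_islimpt_pos_reals real that in auto)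
  have "euler_integral 0 0 b d - Gamma b * Gamma d * rGamma (b + d) = 0"
  proof (rule analytic_continuation[OF _ op, where U = "of_real ` {0<..}" and \<xi> = 1 and w = d
        and f = "\<lambda>s. euler_integral 0 0 b s - Gamma b * Gamma s * rGamma (b + s)"])
    show "(\<lambda>s. euler_integral 0 0 b s - Gamma b * Gamma s * rGamma (b + s)) holomorphic_on ?H"
      by (intro holomorphic_intros holomorphic_on_euler_integral[OF op(1)]) (use assms nG in auto)
  qed (use one_islimpt_pos_reals step1 assms in auto)
  then show ?thesis using e0 by simp
qed

section \<open>Modified Bessel functions\<close>

text \<open>From u \<le> exp u at u = X / p, raised to the power p. Exponential decay is traded for
  powers in this way in all majorants below.\<close>

lemma exp_minus_le_powr:
  fixes X p :: real
  assumes "X > 0" "p > 0"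
  shows "exp (- X) \<le> (p / X) powr p"
proof -
  have "X / p \<le> exp (X / p)" using exp_ge_add_one_self[of "X / p"] by linarith
  then have "(X / p) powr p \<le> exp (X / p) powr p" using assms by (intro powr_mono2) auto
  also have "\<dots> = exp X" using assms by (simp add: powr_def)
  finally have "inverse (exp X) \<le> inverse ((X / p) powr p)"
    using assms by (intro le_imp_inverse_le) auto
  also have "\<dots> = (p / X) powr p" using assms by (simp add: powr_divide)
  finally show ?thesis by (simp add: exp_minus)
qed

lemma absolutely_integrable_scaled_Gamma:
  assumes "y > 0" "Re z > 0"
  shows "(\<lambda>t. complex_of_real (exp (- y * t)) * complex_of_real t powr (z - 1)) absolutely_integrable_on {0<..}"
  using absolutely_integrable_Gamma_integral[OF assms(2,1)] by (simp add: exp_minus divide_inverse mult.commute)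

lemma integrable_real_scaled_Gamma:
  fixes y s :: real
  assumes "y > 0" "s > 0"
  shows "(\<lambda>t. exp (- y * t) * t powr (s - 1)) integrable_on {0<..}"
proof -
  have "(\<lambda>t. norm (complex_of_real (exp (- y * t)) * complex_of_real t powr (of_real s - 1))) integrable_on {0<..}"
    using absolutely_integrable_scaled_Gamma[of y "of_real s"] assms
    unfolding absolutely_integrable_on_def by (simp only: Re_complex_of_real)
  then show ?thesis
    by (rule integrable_eq) (simp add: norm_mult norm_powr_real_powr)
qed

lemma integral_pos_reals_scale:
  fixes f :: "real \<Rightarrow> complex"
  assumes f: "f absolutely_integrable_on {0<..}" and c: "c > 0"
  shows "(\<lambda>x. of_real c * f (c * x)) absolutely_integrable_on {0<..}"
    and "integral {0<..} (\<lambda>x. of_real c * f (c * x)) = integral {0<..} f"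
proof -
  have img: "(\<lambda>t. c * t) ` {0<..} = {0<..}"
  proof (intro equalityI subsetI)
    fix t :: real assume "t \<in> {0<..}"
    then show "t \<in> (\<lambda>t. c * t) ` {0<..}" using c by (intro image_eqI[of _ _ "t / c"]) auto
  qed (use c in auto)
  have "(\<lambda>x. \<bar>c\<bar> *\<^sub>R f (c * x)) absolutely_integrable_on {0<..} \<and>
      integral {0<..} (\<lambda>x. \<bar>c\<bar> *\<^sub>R f (c * x)) = integral {0<..} f"
  proof (rule has_absolute_integral_change_of_variables_real[THEN iffD2])
    show "((\<lambda>t. c * t) has_field_derivative c) (at x within {0<..})" for x
      by (auto intro!: derivative_eq_intros)
    show "inj_on (\<lambda>t. c * t) {0<..}" using c by (auto simp: inj_on_def)
    show "f absolutely_integrable_on (\<lambda>t. c * t) ` {0<..} \<and> integral ((\<lambda>t. c * t) ` {0<..}) f = integral {0<..} f"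
      unfolding img using f by blast
  qed simp
  then show "(\<lambda>x. of_real c * f (c * x)) absolutely_integrable_on {0<..}"
    and "integral {0<..} (\<lambda>x. of_real c * f (c * x)) = integral {0<..} f"
    using c by (simp_all add: scaleR_conv_of_real)
qed

lemma scaled_Gamma_integral:
  assumes y: "y > 0" and z: "Re z > 0"
  shows "((\<lambda>t. complex_of_real (exp (- y * t)) * complex_of_real t powr (z - 1)) has_integral
    Gamma z * complex_of_real y powr (- z)) {0<..}"
proof -
  let ?f = "\<lambda>t. complex_of_real (exp (- t)) * complex_of_real t powr (z - 1)"
  have ai: "?f absolutely_integrable_on {0<..}" using absolutely_integrable_scaled_Gamma[of 1 z] z by simp
  have I: "integral {0<..} ?f = Gamma z"
    using integral_unique[OF Gamma_integral_complex'[OF z]] by (simp add: exp_minus divide_inverse mult.commute)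
  note sc = integral_pos_reals_scale[OF ai y]
  have "((\<lambda>x. of_real y * ?f (y * x)) has_integral Gamma z) {0<..}"
    using integrable_integral[OF set_lebesgue_integral_eq_integral(1)[OF sc(1)]] unfolding sc(2) I .
  then have I1: "((\<lambda>x. complex_of_real y powr (- z) * (of_real y * ?f (y * x))) has_integral complex_of_real y powr (- z) * Gamma z) {0<..}"
    by (rule has_integral_mult_right)
  have eq: "complex_of_real y powr (- z) * (of_real y * ?f (y * x)) = complex_of_real (exp (- y * x)) * complex_of_real x powr (z - 1)"
    if "x \<in> {0<..}" for x
  proof -
    have "complex_of_real (y * x) powr (z - 1) = complex_of_real y powr (z - 1) * complex_of_real x powr (z - 1)"
      using y that by (simp add: powr_times_real)
    moreover have "complex_of_real y powr (- z) * (complex_of_real y * complex_of_real y powr (z - 1)) = 1"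
      using y by (simp add: powr_diff powr_minus)
    ultimately show ?thesis by (simp add: mult_ac)
  qed
  show ?thesis using has_integral_eq[OF eq I1] by (simp only: mult.commute[of "Gamma z"])
qed

text \<open>The integrand of 2 K_z(w) over v > 0. The integral converges for every z as soon as Re w
  > 0, and v -> 1/v exchanges z and - z.\<close>

definition bessel_kernel :: "complex \<Rightarrow> complex \<Rightarrow> real \<Rightarrow> complex" where
  "bessel_kernel z w v = exp (- (w / 2) * of_real (v + 1 / v)) * of_real v powr (z - 1)"

text \<open>\<open>bessel_L z w\<close> is twice the modified Bessel function \<open>K\<^sub>z(w)\<close>.\<close>
definition bessel_L :: "complex \<Rightarrow> complex \<Rightarrow> complex" where
  "bessel_L z w = integral {0<..} (bessel_kernel z w)"

lemma norm_bessel_kernel: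
  assumes "v > 0"
  shows "norm (bessel_kernel z w v) = exp (- (Re w / 2) * (v + 1 / v)) * v powr (Re z - 1)"
  using assms by (simp add: bessel_kernel_def norm_mult norm_powr_real_powr norm_exp_eq_Re
      del: of_real_add of_real_divide)

text \<open>Of the two exponential factors, exp (- r v / 2) is kept for large v, and exp (- r / (2
  v)) is traded for v^p, which makes the singularity at 0 integrable once Re z + p > 0.\<close>

lemma norm_bessel_kernel_le:
  assumes "v > 0" "r > 0" "p > 0" "r \<le> Re w"
  shows "norm (bessel_kernel z w v) \<le> (2 * p / r) powr p * (exp (- (r / 2) * v) * v powr (Re z + p - 1))"
proof -
  have "norm (bessel_kernel z w v) \<le> exp (- (r / 2) * (v + 1 / v)) * v powr (Re z - 1)"
    unfolding norm_bessel_kernel[OF assms(1)] using assms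
    by (intro mult_right_mono) (auto intro!: mult_right_mono)
  also have "exp (- (r / 2) * (v + 1 / v)) = exp (- (r / 2) * v) * exp (- (r / (2 * v)))"
    by (simp add: exp_add[symmetric] algebra_simps)
  also have "exp (- (r / (2 * v))) \<le> (p / (r / (2 * v))) powr p"
    using assms by (intro exp_minus_le_powr) auto
  also have "(p / (r / (2 * v))) powr p = (2 * p / r) powr p * v powr p"
    using assms by (simp add: powr_mult[symmetric] field_simps)
  finally have "norm (bessel_kernel z w v) \<le> exp (- (r / 2) * v) * ((2 * p / r) powr p * v powr p) * v powr (Re z - 1)"
    by (simp add: mult_right_mono)
  also have "\<dots> = (2 * p / r) powr p * (exp (- (r / 2) * v) * (v powr p * v powr (Re z - 1)))"
    by (simp add: mult_ac)
  also have "v powr p * v powr (Re z - 1) = v powr (Re z + p - 1)"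
    by (simp add: powr_add[symmetric] algebra_simps)
  finally show ?thesis .
qed

lemma bessel_kernel_bound_integrable:
  assumes "r > 0" "Re z + p > 0"
  shows "(\<lambda>v. C * (exp (- (r / 2) * v) * v powr (Re z + p - 1))) integrable_on {0<..}"
  using integrable_on_cmult_left[OF integrable_real_scaled_Gamma[of "r / 2" "Re z + p"], of C] assms by simp

lemma bessel_kernel_absolutely_integrable:
  assumes "Re w > 0"
  shows "bessel_kernel z w absolutely_integrable_on {0<..}"
proof -
  define p where "p = 1 + \<bar>Re z\<bar>"
  have p: "p > 0" "Re z + p > 0" by (auto simp: p_def)
  show ?thesis
  proof (rule integrable_dominated(1)[OF _ _ bessel_kernel_bound_integrable[OF assms p(2), of "(2 * p / Re w) powr p"]])
    show "continuous_on {0<..} (bessel_kernel z w)"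
      unfolding bessel_kernel_def by (intro continuous_intros) (auto simp: complex_nonpos_Reals_iff)
  qed (use norm_bessel_kernel_le[OF _ assms p(1)] in auto)
qed

lemma bessel_kernel_integrable:
  assumes "Re w > 0"
  shows "bessel_kernel z w integrable_on {0<..}"
  using bessel_kernel_absolutely_integrable[OF assms] set_lebesgue_integral_eq_integral(1) by blast

lemma bessel_L_has_field_derivative:
  assumes w: "Re w > 0"
  shows "(bessel_L z has_field_derivative - (bessel_L (z + 1) w + bessel_L (z - 1) w) / 2) (at w)"
proof -
  let ?H = "{w. 0 < Re w}"
  \<comment> \<open>This choice gives Re z + p \<ge> 1, and on the ball of radius Re w / 2 about w
    the real part stays above Re w / 2; the kernel bound is then uniform there.\<close>
  define p where "p = 1 + \<bar>Re z\<bar>"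
  define r where "r = Re w / 2"
  have p: "p > 0" "Re z + p > 0" by (auto simp: p_def)
  have r: "r > 0" using w by (simp add: r_def)
  have D: "((\<lambda>w. bessel_kernel z w v) has_field_derivative
      - (bessel_kernel (z + 1) w v + bessel_kernel (z - 1) w v) / 2) (at w)" if "v > 0" for v w
  proof -
    have "complex_of_real v powr (z - 1 - 1) = complex_of_real v powr (z - 1) / of_real v"
      "complex_of_real v powr (z + 1 - 1) = complex_of_real v powr (z - 1) * of_real v"
      using that by (simp_all add: powr_diff power2_eq_square)
    then have e: "- (bessel_kernel (z + 1) w v + bessel_kernel (z - 1) w v) / 2 =
       - (1 / 2) * of_real (v + 1 / v) * exp (- (w / 2) * of_real (v + 1 / v)) * of_real v powr (z - 1)"
      unfolding bessel_kernel_def using that by (simp add: field_simps)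
    show ?thesis unfolding e unfolding bessel_kernel_def
      by (auto intro!: derivative_eq_intros)
  qed
  have "((\<lambda>w. integral {0<..} (bessel_kernel z w)) has_field_derivative
      integral {0<..} (\<lambda>v. deriv (\<lambda>w. bessel_kernel z w v) w)) (at w)"
  proof (rule has_field_derivative_integral(2)[where U = ?H and r = r])
    show "(\<lambda>v. (2 * p / r) powr p * (exp (- (r / 2) * v) * v powr (Re z + p - 1))) integrable_on {0<..}"
      using bessel_kernel_bound_integrable[OF r p(2)] .
    fix w' and v :: real assume w': "w' \<in> ball w r" and v: "v \<in> {0<..}"
    have "Re w - Re w' \<le> norm (w - w')" using complex_Re_le_cmod[of "w - w'"] by simp
    also have "\<dots> < r" using w' by (simp add: dist_norm)
    finally have "r \<le> Re w'" by (simp add: r_def)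
    then show "norm (bessel_kernel z w' v) \<le> (2 * p / r) powr p * (exp (- (r / 2) * v) * v powr (Re z + p - 1))"
      using v r p by (intro norm_bessel_kernel_le) auto
  next
    show "(\<lambda>w. bessel_kernel z w v) holomorphic_on ?H" if "v \<in> {0<..}" for v
      unfolding bessel_kernel_def by (intro holomorphic_intros) auto
  qed (use w r open_halfspace_Re_gt bessel_kernel_integrable in auto)
  also have "integral {0<..} (\<lambda>v. deriv (\<lambda>w. bessel_kernel z w v) w) =
      integral {0<..} (\<lambda>v. - (bessel_kernel (z + 1) w v + bessel_kernel (z - 1) w v) / 2)"
    by (intro Henstock_Kurzweil_Integration.integral_cong DERIV_imp_deriv D) auto
  also have "\<dots> = - (bessel_L (z + 1) w + bessel_L (z - 1) w) / 2"
    unfolding bessel_L_def using bessel_kernel_integrable[OF w]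
    by (intro integral_unique has_integral_divide has_integral_neg has_integral_add integrable_integral) auto
  finally show ?thesis by (simp add: bessel_L_def[abs_def])
qed

lemma integral_pos_reals_limit:
  fixes f :: "real \<Rightarrow> complex"
  assumes "f absolutely_integrable_on {0<..}"
  shows "(\<lambda>n. integral {1 / real (Suc n)..real (Suc n)} f) \<longlonglongrightarrow> integral {0<..} f"
proof -
  define h where "h = (\<lambda>n x. if x \<in> {1 / real (Suc n)..real (Suc n)} then f x else 0)"
  have sub: "{1 / real (Suc n)..real (Suc n)} \<subseteq> {0<..}" for n
  proof
    fix x assume "x \<in> {1 / real (Suc n)..real (Suc n)}"
    moreover have "1 / real (Suc n) > 0" by simp
    ultimately show "x \<in> {0<..}" unfolding atLeastAtMost_iff greaterThan_iff by linarith
  qed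
  have fi: "f integrable_on {1 / real (Suc n)..real (Suc n)}" for n
    using set_lebesgue_integral_eq_integral(1)[OF set_integrable_subset[OF assms _ sub[of n]]] by simp
  have hi: "(h n has_integral integral {1 / real (Suc n)..real (Suc n)} f) {0<..}" for n
    unfolding h_def using has_integral_restrict[OF sub[of n], of f] integrable_integral[OF fi[of n]] by simp
  have 1: "h n integrable_on {0<..}" for n using hi by blast
  have 2: "(\<lambda>x. norm (f x)) integrable_on {0<..}"
    using assms by (simp add: absolutely_integrable_on_def)
  have 3: "norm (h n x) \<le> norm (f x)" for n x by (simp add: h_def)
  have 4: "(\<lambda>n. h n x) \<longlonglongrightarrow> f x" if "x \<in> {0<..}" for x
  proof (rule tendsto_eventually)
    obtain N1 N2 :: nat where N: "x \<le> real N1" "1 / x \<le> real N2" using real_arch_simple by meson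
    show "eventually (\<lambda>n. h n x = f x) sequentially"
    proof (rule eventually_sequentiallyI[of "max N1 N2"])
      fix n assume "max N1 N2 \<le> n"
      then have "x \<le> real (Suc n)" "1 / x \<le> real (Suc n)" using N by auto
      then have "1 / real (Suc n) \<le> x" using that by (simp add: field_simps)
      then show "h n x = f x" using \<open>x \<le> real (Suc n)\<close> by (simp add: h_def)
    qed
  qed
  have "(\<lambda>n. integral {0<..} (h n)) \<longlonglongrightarrow> integral {0<..} f"
    using dominated_convergence(2)[of h "{0<..}" "\<lambda>x. norm (f x)" f, OF 1 2 3 4] by blast
  then show ?thesis using integral_unique[OF hi] by simp
qed

text \<open>The integrand \<open>?f\<close> is the derivative of v^z exp (- (w/2) (v + 1/v)), which
  tends to 0 at both ends of the half-line. The fundamental theorem is applied on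
  [1/(n + 1), n + 1].\<close>

lemma bessel_L_recurrence:
  assumes w: "Re w > 0"
  shows "z * bessel_L z w = w / 2 * (bessel_L (z + 1) w - bessel_L (z - 1) w)"
proof -
  let ?F = "bessel_kernel (z + 1) w"
  let ?f = "\<lambda>v. z * bessel_kernel z w v - w / 2 * (bessel_kernel (z + 1) w v - bessel_kernel (z - 1) w v)"
  have "?f absolutely_integrable_on {0<..}"
    by (intro set_integral_diff set_integrable_mult_right bessel_kernel_absolutely_integrable w)
  then have lim: "(\<lambda>n. integral {1 / real (Suc n)..real (Suc n)} ?f) \<longlonglongrightarrow> integral {0<..} ?f"
    by (rule integral_pos_reals_limit)
  have D: "(?F has_vector_derivative ?f v) (at v within S)" if "v > 0" for v S
  proof -
    have v: "complex_of_real v \<notin> \<real>\<^sub>\<le>\<^sub>0" "complex_of_real v \<noteq> 0" using that by auto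
    have pw: "complex_of_real v powr (z - 1 - 1) = complex_of_real v powr z / (of_real v * of_real v)"
      "complex_of_real v powr (z - 1) = complex_of_real v powr z / of_real v"
      using v by (simp_all add: powr_diff power2_eq_square)
    have "((\<lambda>u. exp (- (w / 2) * (u + 1 / u)) * u powr z) has_field_derivative
        exp (- (w / 2) * (of_real v + 1 / of_real v)) * (- (w / 2) * (1 - 1 / (of_real v * of_real v))) * of_real v powr z
        + exp (- (w / 2) * (of_real v + 1 / of_real v)) * (z * of_real v powr (z - 1))) (at (complex_of_real v))"
    proof -
      have 1: "((\<lambda>u. - (w / 2) * (u + 1 / u)) has_field_derivative - (w / 2) * (1 - 1 / (of_real v * of_real v))) (at (complex_of_real v))"
        using v by (auto intro!: derivative_eq_intros)
      have 2: "((\<lambda>u. u powr z) has_field_derivative z * of_real v powr (z - 1)) (at (complex_of_real v))"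
        using v(1) by (rule has_field_derivative_powr)
      show ?thesis
        using DERIV_mult[OF DERIV_chain2[OF DERIV_exp 1] 2] by (simp only: mult.commute mult.left_commute)
    qed
    also have "exp (- (w / 2) * (of_real v + 1 / of_real v)) * (- (w / 2) * (1 - 1 / (of_real v * of_real v))) * of_real v powr z
        + exp (- (w / 2) * (of_real v + 1 / of_real v)) * (z * of_real v powr (z - 1)) = ?f v"
      unfolding bessel_kernel_def pw using v by (simp add: field_simps)
    finally show ?thesis
      using has_vector_derivative_real_field[of "\<lambda>u. exp (- (w / 2) * (u + 1 / u)) * u powr z" _ v S]
      by (simp add: bessel_kernel_def[abs_def])
  qed
  have int: "integral {1 / real (Suc n)..real (Suc n)} ?f = ?F (real (Suc n)) - ?F (1 / real (Suc n))" for n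
  proof (intro integral_unique fundamental_theorem_of_calculus D)
    have "1 / real (Suc n) \<le> 1" "1 \<le> real (Suc n)" by auto
    then show "1 / real (Suc n) \<le> real (Suc n)" by linarith
    fix x assume "x \<in> {1 / real (Suc n)..real (Suc n)}"
    moreover have "1 / real (Suc n) > 0" by simp
    ultimately show "x > 0" unfolding atLeastAtMost_iff by linarith
  qed
  define p where "p = 1 + \<bar>Re z\<bar>"
  \<comment> \<open>One bound for both boundary terms: v + 1/v is the same at v and 1/v, and the
    exponent p exceeds both Re z and - Re z.\<close>
  define B where "B = (\<lambda>v. exp (- (Re w / 2) * v) * v powr p)"
  have B0: "(\<lambda>n. B (real (Suc n))) \<longlonglongrightarrow> 0"
  proof (rule tendsto_sandwich[of "\<lambda>_. 0" _ _ "\<lambda>n. ((p + 1) / (Re w / 2)) powr (p + 1) * (1 / real (Suc n))"])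
    \<comment> \<open>The exponential is traded for the power p + 1 of 1/v; after the factor v^p,
      one power of 1/v is left over.\<close>
    have "B v \<le> ((p + 1) / (Re w / 2)) powr (p + 1) * (1 / v)" if "v > 0" for v
    proof -
      have "exp (- (Re w / 2 * v)) \<le> ((p + 1) / (Re w / 2 * v)) powr (p + 1)"
        using w that by (intro exp_minus_le_powr) (auto simp: p_def)
      also have "(p + 1) / (Re w / 2 * v) = (p + 1) / (Re w / 2) * (1 / v)" by simp
      also have "\<dots> powr (p + 1) = ((p + 1) / (Re w / 2)) powr (p + 1) * (1 / v) powr (p + 1)"
        by (rule powr_mult)
      also have "(1 / v) powr (p + 1) = (1 / v) * v powr (- p)"
        using that by (simp add: powr_divide powr_add powr_minus field_simps)
      finally have "B v \<le> ((p + 1) / (Re w / 2)) powr (p + 1) * ((1 / v) * v powr (- p)) * v powr p"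
        unfolding B_def using that by (intro mult_right_mono) auto
      also have "\<dots> = ((p + 1) / (Re w / 2)) powr (p + 1) * (1 / v)"
        using that by (simp add: powr_minus)
      finally show ?thesis .
    qed
    then show "eventually (\<lambda>n. B (real (Suc n)) \<le> ((p + 1) / (Re w / 2)) powr (p + 1) * (1 / real (Suc n))) sequentially"
      by (intro always_eventually allI) auto
    show "eventually (\<lambda>n. 0 \<le> B (real (Suc n))) sequentially"
      by (intro always_eventually) (simp add: B_def)
    have "(\<lambda>n. ((p + 1) / (Re w / 2)) powr (p + 1) * (1 / real (Suc n))) \<longlonglongrightarrow> ((p + 1) / (Re w / 2)) powr (p + 1) * 0"
      by (intro tendsto_mult tendsto_const LIMSEQ_Suc[OF lim_1_over_n])
    then show "(\<lambda>n. ((p + 1) / (Re w / 2)) powr (p + 1) * (1 / real (Suc n))) \<longlonglongrightarrow> 0" by simp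
  qed simp
  have ex: "exp (- (Re w / 2) * (v + 1 / v)) \<le> exp (- (Re w / 2) * v)" "exp (- (Re w / 2) * (1 / v + v)) \<le> exp (- (Re w / 2) * v)"
    if "v > 0" for v using that w by (auto intro!: mult_left_mono)
  have up: "norm (?F (real (Suc n))) \<le> B (real (Suc n))" for n
  proof -
    have "real (Suc n) powr (Re z) \<le> real (Suc n) powr p" by (intro powr_mono) (auto simp: p_def)
    then show ?thesis unfolding B_def using ex[of "real (Suc n)"]
      by (subst norm_bessel_kernel) (auto intro!: mult_mono)
  qed
  have dn: "norm (?F (1 / real (Suc n))) \<le> B (real (Suc n))" for n
  proof -
    have "(1 / real (Suc n)) powr (Re z) = real (Suc n) powr (- Re z)"
      by (simp add: powr_divide powr_minus field_simps)
    also have "\<dots> \<le> real (Suc n) powr p" by (intro powr_mono) (auto simp: p_def)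
    finally have "exp (- (Re w / 2) * (1 / real (Suc n) + real (Suc n))) * (1 / real (Suc n)) powr (Re z) \<le> B (real (Suc n))"
      unfolding B_def using ex(2)[of "real (Suc n)"] by (intro mult_mono) auto
    then show ?thesis by (subst norm_bessel_kernel) auto
  qed
  have "(\<lambda>n. ?F (real (Suc n))) \<longlonglongrightarrow> 0" "(\<lambda>n. ?F (1 / real (Suc n))) \<longlonglongrightarrow> 0"
    by (rule Lim_null_comparison[OF _ B0], use up dn in auto)+
  from tendsto_diff[OF this] have "(\<lambda>n. ?F (real (Suc n)) - ?F (1 / real (Suc n))) \<longlonglongrightarrow> 0" by simp
  with lim have "integral {0<..} ?f = 0" unfolding int using LIMSEQ_unique by blast
  moreover have "integral {0<..} ?f = z * bessel_L z w - w / 2 * (bessel_L (z + 1) w - bessel_L (z - 1) w)"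
    unfolding bessel_L_def using bessel_kernel_integrable[OF w]
    by (intro integral_unique has_integral_diff has_integral_mult_right integrable_integral) auto
  ultimately show ?thesis by simp
qed

lemma bessel_L_scaled:
  assumes w: "Re w > 0" and c: "c > 0"
  shows "(\<lambda>u. complex_of_real c * bessel_kernel z w (c * u)) absolutely_integrable_on {0<..}"
    and "bessel_L z w = integral {0<..} (\<lambda>u. complex_of_real c * bessel_kernel z w (c * u))"
  using integral_pos_reals_scale[OF bessel_kernel_absolutely_integrable[OF w] c]
  by (simp_all add: bessel_L_def)

text \<open>The substitution v -> 1/v fixes v + 1/v and turns v^(z-1) dv into v^(-z-1) dv.\<close>

lemma bessel_L_uminus:
  assumes w: "Re w > 0"
  shows "bessel_L (- z) w = bessel_L z w"
proof -
  have img: "(\<lambda>t. 1 / t) ` {0<..} = {(0::real)<..}"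
  proof (intro equalityI subsetI)
    fix t :: real assume "t \<in> {0<..}"
    then show "t \<in> (\<lambda>t. 1 / t) ` {0<..}" by (intro image_eqI[of _ _ "1 / t"]) auto
  qed auto
  have "(\<lambda>x. \<bar>- (1 / (x * x))\<bar> *\<^sub>R bessel_kernel z w (1 / x)) absolutely_integrable_on {0<..} \<and>
      integral {0<..} (\<lambda>x. \<bar>- (1 / (x * x))\<bar> *\<^sub>R bessel_kernel z w (1 / x)) = bessel_L z w"
  proof (rule has_absolute_integral_change_of_variables_real[THEN iffD2])
    show "((\<lambda>t. 1 / t) has_field_derivative - (1 / (x * x))) (at x within {0<..})" if "x \<in> {0<..}" for x :: real
      using that by (auto intro!: derivative_eq_intros)
    show "inj_on (\<lambda>t. 1 / t) {(0::real)<..}" by (auto simp: inj_on_def)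
    show "bessel_kernel z w absolutely_integrable_on (\<lambda>t. 1 / t) ` {0<..} \<and>
        integral ((\<lambda>t. 1 / t) ` {0<..}) (bessel_kernel z w) = bessel_L z w"
      unfolding img bessel_L_def using bessel_kernel_absolutely_integrable[OF w] by blast
  qed simp
  moreover have "\<bar>- (1 / (x * x))\<bar> *\<^sub>R bessel_kernel z w (1 / x) = bessel_kernel (- z) w x" if "x \<in> {0<..}" for x
  proof -
    have x: "x > 0" using that by simp
    have "complex_of_real (1 / x) powr (z - 1) = complex_of_real x powr (- z) * complex_of_real x"
    proof -
      have "Ln (complex_of_real (1 / x)) = - Ln (complex_of_real x)"
        using x by (simp add: Ln_of_real ln_div del: of_real_divide)
      then show ?thesis using x by (simp add: powr_def exp_diff exp_minus field_simps exp_add[symmetric])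
    qed
    moreover have "complex_of_real x powr (- z - 1) = complex_of_real x powr (- z) / complex_of_real x"
      using x by (simp add: powr_diff)
    ultimately show ?thesis using x
      by (simp add: bessel_kernel_def scaleR_conv_of_real add.commute)
  qed
  then have "integral {0<..} (\<lambda>x. \<bar>- (1 / (x * x))\<bar> *\<^sub>R bessel_kernel z w (1 / x)) = bessel_L (- z) w"
    unfolding bessel_L_def by (intro Henstock_Kurzweil_Integration.integral_cong) auto
  ultimately show ?thesis by simp
qed

text \<open>By rGamma w = w rGamma (w + 1) the norms no longer increase once Re (b + n) \<ge> 1; the
  finitely many earlier ones are summed into the bound.\<close>

lemma bounded_rGamma_add_of_nat:
  obtains C where "\<And>n. norm (rGamma (b + of_nat n :: complex)) \<le> C"
proof -
  obtain N :: nat where N: "real N \<ge> 1 - Re b" using real_arch_simple by blast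
  have dec: "norm (rGamma (b + of_nat n)) \<le> norm (rGamma (b + of_nat N))" if "n \<ge> N" for n
    using that
  proof (induction n rule: dec_induct)
    case (step n)
    let ?w = "b + of_nat n"
    have "1 \<le> Re ?w" using N step.hyps by simp
    then have "1 \<le> norm ?w" using complex_Re_le_cmod[of ?w] by linarith
    then have "norm (rGamma (?w + 1)) \<le> norm ?w * norm (rGamma (?w + 1))"
      by (simp add: mult_le_cancel_right1)
    also have "\<dots> = norm (rGamma ?w)" by (metis norm_mult rGamma_plus1)
    finally show ?case using step.IH by (simp add: add.commute add.left_commute)
  qed simp
  show thesis
  proof (rule that)
    fix n
    show "norm (rGamma (b + of_nat n)) \<le> (\<Sum>k\<le>N. norm (rGamma (b + of_nat k)))"
    proof (cases "n \<le> N")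
      case True
      then show ?thesis by (intro member_le_sum) auto
    next
      case False
      then have "norm (rGamma (b + of_nat n)) \<le> norm (rGamma (b + of_nat N))" by (intro dec) auto
      also have "\<dots> \<le> (\<Sum>k\<le>N. norm (rGamma (b + of_nat k)))" by (intro member_le_sum) auto
      finally show ?thesis .
    qed
  qed
qed

section \<open>Power series of the regularized 1F2 and of I_z\<close>

definition hyp1F2_coeff :: "complex \<Rightarrow> complex \<Rightarrow> complex \<Rightarrow> nat \<Rightarrow> complex" where
  "hyp1F2_coeff a c b n = pochhammer a n * rGamma (c + of_nat n) / pochhammer b n / fact n"

lemma hyp1F2_reg_altdef: "hyp1F2_reg a c b q = (\<Sum>n. hyp1F2_coeff a c b n * q ^ n)"
  unfolding hyp1F2_reg_def hyp1F2_coeff_def by (simp add: mult_ac)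

lemma summable_norm_hyp1F2_coeff: "summable (\<lambda>n. norm (hyp1F2_coeff a c b n * q ^ n))"
proof -
  obtain C where C: "\<And>n. norm (rGamma (c + of_nat n)) \<le> C" using bounded_rGamma_add_of_nat by blast
  have "summable (\<lambda>n. C * norm (pochhammer a n / pochhammer b n * (q ^ n / fact n)))"
    by (intro summable_mult summable_norm_hyp1F1)
  then show ?thesis
  proof (rule summable_comparison_test'[of _ 0])
    fix n
    have "norm (hyp1F2_coeff a c b n * q ^ n) = norm (rGamma (c + of_nat n)) * norm (pochhammer a n / pochhammer b n * (q ^ n / fact n))"
      by (simp add: hyp1F2_coeff_def norm_mult norm_divide mult_ac)
    also have "\<dots> \<le> C * norm (pochhammer a n / pochhammer b n * (q ^ n / fact n))"
      by (intro mult_right_mono C) auto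
    finally show "norm (norm (hyp1F2_coeff a c b n * q ^ n)) \<le> C * norm (pochhammer a n / pochhammer b n * (q ^ n / fact n))"
      by simp
  qed
qed

lemma summable_hyp1F2_coeff: "summable (\<lambda>n. hyp1F2_coeff a c b n * q ^ n)"
  using summable_norm_cancel[OF summable_norm_hyp1F2_coeff] .

lemma hyp1F2_reg_has_field_derivative:
  "(hyp1F2_reg a c b has_field_derivative (\<Sum>n. diffs (hyp1F2_coeff a c b) n * q ^ n)) (at q)"
  using termdiffs_strong_converges_everywhere[OF summable_hyp1F2_coeff, of a c b q]
  by (simp add: hyp1F2_reg_altdef[abs_def])

lemma holomorphic_hyp1F2_reg: "hyp1F2_reg a c b holomorphic_on UNIV"
  using hyp1F2_reg_has_field_derivative by (meson holomorphic_on_open open_UNIV)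

text \<open>On q^n the operator (c - 1) + q d/dq is multiplication by c - 1 + n, and this factor
  turns rGamma (c + n) into rGamma (c - 1 + n). For q = w^2 / 4 the operator q d/dq is (w/2)
  d/dw.\<close>

lemma hyp1F2_reg_lower:
  "hyp1F2_reg a (c - 1) b q = (c - 1) * hyp1F2_reg a c b q + q * deriv (hyp1F2_reg a c b) q"
proof -
  let ?c = "hyp1F2_coeff a c b"
  have "summable (\<lambda>n. diffs ?c n * q ^ n)"
    by (rule termdiff_converges_all[OF summable_hyp1F2_coeff])
  then have "(\<lambda>n. q * (of_nat n * ?c n * q ^ (n - Suc 0))) sums (q * (\<Sum>n. diffs ?c n * q ^ n))"
    by (intro sums_mult diffs_equiv)
  moreover have "q * (of_nat n * ?c n * q ^ (n - Suc 0)) = of_nat n * ?c n * q ^ n" for n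
    by (cases n) auto
  ultimately have "(\<lambda>n. of_nat n * ?c n * q ^ n) sums (q * (\<Sum>n. diffs ?c n * q ^ n))" by simp
  moreover have "(\<lambda>n. (c - 1) * (?c n * q ^ n)) sums ((c - 1) * hyp1F2_reg a c b q)"
    unfolding hyp1F2_reg_altdef by (intro sums_mult summable_sums summable_hyp1F2_coeff)
  ultimately have "(\<lambda>n. (c - 1) * (?c n * q ^ n) + of_nat n * ?c n * q ^ n) sums
      ((c - 1) * hyp1F2_reg a c b q + q * (\<Sum>n. diffs ?c n * q ^ n))"
    by (rule sums_add[rotated])
  moreover have "(c - 1) * (?c n * q ^ n) + of_nat n * ?c n * q ^ n = hyp1F2_coeff a (c - 1) b n * q ^ n" for n
  proof -
    have "rGamma (c - 1 + of_nat n) = (c - 1 + of_nat n) * rGamma (c + of_nat n)"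
      using rGamma_plus1[of "c - 1 + of_nat n"] by (simp add: algebra_simps)
    note * = this
    show ?thesis unfolding hyp1F2_coeff_def * by (simp add: algebra_simps add_divide_distrib diff_divide_distrib)
  qed
  ultimately have "(\<lambda>n. hyp1F2_coeff a (c - 1) b n * q ^ n) sums
      ((c - 1) * hyp1F2_reg a c b q + q * (\<Sum>n. diffs ?c n * q ^ n))" by simp
  then show ?thesis
    using sums_unique DERIV_imp_deriv[OF hyp1F2_reg_has_field_derivative]
    by (metis hyp1F2_reg_altdef)
qed

text \<open>\<open>(w/2)\<^sup>z bessel_E (1 + z) (w\<^sup>2/4)\<close> is the modified Bessel function \<open>I\<^sub>z(w)\<close>.\<close>
definition bessel_E :: "complex \<Rightarrow> complex \<Rightarrow> complex" where
  "bessel_E b = hyp1F2_reg 1 b 1"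

text \<open>The parameters a = 1 and b2 = 1 cancel, so that \<open>bessel_E\<close> is a regularized
  0F1 to which all facts about \<open>hyp1F2_reg\<close> apply.\<close>

lemma bessel_E_coeff: "hyp1F2_coeff 1 b 1 n = rGamma (b + of_nat n) / fact n"
  by (simp add: hyp1F2_coeff_def pochhammer_fact[symmetric])

lemma bessel_E_has_field_derivative: "(bessel_E b has_field_derivative bessel_E (b + 1) q) (at q)"
proof -
  have "diffs (hyp1F2_coeff 1 b 1) = hyp1F2_coeff 1 (b + 1) 1"
    by (rule ext) (simp add: diffs_def bessel_E_coeff add_ac field_simps del: of_nat_Suc, simp add: add_ac)
  then show ?thesis
    using hyp1F2_reg_has_field_derivative[of 1 b 1 q] unfolding bessel_E_def by (simp add: hyp1F2_reg_altdef)
qed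

lemma bessel_E_recurrence: "bessel_E b q = b * bessel_E (b + 1) q + q * bessel_E (b + 2) q"
proof -
  have "bessel_E (b + 1 - 1) q = (b + 1 - 1) * bessel_E (b + 1) q + q * deriv (bessel_E (b + 1)) q"
    unfolding bessel_E_def by (rule hyp1F2_reg_lower)
  then show ?thesis
    using DERIV_imp_deriv[OF bessel_E_has_field_derivative[of "b + 1" q]] by (simp add: add.assoc)
qed

lemma bessel_E_0: "bessel_E b 0 = rGamma b"
  unfolding bessel_E_def hyp1F2_reg_altdef using powser_zero[of "hyp1F2_coeff 1 b 1"]
  by (simp add: bessel_E_coeff)

text \<open>This is 2 (w/2)^z K_z(w). In this normalization differentiation just lowers z, and the
  limit at w = 0 is Gamma z if Re z > 0.\<close>

definition scaled_bessel_K :: "complex \<Rightarrow> complex \<Rightarrow> complex" where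
  "scaled_bessel_K z w = (w / 2) powr z * bessel_L z w"

section \<open>Recurrence, derivative and behaviour at 0 of the scaled function K\<close>

lemma half_plane_slit: "Re w > 0 \<Longrightarrow> w / 2 \<notin> \<real>\<^sub>\<le>\<^sub>0"
  by (auto simp: complex_nonpos_Reals_iff)

lemma scaled_bessel_K_recurrence:
  assumes w: "Re w > 0"
  shows "scaled_bessel_K (z + 1) w = z * scaled_bessel_K z w + w\<^sup>2 / 4 * scaled_bessel_K (z - 1) w"
proof -
  have "w \<noteq> 0" using w by auto
  then have p: "(w / 2) powr (z + 1) = (w / 2) powr z * (w / 2)" "(w / 2) powr (z - 1) = (w / 2) powr z / (w / 2)"
    by (simp_all add: powr_add powr_diff)
  have "z * bessel_L z w = w / 2 * bessel_L (z + 1) w - w / 2 * bessel_L (z - 1) w"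
    using bessel_L_recurrence[OF w, of z] by (simp add: right_diff_distrib)
  then have "(w / 2) powr z * (z * bessel_L z w) = (w / 2) powr z * (w / 2 * bessel_L (z + 1) w - w / 2 * bessel_L (z - 1) w)"
    by simp
  then show ?thesis
    unfolding scaled_bessel_K_def p using \<open>w \<noteq> 0\<close> by (simp add: field_simps power2_eq_square)
qed

lemma scaled_bessel_K_has_field_derivative:
  assumes w: "Re w > 0"
  shows "(scaled_bessel_K z has_field_derivative - (w / 2) * scaled_bessel_K (z - 1) w) (at w)"
proof -
  have "w \<noteq> 0" using w by auto
  then have p: "(w / 2) powr (z - 1) = (w / 2) powr z / (w / 2)" by (simp add: powr_diff)
  have D: "((\<lambda>w. (w / 2) powr z) has_field_derivative z * (w / 2) powr (z - 1) * (1 / 2)) (at w)"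
    using half_plane_slit[OF w] by (intro DERIV_chain2[where f = "\<lambda>u. u powr z", OF has_field_derivative_powr])
      (auto intro!: derivative_eq_intros)
  have "((\<lambda>w. (w / 2) powr z * bessel_L z w) has_field_derivative
      z * (w / 2) powr (z - 1) * (1 / 2) * bessel_L z w + - (bessel_L (z + 1) w + bessel_L (z - 1) w) / 2 * (w / 2) powr z) (at w)"
    by (intro DERIV_mult D bessel_L_has_field_derivative w)
  also have "z * (w / 2) powr (z - 1) * (1 / 2) * bessel_L z w + - (bessel_L (z + 1) w + bessel_L (z - 1) w) / 2 * (w / 2) powr z
     = (w / 2) powr z * ((z * bessel_L z w) / w - (bessel_L (z + 1) w + bessel_L (z - 1) w) / 2)"
    unfolding p using \<open>w \<noteq> 0\<close> by (simp add: field_simps)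
  also have "\<dots> = (w / 2) powr z * (- bessel_L (z - 1) w)"
    unfolding bessel_L_recurrence[OF w] using \<open>w \<noteq> 0\<close> by (simp add: field_simps)
  also have "\<dots> = - (w / 2) * scaled_bessel_K (z - 1) w"
    unfolding scaled_bessel_K_def p using \<open>w \<noteq> 0\<close> by simp
  finally show ?thesis by (simp add: scaled_bessel_K_def[abs_def])
qed

text \<open>The substitution v = c u with c at choice. With c = 2/r the first exponent becomes - u,
  which suits the limit r -> 0; for r = n y the choice c = 2 y / n makes it - y^2 u for all n, which
  suits Poisson summation.\<close>

lemma scaled_bessel_K_integral:
  assumes r: "r > 0" and c: "c > 0"
  shows "(\<lambda>u. complex_of_real (exp (- (r * c / 2) * u - r / (2 * c) / u)) * complex_of_real u powr (z - 1)) absolutely_integrable_on {0<..}"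
    and "scaled_bessel_K z (of_real r) = complex_of_real (r * c / 2) powr z *
      integral {0<..} (\<lambda>u. complex_of_real (exp (- (r * c / 2) * u - r / (2 * c) / u)) * complex_of_real u powr (z - 1))"
proof -
  let ?g = "\<lambda>u. complex_of_real (exp (- (r * c / 2) * u - r / (2 * c) / u)) * complex_of_real u powr (z - 1)"
  have e: "complex_of_real c * bessel_kernel z (of_real r) (c * u) = complex_of_real c powr z * ?g u" if "u \<in> {0<..}" for u
  proof -
    have u: "u > 0" using that by simp
    have "- (complex_of_real r / 2) * complex_of_real (c * u + 1 / (c * u)) = complex_of_real (- (r * c / 2) * u - r / (2 * c) / u)"
      using u c by (simp add: field_simps)
    then have 1: "exp (- (complex_of_real r / 2) * complex_of_real (c * u + 1 / (c * u))) = complex_of_real (exp (- (r * c / 2) * u - r / (2 * c) / u))"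
      by (simp only: exp_of_real)
    have 2: "complex_of_real (c * u) powr (z - 1) = complex_of_real c powr (z - 1) * complex_of_real u powr (z - 1)"
      using u c by (simp add: powr_times_real)
    have 3: "complex_of_real c * complex_of_real c powr (z - 1) = complex_of_real c powr z"
      using c by (simp add: powr_diff)
    show ?thesis unfolding bessel_kernel_def 1 2 3[symmetric] by (simp add: mult_ac)
  qed
  have "(\<lambda>u. complex_of_real c powr z * ?g u) absolutely_integrable_on {0<..}"
    by (rule set_integrable_cong[OF refl refl e, THEN iffD1]) (use bessel_L_scaled(1)[of "of_real r" c z] r c in auto)
  from set_integrable_mult_right[OF this, of "inverse (complex_of_real c powr z)"]
  show "?g absolutely_integrable_on {0<..}" using c by simp
  have "bessel_L z (of_real r) = integral {0<..} (\<lambda>u. complex_of_real c powr z * ?g u)"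
    using bessel_L_scaled(2)[of "of_real r" c z] r c
      Henstock_Kurzweil_Integration.integral_cong[of "{0<..}", OF e] by simp
  then have "bessel_L z (of_real r) = complex_of_real c powr z * integral {0<..} ?g" by simp
  moreover have "complex_of_real (r * c / 2) powr z = (complex_of_real r / 2) powr z * complex_of_real c powr z"
    using powr_times_real[of "of_real (r / 2)" "of_real c" z] r c by simp
  ultimately show "scaled_bessel_K z (of_real r) = complex_of_real (r * c / 2) powr z * integral {0<..} ?g"
    by (simp add: scaled_bessel_K_def)
qed

lemma scaled_bessel_K_tendsto:
  assumes z: "Re z > 0"
  shows "(\<lambda>n. scaled_bessel_K z (of_real (1 / real (Suc n)))) \<longlonglongrightarrow> Gamma z"
proof -
  define g where "g = (\<lambda>n u. complex_of_real (exp (- 1 * u - (1 / real (Suc n))\<^sup>2 / 4 / u)) * complex_of_real u powr (z - 1))"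
  define f where "f = (\<lambda>u. complex_of_real (exp (- 1 * u)) * complex_of_real u powr (z - 1))"
  have K: "scaled_bessel_K z (of_real (1 / real (Suc n))) = integral {0<..} (g n)" "g n absolutely_integrable_on {0<..}" for n
  proof -
    \<comment> \<open>For r = 1/(n + 1) the scaling c = 2/r leaves r only in the factor exp (- r^2 /
      (4 u)), which is at most 1 and tends to 1.\<close>
    have "1 / real (Suc n) * (2 * real (Suc n)) / 2 = 1"
      "1 / real (Suc n) / (2 * (2 * real (Suc n))) = (1 / real (Suc n))\<^sup>2 / 4"
      by (simp_all add: power2_eq_square del: of_nat_Suc)
    note rc = this
    have "1 / real (Suc n) > 0" "2 * real (Suc n) > 0" by simp_all
    note I = scaled_bessel_K_integral[OF this, of z, unfolded rc]
    show "g n absolutely_integrable_on {0<..}" unfolding g_def by (rule I(1))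
    show "scaled_bessel_K z (of_real (1 / real (Suc n))) = integral {0<..} (g n)"
      using I(2) unfolding g_def by (simp only: of_real_1 powr_one_eq_one mult_1)
  qed
  have 1: "g n integrable_on {0<..}" for n
    using K(2) set_lebesgue_integral_eq_integral(1) by blast
  have 2: "(\<lambda>u. exp (- 1 * u) * u powr (Re z - 1)) integrable_on {0<..}"
    by (rule integrable_real_scaled_Gamma) (use z in auto)
  have 3: "norm (g n u) \<le> exp (- 1 * u) * u powr (Re z - 1)" if "u \<in> {0<..}" for n u
    unfolding g_def norm_mult using that by (auto simp: norm_powr_real_powr intro!: mult_right_mono)
  have 4: "(\<lambda>n. g n u) \<longlonglongrightarrow> f u" if "u \<in> {0<..}" for u
  proof -
    have "(\<lambda>n. complex_of_real (exp (- 1 * u - (1 / real (Suc n))\<^sup>2 / 4 / u)) * complex_of_real u powr (z - 1))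
       \<longlonglongrightarrow> complex_of_real (exp (- 1 * u - 0\<^sup>2 / 4 / u)) * complex_of_real u powr (z - 1)"
      using that by (intro tendsto_intros LIMSEQ_Suc[OF lim_1_over_n]) auto
    then show ?thesis by (simp add: g_def f_def)
  qed
  have "(\<lambda>n. integral {0<..} (g n)) \<longlonglongrightarrow> integral {0<..} f"
    using dominated_convergence(2)[of g "{0<..}" _ f, OF 1 2 3 4] by blast
  moreover have "integral {0<..} f = Gamma z"
    unfolding f_def using integral_unique[OF scaled_Gamma_integral[of 1 z]] z by simp
  ultimately show ?thesis using K(1) by simp
qed

text \<open>The Wronskian of \<open>I\<^sub>z\<close> and \<open>K\<^sub>z\<close>: it does not depend on \<open>w\<close>, by the derivative formulas, nor
  does it change under \<open>z \<mapsto> z + 1\<close>, by the recurrences, so its value can be read off as \<open>w \<rightarrow> 0\<close> for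
  large \<open>Re z\<close>.\<close>
lemma bessel_Wronskian:
  assumes w: "Re w > 0"
  shows "scaled_bessel_K z w * bessel_E z (w\<^sup>2 / 4) + w\<^sup>2 / 4 * scaled_bessel_K (z - 1) w * bessel_E (z + 1) (w\<^sup>2 / 4) = 1"
proof -
  \<comment> \<open>In classical notation this is w (K_z I_{z-1} + K_{z-1} I_z).\<close>
  define W where "W = (\<lambda>z w. scaled_bessel_K z w * bessel_E z (w\<^sup>2 / 4) + w\<^sup>2 / 4 * scaled_bessel_K (z - 1) w * bessel_E (z + 1) (w\<^sup>2 / 4))"
  let ?H = "{w. 0 < Re w}"
  have E: "((\<lambda>w. bessel_E b (w\<^sup>2 / 4)) has_field_derivative bessel_E (b + 1) (w\<^sup>2 / 4) * (w / 2)) (at w)" for b w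
    by (rule DERIV_chain2[OF bessel_E_has_field_derivative]) (auto intro!: derivative_eq_intros)
  have Q: "((\<lambda>w. w\<^sup>2 / 4) has_field_derivative w / 2) (at w)" for w :: complex
    by (auto intro!: derivative_eq_intros)
  have D: "(W z has_field_derivative 0) (at w)" if w: "w \<in> ?H" for z w
  proof -
    from w have w': "Re w > 0" by simp
    let ?q = "w\<^sup>2 / 4" and ?h = "w / 2"
    have "(W z has_field_derivative
       (- ?h * scaled_bessel_K (z - 1) w) * bessel_E z ?q + (bessel_E (z + 1) ?q * ?h) * scaled_bessel_K z w +
       ((?h * scaled_bessel_K (z - 1) w + (- ?h * scaled_bessel_K (z - 1 - 1) w) * ?q) * bessel_E (z + 1) ?q +
         (bessel_E (z + 1 + 1) ?q * ?h) * (?q * scaled_bessel_K (z - 1) w))) (at w)"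
      unfolding W_def by (intro DERIV_add DERIV_mult Q E scaled_bessel_K_has_field_derivative w')
    also have "(- ?h * scaled_bessel_K (z - 1) w) * bessel_E z ?q + (bessel_E (z + 1) ?q * ?h) * scaled_bessel_K z w +
       ((?h * scaled_bessel_K (z - 1) w + (- ?h * scaled_bessel_K (z - 1 - 1) w) * ?q) * bessel_E (z + 1) ?q +
         (bessel_E (z + 1 + 1) ?q * ?h) * (?q * scaled_bessel_K (z - 1) w))
      = ?h * (scaled_bessel_K (z - 1) w * (bessel_E (z + 1) ?q + ?q * bessel_E (z + 2) ?q - bessel_E z ?q)
         + bessel_E (z + 1) ?q * (scaled_bessel_K z w - ?q * scaled_bessel_K (z - 2) w))"
    proof -
      have "z - 1 - 1 = z - 2" "z + 1 + 1 = z + 2" by auto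
      note e = this
      have *: "(- h * k1) * e0 + (e1 * h) * k0 + ((h * k1 + (- h * k2) * q) * e1 + (e2 * h) * (q * k1))
          = h * (k1 * (e1 + q * e2 - e0) + e1 * (k0 - q * k2))" for h q k0 k1 k2 e0 e1 e2 :: complex
        by (simp add: algebra_simps)
      show ?thesis unfolding e by (rule *)
    qed
    also have "\<dots> = 0"
    proof -
      have "scaled_bessel_K z w = (z - 1) * scaled_bessel_K (z - 1) w + ?q * scaled_bessel_K (z - 2) w"
        using scaled_bessel_K_recurrence[OF w', of "z - 1"] by (simp add: diff_diff_eq)
      note K = this
      have *: "h * (k1 * (e1 + q * e2 - (z * e1 + q * e2)) + e1 * ((z - 1) * k1 + q * k2 - q * k2)) = 0"
        for h q k1 k2 e1 e2 :: complex
        by (simp add: algebra_simps)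
      show ?thesis unfolding bessel_E_recurrence[of z ?q] K by (rule *)
    qed
    finally show ?thesis .
  qed
  have const: "W z w = W z w'" if "w \<in> ?H" "w' \<in> ?H" for z w w'
  proof -
    have "W z w - W z w' = 0"
      using has_field_derivative_zero_constant[of ?H "W z"] D that convex_halfspace_Re_gt[of 0]
      by (metis (mono_tags, lifting) DERIV_subset cancel_comm_monoid_add_class.diff_cancel top_greatest)
    then show ?thesis by simp
  qed
  \<comment> \<open>With Re z > 1 both z and z - 1 have positive real part, so that both scaled
    functions have finite limits at 0; the factor w^2 / 4 removes the second product.\<close>
  have one: "W z w = 1" if "Re z > 1" "w \<in> ?H" for z w
  proof -
    let ?x = "\<lambda>n. complex_of_real (1 / real (Suc n))"
    have x0: "?x \<longlonglongrightarrow> 0"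
      using tendsto_of_real[OF LIMSEQ_Suc[OF lim_1_over_n[where 'a = real]], where 'a = complex] by simp
    have q0: "(\<lambda>n. (?x n)\<^sup>2 / 4) \<longlonglongrightarrow> 0"
      using tendsto_divide[OF tendsto_power[OF x0, of 2] tendsto_const[of 4]] by simp
    have "isCont (bessel_E b) 0" for b using bessel_E_has_field_derivative DERIV_isCont by blast
    then have e0: "(\<lambda>n. bessel_E b ((?x n)\<^sup>2 / 4)) \<longlonglongrightarrow> rGamma b" for b
      using isCont_tendsto_compose[OF _ q0, of "bessel_E b"] bessel_E_0 by metis
    have "(\<lambda>n. W z (?x n)) \<longlonglongrightarrow> Gamma z * rGamma z + 0 * Gamma (z - 1) * rGamma (z + 1)"
      unfolding W_def
      by (intro tendsto_intros e0 q0 scaled_bessel_K_tendsto) (use that in auto)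
    moreover have "W z (?x n) = W z w" for n
      by (rule const) (use that in auto)
    moreover have "Gamma z * rGamma z = 1"
      using that Gamma_eq_zero_iff[of z] by (auto simp: rGamma_inverse_Gamma elim!: nonpos_Ints_cases)
    ultimately show ?thesis by (simp add: LIMSEQ_const_iff)
  qed
  have step: "W (z + 1) w = W z w" if "w \<in> ?H" for z w
  proof -
    have "Re w > 0" using that by simp
    then show ?thesis
      unfolding W_def scaled_bessel_K_recurrence[OF \<open>Re w > 0\<close>] bessel_E_recurrence[of z]
      by (simp add: algebra_simps)
  qed
  have "W (z + of_nat n) w = W z w" for n
  proof (induction n)
    case (Suc n)
    then show ?case using step[of w "z + of_nat n"] w by (simp add: add_ac)
  qed simp
  moreover obtain n :: nat where "1 - Re z < real n" using reals_Archimedean2 by blast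
  ultimately have "W z w = 1" using one[of "z + of_nat n" w] w by simp
  then show ?thesis by (simp add: W_def)
qed

lemma scaled_bessel_K_reflect:
  assumes w: "Re w > 0"
  shows "scaled_bessel_K (- z) w = (w / 2) powr (- (2 * z)) * scaled_bessel_K z w"
proof -
  have "w \<noteq> 0" using w by auto
  then have "(w / 2) powr (- (2 * z)) * (w / 2) powr z = (w / 2) powr (- z)"
    by (simp add: powr_add[symmetric])
  then show ?thesis
    unfolding scaled_bessel_K_def bessel_L_uminus[OF w] by (simp add: mult.assoc[symmetric])
qed

lemma sin_pi_nonzero:
  assumes "z \<notin> \<int>"
  shows "sin (z * of_real pi) \<noteq> (0 :: complex)"
proof
  assume "sin (z * of_real pi) = 0"
  then obtain n :: int where "z * of_real pi = of_real (of_int n * pi)" unfolding sin_eq_0 by blast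
  then have "z * of_real pi = of_int n * of_real pi" by simp
  then have "z = of_int n" by simp
  then show False using assms by simp
qed

text \<open>The formula K_z = (pi/2) (I_{-z} - I_z) / sin (pi z). The Wronskians at z and at 1 - z,
  the latter rewritten by evenness in the order, are two linear equations for \<open>k\<close> and
  \<open>k1\<close>. Eliminating \<open>k1\<close> leaves \<open>k\<close> times a determinant that
  is the constant rGamma z rGamma (1 - z) = sin (pi z) / pi.\<close>

lemma scaled_bessel_K_series:
  assumes w: "Re w > 0" and z: "z \<notin> \<int>"
  shows "scaled_bessel_K z w = of_real pi / sin (z * of_real pi) *
    (bessel_E (1 - z) (w\<^sup>2 / 4) - (w / 2) powr (2 * z) * bessel_E (1 + z) (w\<^sup>2 / 4))"
proof -
  let ?q = "w\<^sup>2 / 4"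
  define P where "P = (w / 2) powr (2 * z)"
  define k where "k = scaled_bessel_K z w"
  define k1 where "k1 = scaled_bessel_K (z - 1) w"
  have w0: "w \<noteq> 0" using w by auto
  have P: "P * (w / 2) powr (- (2 * z)) = 1" using w0 by (simp add: P_def powr_add[symmetric])
  have W1: "k * bessel_E z ?q + ?q * k1 * bessel_E (z + 1) ?q = 1"
    using bessel_Wronskian[OF w, of z] by (simp add: k_def k1_def)
  have refl1: "P * scaled_bessel_K (1 - z) w = ?q * k1"
  proof -
    have "scaled_bessel_K (1 - z) w = (w / 2) powr (- (2 * (z - 1))) * k1"
      using scaled_bessel_K_reflect[OF w, of "z - 1"] by (simp add: k1_def)
    moreover have "P * (w / 2) powr (- (2 * (z - 1))) = ?q"
    proof -
      have "P * (w / 2) powr (- (2 * (z - 1))) = (w / 2) powr (2 :: complex)"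
        using w0 by (simp add: P_def powr_add[symmetric] algebra_simps)
      also have "\<dots> = ?q" by (simp add: power2_eq_square)
      finally show ?thesis .
    qed
    ultimately show ?thesis by (simp add: mult.assoc[symmetric])
  qed
  have refl2: "P * scaled_bessel_K (- z) w = k"
    using scaled_bessel_K_reflect[OF w, of z] P by (simp add: k_def mult.assoc[symmetric])
  \<comment> \<open>The Wronskian at 1 - z; multiplication by P turns the functions of order 1 - z
    and - z into multiples of \<open>k1\<close> and \<open>k\<close>.\<close>
  have "scaled_bessel_K (1 - z) w * bessel_E (1 - z) ?q + ?q * scaled_bessel_K (- z) w * bessel_E (2 - z) ?q = 1"
    using bessel_Wronskian[OF w, of "1 - z"] by simp
  then have "P * (scaled_bessel_K (1 - z) w * bessel_E (1 - z) ?q + ?q * scaled_bessel_K (- z) w * bessel_E (2 - z) ?q) = P" by simp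
  moreover have "P * (scaled_bessel_K (1 - z) w * bessel_E (1 - z) ?q + ?q * scaled_bessel_K (- z) w * bessel_E (2 - z) ?q)
      = (P * scaled_bessel_K (1 - z) w) * bessel_E (1 - z) ?q + ?q * (P * scaled_bessel_K (- z) w) * bessel_E (2 - z) ?q"
    by (simp add: algebra_simps)
  ultimately have W2: "?q * k1 * bessel_E (1 - z) ?q + ?q * k * bessel_E (2 - z) ?q = P"
    by (simp only: refl1 refl2)
  \<comment> \<open>The determinant of the system, up to sign and a factor q: its derivative in q
    vanishes by the recurrences, so it equals its value at q = 0.\<close>
  have C: "bessel_E z ?q * bessel_E (1 - z) ?q - ?q * bessel_E (2 - z) ?q * bessel_E (1 + z) ?q = rGamma z * rGamma (1 - z)"
  proof -
    define C where "C = (\<lambda>q. bessel_E z q * bessel_E (1 - z) q - q * (bessel_E (2 - z) q * bessel_E (1 + z) q))"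
    have "(C has_field_derivative 0) (at q within UNIV)" for q
    proof -
      have "(C has_field_derivative (bessel_E (z + 1) q * bessel_E (1 - z) q + bessel_E (1 - z + 1) q * bessel_E z q) -
          (1 * (bessel_E (2 - z) q * bessel_E (1 + z) q) +
           (bessel_E (2 - z + 1) q * bessel_E (1 + z) q + bessel_E (1 + z + 1) q * bessel_E (2 - z) q) * q)) (at q)"
        unfolding C_def by (intro DERIV_diff DERIV_mult DERIV_ident bessel_E_has_field_derivative)
      also have "(bessel_E (z + 1) q * bessel_E (1 - z) q + bessel_E (1 - z + 1) q * bessel_E z q) -
          (1 * (bessel_E (2 - z) q * bessel_E (1 + z) q) +
           (bessel_E (2 - z + 1) q * bessel_E (1 + z) q + bessel_E (1 + z + 1) q * bessel_E (2 - z) q) * q) = 0"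
      proof -
        have e: "1 - z + 1 = 2 - z" "2 - z + 1 = 3 - z" "1 + z + 1 = z + 2" "1 + z = z + 1" by auto
        have e': "1 - z + 2 = 3 - z" by auto
        have 1: "bessel_E (1 - z) q = (1 - z) * bessel_E (2 - z) q + q * bessel_E (3 - z) q"
          using bessel_E_recurrence[of "1 - z" q] unfolding e e' .
        have 2: "bessel_E z q = z * bessel_E (z + 1) q + q * bessel_E (z + 2) q"
          by (rule bessel_E_recurrence)
        show ?thesis unfolding e 1 2 by (simp add: algebra_simps)
      qed
      finally show ?thesis by simp
    qed
    then have "C ?q = C 0"
      using has_field_derivative_zero_constant[of UNIV C] by (metis UNIV_I convex_UNIV)
    then show ?thesis by (simp add: C_def bessel_E_0 mult.assoc)
  qed
  have "k * (bessel_E z ?q * bessel_E (1 - z) ?q - ?q * bessel_E (2 - z) ?q * bessel_E (1 + z) ?q)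
      = bessel_E (1 - z) ?q - P * bessel_E (1 + z) ?q"
  proof -
    have "bessel_E (1 - z) ?q * (k * bessel_E z ?q + ?q * k1 * bessel_E (z + 1) ?q) = bessel_E (1 - z) ?q"
      unfolding W1 by simp
    moreover have "bessel_E (z + 1) ?q * (?q * k1 * bessel_E (1 - z) ?q + ?q * k * bessel_E (2 - z) ?q) = bessel_E (z + 1) ?q * P"
      unfolding W2 by simp
    moreover have "k * (ez * e1m - q * e2m * e1) = e1m - P * e1"
      if "e1m * (k * ez + q * k1 * e1) = e1m" "e1 * (q * k1 * e1m + q * k * e2m) = e1 * P" for q e1 e2m e1m ez
    proof -
      have "e1m - P * e1 = e1m * (k * ez + q * k1 * e1) - e1 * (q * k1 * e1m + q * k * e2m)"
        unfolding that by (simp add: mult.commute)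
      also have "\<dots> = k * (ez * e1m - q * e2m * e1)" by (simp add: algebra_simps)
      finally show ?thesis ..
    qed
    ultimately show ?thesis unfolding add.commute[of 1 z] by blast
  qed
  then have "k * (sin (z * of_real pi) / of_real pi) = bessel_E (1 - z) ?q - P * bessel_E (1 + z) ?q"
    unfolding C rGamma_reflection_complex by (simp add: mult.commute)
  then show ?thesis
    using sin_pi_nonzero[OF z] by (simp add: k_def P_def field_simps)
qed

section \<open>Decay of the scaled function K in sectors\<close>

lemma norm_powr_half_plane_le:
  assumes "w \<noteq> 0"
  shows "norm (w powr z) \<le> norm w powr Re z * exp (pi * \<bar>Im z\<bar>)"
proof -
  have "norm (w powr z) = exp (Re z * ln (norm w) - Im z * Im (Ln w))"
    using assms by (simp add: powr_def norm_exp_eq_Re)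
  also have "\<dots> \<le> exp (Re z * ln (norm w) + pi * \<bar>Im z\<bar>)"
  proof -
    have "\<bar>Im (Ln w)\<bar> \<le> pi" using assms mpi_less_Im_Ln Im_Ln_le_pi by (simp add: abs_le_iff less_imp_le minus_le_iff)
    then have "\<bar>Im z * Im (Ln w)\<bar> \<le> \<bar>Im z\<bar> * pi" unfolding abs_mult by (intro mult_left_mono) auto
    then show ?thesis by (simp add: mult.commute)
  qed
  also have "\<dots> = norm w powr Re z * exp (pi * \<bar>Im z\<bar>)"
    using assms by (simp add: powr_def exp_add)
  finally show ?thesis .
qed

text \<open>The kernel is estimated through Re w, the power (w/2)^z through the norm of w; in a
  sector norm w \<le> M Re w the two are comparable. The exponent p is free and is fixed later
  between the demands of summation over n and of integration over t.\<close>

lemma scaled_bessel_K_bound: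
  assumes z: "Re z > 0" and p: "p > 0" and M: "M > 0"
  obtains C where "C > 0" "\<And>w. Re w > 0 \<Longrightarrow> norm w \<le> M * Re w \<Longrightarrow> norm (scaled_bessel_K z w) \<le> C * norm w powr (- (2 * p))"
proof -
  define s where "s = Re z"
  define G where "G = Gamma (s + p)"
  have G: "G > 0" using z p by (simp add: G_def s_def Gamma_real_pos)
  define C where "C = exp (pi * \<bar>Im z\<bar>) * M powr s * (2 * p) powr p * 2 powr p * G * M powr (2 * p)"
  show thesis
  proof (rule that[of C])
    show "C > 0" using G M p by (simp add: C_def)
    fix w assume w: "Re w > 0" "norm w \<le> M * Re w"
    define r where "r = Re w"
    have r: "r > 0" using w by (simp add: r_def)
    have w0: "w \<noteq> 0" "norm w > 0" using w by auto
    have GI: "((\<lambda>v. exp (- (r / 2) * v) * v powr (s + p - 1)) has_integral G * (r / 2) powr (- (s + p))) {0<..}"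
    proof -
      have "((\<lambda>v. Re (complex_of_real (exp (- (r / 2) * v)) * complex_of_real v powr (of_real (s + p) - 1))) has_integral
          Re (Gamma (of_real (s + p)) * complex_of_real (r / 2) powr (- of_real (s + p)))) {0<..}"
        using has_integral_linear[OF scaled_Gamma_integral[of "r / 2" "of_real (s + p)"] bounded_linear_Re] r z p
        by (simp add: o_def s_def)
      moreover have "Re (Gamma (of_real (s + p)) * complex_of_real (r / 2) powr (- of_real (s + p))) = G * (r / 2) powr (- (s + p))"
      proof -
        have "complex_of_real (r / 2) powr (- of_real (s + p)) = of_real ((r / 2) powr (- (s + p)))"
          using powr_of_real[of "r / 2" "- (s + p)"] r by simp
        then show ?thesis unfolding Gamma_complex_of_real G_def by (simp only: of_real_mult[symmetric] Re_complex_of_real)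
      qed
      moreover have "Re (complex_of_real (exp (- (r / 2) * v)) * complex_of_real v powr (of_real (s + p) - 1)) = exp (- (r / 2) * v) * v powr (s + p - 1)"
        if "v \<in> {0<..}" for v
      proof -
        have "complex_of_real v powr (of_real (s + p) - 1) = of_real (v powr (s + p - 1))"
          using powr_of_real[of v "s + p - 1"] that by simp
        then show ?thesis by (simp only: of_real_mult[symmetric] Re_complex_of_real)
      qed
      ultimately show ?thesis using has_integral_eq by (metis (no_types, lifting))
    qed
    have "norm (bessel_L z w) \<le> integral {0<..} (\<lambda>v. (2 * p / r) powr p * (exp (- (r / 2) * v) * v powr (s + p - 1)))"
      unfolding bessel_L_def
    proof (rule integral_norm_bound_integral)
      show "(\<lambda>v. (2 * p / r) powr p * (exp (- (r / 2) * v) * v powr (s + p - 1))) integrable_on {0<..}"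
        using bessel_kernel_bound_integrable[of r z p] r z p by (simp add: s_def)
      show "norm (bessel_kernel z w v) \<le> (2 * p / r) powr p * (exp (- (r / 2) * v) * v powr (s + p - 1))" if "v \<in> {0<..}" for v
        unfolding s_def using that r p by (intro norm_bessel_kernel_le) (auto simp: r_def)
    qed (use bessel_kernel_integrable w in auto)
    also have "\<dots> = (2 * p / r) powr p * (G * (r / 2) powr (- (s + p)))"
      using integral_unique[OF has_integral_mult_right[OF GI, of "(2 * p / r) powr p"]] by simp
    finally have L: "norm (bessel_L z w) \<le> (2 * p / r) powr p * (G * (r / 2) powr (- (s + p)))" .
    have wr: "norm w / r \<le> M" using w r by (simp add: r_def field_simps)
    have A: "norm ((w / 2) powr z) \<le> norm (w / 2) powr s * exp (pi * \<bar>Im z\<bar>)"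
      unfolding s_def using w0 by (intro norm_powr_half_plane_le) auto
    have "norm (scaled_bessel_K z w) \<le> (norm (w / 2) powr s * exp (pi * \<bar>Im z\<bar>)) * ((2 * p / r) powr p * (G * (r / 2) powr (- (s + p))))"
      unfolding scaled_bessel_K_def norm_mult using A L by (intro mult_mono) auto
    \<comment> \<open>Splitting off norm w to the power - 2 p leaves powers of norm w / r with
      nonnegative exponents, and this quotient is at most M.\<close>
    also have "\<dots> = exp (pi * \<bar>Im z\<bar>) * (norm w / r) powr s * (2 * p) powr p * 2 powr p * G * (norm w / r) powr (2 * p) * norm w powr (- (2 * p))"
    proof -
      have e1: "(2 * p / r) powr p = (2 * p) powr p / r powr p" using r p by (simp add: powr_divide)
      have e2: "(r / 2) powr (- (s + p)) = 2 powr s * 2 powr p / (r powr s * r powr p)"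
        unfolding powr_minus_divide using r by (simp add: powr_divide powr_add)
      have e3: "norm (w / 2) powr s = norm w powr s / 2 powr s" by (simp add: norm_divide powr_divide)
      have e4: "(norm w / r) powr s = norm w powr s / r powr s" "(norm w / r) powr (2 * p) = norm w powr (2 * p) / (r powr p * r powr p)"
        using r by (simp_all add: powr_divide powr_add[symmetric])
      have e5: "norm w powr (- (2 * p)) = 1 / norm w powr (2 * p)" by (simp add: powr_minus divide_inverse)
      have nz: "2 powr s \<noteq> 0" "r powr s \<noteq> 0" "r powr p \<noteq> 0" "norm w powr (2 * p) \<noteq> 0" using r w0 by auto
      show ?thesis unfolding e1 e2 e3 e4 e5 using nz by (simp add: field_simps)
    qed
    also have "\<dots> \<le> exp (pi * \<bar>Im z\<bar>) * M powr s * (2 * p) powr p * 2 powr p * G * M powr (2 * p) * norm w powr (- (2 * p))"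
    proof -
      have "(norm w / r) powr s * (norm w / r) powr (2 * p) \<le> M powr s * M powr (2 * p)"
        using wr r p z by (intro mult_mono powr_mono2) (auto simp: s_def)
      then have "exp (pi * \<bar>Im z\<bar>) * (2 * p) powr p * 2 powr p * G * norm w powr (- (2 * p)) * ((norm w / r) powr s * (norm w / r) powr (2 * p))
          \<le> exp (pi * \<bar>Im z\<bar>) * (2 * p) powr p * 2 powr p * G * norm w powr (- (2 * p)) * (M powr s * M powr (2 * p))"
        using G by (intro mult_left_mono) auto
      then show ?thesis by (simp only: mult_ac)
    qed
    finally show "norm (scaled_bessel_K z w) \<le> C * norm w powr (- (2 * p))" by (simp add: C_def)
  qed
qed

section \<open>Poisson summation\<close>

lemma summable_Suc_powr:
  assumes "s > 1"
  shows "summable (\<lambda>n. real (Suc n) powr (- s))"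
  using summable_Suc_iff[of "\<lambda>n. real n powr (- s)"] summable_real_powr_iff[of "- s"] assms by simp

lemma exp_minus_square_le:
  fixes s X :: real
  assumes "s > 0" "X > 0"
  shows "exp (- (X * (real (Suc n))\<^sup>2)) \<le> (s / X) powr s * real (Suc n) powr (- (2 * s))"
proof -
  have "exp (- (X * (real (Suc n))\<^sup>2)) \<le> (s / (X * (real (Suc n))\<^sup>2)) powr s"
    using assms by (intro exp_minus_le_powr) auto
  also have "s / (X * (real (Suc n))\<^sup>2) = s / X * (1 / (real (Suc n))\<^sup>2)" by simp
  also have "\<dots> powr s = (s / X) powr s * (1 / (real (Suc n))\<^sup>2) powr s"
    by (rule powr_mult)
  also have "1 / (real (Suc n))\<^sup>2 = real (Suc n) powr (- 2)"
    by (simp add: powr_minus divide_inverse del: of_nat_Suc)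
  also have "(real (Suc n) powr (- 2)) powr s = real (Suc n) powr (- (2 * s))"
    by (simp only: powr_powr) simp
  finally show ?thesis .
qed

text \<open>Poisson summation for \<open>(w/2)\<^sup>z K\<^sub>z(w)\<close>: both sides are Laplace transforms, against
  \<open>p\<^sup>z\<^sup>-\<^sup>1\<close>, of the two sides of the theta transformation.\<close>
lemma scaled_bessel_K_Poisson:
  assumes y: "y > 0" and z: "Re z > 0"
  shows "\<exists>A B. (\<lambda>n. scaled_bessel_K z (of_real (real (Suc n) * y))) sums A \<and>
    (\<lambda>m. of_real (y\<^sup>2) powr z * (2 * of_real (sqrt pi) * Gamma (z + 1/2) *
       of_real (y\<^sup>2 + 4 * pi\<^sup>2 * (real (Suc m))\<^sup>2) powr (- (z + 1/2)))) sums B \<and>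
    A + Gamma z / 2 - of_real (sqrt pi) * Gamma (z + 1/2) / of_real y = B"
proof -
  define Y where "Y = y\<^sup>2"
  have Y: "Y > 0" using y by (simp add: Y_def)
  define \<phi> where "\<phi> = (\<lambda>p. complex_of_real (exp (- Y * p)) * complex_of_real p powr (z - 1))"
  define \<psi> where "\<psi> = (\<lambda>p. complex_of_real (exp (- Y * p)) * complex_of_real p powr (z + 1/2 - 1))"
  define u where "u = (\<lambda>n p. exp (- (1 / (4 * p) * (real (Suc n))\<^sup>2)))"
  define v where "v = (\<lambda>m p. exp (- (4 * pi\<^sup>2 * p * (real (Suc m))\<^sup>2)))"
  have z2: "Re (z + 1/2) > 0" using z by simp
  have n\<phi>: "norm (\<phi> p) = exp (- Y * p) * p powr (Re z - 1)" "norm (\<psi> p) = exp (- Y * p) * p powr (Re z - 1 / 2)" if "p > 0" for p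
    using that by (simp_all add: \<phi>_def \<psi>_def norm_mult norm_powr_real_powr)
  have I\<phi>: "(\<phi> has_integral Gamma z * of_real Y powr (- z)) {0<..}"
    unfolding \<phi>_def by (rule scaled_Gamma_integral[OF Y z])
  have I\<psi>: "(\<psi> has_integral Gamma (z + 1/2) * of_real Y powr (- (z + 1/2))) {0<..}"
    unfolding \<psi>_def by (rule scaled_Gamma_integral[OF Y z2])
  have K: "(\<lambda>p. complex_of_real (u n p) * \<phi> p) integrable_on {0<..}"
    "scaled_bessel_K z (of_real (real (Suc n) * y)) = of_real Y powr z * integral {0<..} (\<lambda>p. complex_of_real (u n p) * \<phi> p)" for n
  proof -
    \<comment> \<open>The scaling c = 2 y / (n + 1) gives each term the same factor exp (- y^2 p); n
      remains only in exp (- (n + 1)^2 / (4 p)).\<close>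
    have "real (Suc n) * y * (2 * y / real (Suc n)) / 2 = Y"
      "real (Suc n) * y / (2 * (2 * y / real (Suc n))) = (real (Suc n))\<^sup>2 / 4"
      using y by (simp_all add: Y_def power2_eq_square del: of_nat_Suc)
    note rc = this
    have "real (Suc n) * y > 0" "2 * y / real (Suc n) > 0" using y by simp_all
    note I = scaled_bessel_K_integral[OF this, of z, unfolded rc]
    have e: "complex_of_real (exp (- Y * p - (real (Suc n))\<^sup>2 / 4 / p)) * complex_of_real p powr (z - 1) = complex_of_real (u n p) * \<phi> p" for p
    proof -
      have "exp (- Y * p - (real (Suc n))\<^sup>2 / 4 / p) = u n p * exp (- Y * p)"
        by (simp add: u_def exp_add[symmetric] del: of_nat_Suc)
      then show ?thesis by (simp add: \<phi>_def)
    qed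
    show "(\<lambda>p. complex_of_real (u n p) * \<phi> p) integrable_on {0<..}"
      using I(1) unfolding e by (rule set_lebesgue_integral_eq_integral(1))
    show "scaled_bessel_K z (of_real (real (Suc n) * y)) = of_real Y powr z * integral {0<..} (\<lambda>p. complex_of_real (u n p) * \<phi> p)"
      using I(2) unfolding e .
  qed
  have V: "((\<lambda>p. complex_of_real (v m p) * \<psi> p) has_integral
      Gamma (z + 1/2) * of_real (Y + 4 * pi\<^sup>2 * (real (Suc m))\<^sup>2) powr (- (z + 1/2))) {0<..}" for m
  proof -
    have "Y + 4 * pi\<^sup>2 * (real (Suc m))\<^sup>2 > 0" using Y by (simp add: add_pos_nonneg del: of_nat_Suc)
    moreover have "complex_of_real (v m p) * \<psi> p = complex_of_real (exp (- (Y + 4 * pi\<^sup>2 * (real (Suc m))\<^sup>2) * p)) * complex_of_real p powr (z + 1/2 - 1)" for p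
    proof -
      have "exp (- (Y + 4 * pi\<^sup>2 * (real (Suc m))\<^sup>2) * p) = v m p * exp (- Y * p)"
        by (simp add: v_def exp_add[symmetric] algebra_simps del: of_nat_Suc)
      then show ?thesis by (simp add: \<psi>_def)
    qed
    ultimately show ?thesis using scaled_Gamma_integral[of "Y + 4 * pi\<^sup>2 * (real (Suc m))\<^sup>2" "z + 1/2"] z2 by simp
  qed
  have dom1: "norm (complex_of_real (u n p) * \<phi> p) \<le> real (Suc n) powr (- (2 * 1)) * (4 * (exp (- Y * p) * p powr (Re z + 1 - 1)))"
    if "p \<in> {0<..}" for n p
  proof -
    have p: "p > 0" using that by simp
    have "u n p \<le> (1 / (1 / (4 * p))) powr 1 * real (Suc n) powr (- (2 * 1))"
      unfolding u_def using p by (intro exp_minus_square_le) auto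
    then have "norm (complex_of_real (u n p) * \<phi> p) \<le> (1 / (1 / (4 * p))) powr 1 * real (Suc n) powr (- (2 * 1)) * norm (\<phi> p)"
      unfolding norm_mult by (intro mult_right_mono) (auto simp: u_def)
    also have "\<dots> = real (Suc n) powr (- (2 * 1)) * (4 * (exp (- Y * p) * (p * p powr (Re z - 1))))"
      using p by (simp add: n\<phi> del: of_nat_Suc)
    also have "p * p powr (Re z - 1) = p powr (Re z + 1 - 1)"
      using p by (simp add: powr_diff)
    finally show ?thesis .
  qed
  have int1: "(\<lambda>p. 4 * (exp (- Y * p) * p powr (Re z + 1 - 1))) integrable_on {0<..}"
    using integrable_on_cmult_left[OF integrable_real_scaled_Gamma[of Y "Re z + 1"], of 4] Y z by simp
  have sm1: "summable (\<lambda>n. real (Suc n) powr (- (2 * 1)))" by (intro summable_Suc_powr) auto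
  have nn: "0 \<le> 4 * (exp (- Y * p) * p powr (Re z + 1 - 1))" for p by simp
  note sums1 = sums_integral_majorized[OF K(1) int1 sm1 dom1 powr_ge_zero nn]
  \<comment> \<open>Summability over m asks for 2 s > 1, integrability at p = 0 for Re z - 1/2 - s >
    -1; this s satisfies both, with exponent Re z / 2 - 1.\<close>
  define s where "s = 1 / 2 + Re z / 2"
  have s: "s > 1 / 2" using z by (simp add: s_def)
  define C where "C = (s / (4 * pi\<^sup>2)) powr s"
  have dom2: "norm (complex_of_real (v m p) * \<psi> p) \<le> real (Suc m) powr (- (2 * s)) * (C * (exp (- Y * p) * p powr (Re z / 2 - 1)))"
    if "p \<in> {0<..}" for m p
  proof -
    have p: "p > 0" using that by simp
    have "v m p \<le> (s / (4 * pi\<^sup>2 * p)) powr s * real (Suc m) powr (- (2 * s))"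
      unfolding v_def using p s by (intro exp_minus_square_le) auto
    then have "norm (complex_of_real (v m p) * \<psi> p) \<le> (s / (4 * pi\<^sup>2 * p)) powr s * real (Suc m) powr (- (2 * s)) * norm (\<psi> p)"
      unfolding norm_mult by (intro mult_right_mono) (auto simp: v_def)
    also have "(s / (4 * pi\<^sup>2 * p)) powr s = C * p powr (- s)"
      using p s by (simp add: C_def powr_divide powr_mult powr_minus field_simps)
    also have "C * p powr (- s) * real (Suc m) powr (- (2 * s)) * norm (\<psi> p) =
        real (Suc m) powr (- (2 * s)) * (C * (exp (- Y * p) * (p powr (- s) * p powr (Re z - 1 / 2))))"
      using p by (simp add: n\<phi> del: of_nat_Suc)
    also have "p powr (- s) * p powr (Re z - 1 / 2) = p powr (Re z / 2 - 1)"
    proof -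
      have "- s + (Re z - 1 / 2) = Re z / 2 - 1" by (simp add: s_def)
      then show ?thesis unfolding powr_add[symmetric] by simp
    qed
    finally show ?thesis .
  qed
  have int2: "(\<lambda>p. C * (exp (- Y * p) * p powr (Re z / 2 - 1))) integrable_on {0<..}"
    using integrable_on_cmult_left[OF integrable_real_scaled_Gamma[of Y "Re z / 2"], of C] Y z by simp
  have sm2: "summable (\<lambda>m. real (Suc m) powr (- (2 * s)))" using s by (intro summable_Suc_powr) auto
  have K2: "(\<lambda>p. complex_of_real (v m p) * \<psi> p) integrable_on {0<..}" for m using V by blast
  have C0: "0 \<le> C * (exp (- Y * p) * p powr (Re z / 2 - 1))" for p by (simp add: C_def)
  note sums2 = sums_integral_majorized[OF K2 int2 sm2 dom2 powr_ge_zero C0]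
  define R where "R = integral {0<..} (\<lambda>p. \<Sum>m. complex_of_real (v m p) * \<psi> p)"
  \<comment> \<open>The theta transformation at q = 1/(4 p). Its prefactor contains sqrt p, which
    turns \<open>\<phi>\<close> into \<open>\<psi>\<close>; the term - \<open>\<phi>\<close> / 2 is
    due to n = 0, the single \<open>\<psi>\<close> to frequency 0.\<close>
  have theta: "(\<Sum>n. complex_of_real (u n p) * \<phi> p) =
      of_real (sqrt pi) * \<psi> p - 1 / 2 * \<phi> p + 2 * of_real (sqrt pi) * (\<Sum>m. complex_of_real (v m p) * \<psi> p)" if "p \<in> {0<..}" for p
  proof -
    have p: "p > 0" using that by simp
    have q: "1 / (4 * p) > 0" using p by simp
    have su: "summable (\<lambda>n. u n p)" using theta_transformation(2)[OF q] by (simp add: u_def)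
    have pv: "4 * pi\<^sup>2 * p > 0" using p by simp
    have sv: "summable (\<lambda>n. v n p)" using theta_transformation(2)[OF pv] by (simp add: v_def)
    define E where "E = (\<lambda>n. exp (- (1 / (4 * p)) * (real n)\<^sup>2))"
    have Eu: "E (Suc n) = u n p" for n by (simp add: E_def u_def)
    have sE: "summable E" using su unfolding Eu[symmetric] by (simp only: summable_Suc_iff)
    have "suminf E + (\<Sum>n. E (Suc n)) = (\<Sum>n. E n + E (Suc n))"
      by (rule suminf_add[OF sE]) (simp only: summable_Suc_iff sE)
    also have "\<dots> = sqrt (pi / (1 / (4 * p))) * (1 + 2 * (\<Sum>m. exp (- pi\<^sup>2 * (real (Suc m))\<^sup>2 / (1 / (4 * p)))))"
      unfolding E_def by (rule theta_transformation(1)[OF q])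
    also have "(\<lambda>m. exp (- pi\<^sup>2 * (real (Suc m))\<^sup>2 / (1 / (4 * p)))) = (\<lambda>m. v m p)"
      by (simp add: v_def mult_ac del: of_nat_Suc)
    also have "sqrt (pi / (1 / (4 * p))) = 2 * sqrt pi * sqrt p"
      using p by (simp add: real_sqrt_mult)
    finally have "suminf E + (\<Sum>n. E (Suc n)) = 2 * sqrt pi * sqrt p * (1 + 2 * (\<Sum>m. v m p))" .
    moreover have "(\<Sum>n. E (Suc n)) = suminf E - 1" using suminf_split_head[OF sE] by (simp add: E_def)
    ultimately have "(\<Sum>n. u n p) = sqrt pi * sqrt p - 1 / 2 + 2 * sqrt pi * (sqrt p * (\<Sum>m. v m p))"
      unfolding Eu by (simp add: algebra_simps)
    note e = this
    have "complex_of_real (\<Sum>n. u n p) * \<phi> p =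
        of_real (sqrt pi) * (of_real (sqrt p) * \<phi> p) - 1 / 2 * \<phi> p + 2 * of_real (sqrt pi) * (of_real (\<Sum>m. v m p) * (of_real (sqrt p) * \<phi> p))"
      unfolding e by (simp add: algebra_simps)
    moreover have "of_real (sqrt p) * \<phi> p = \<psi> p"
    proof -
      have "complex_of_real (sqrt p) = complex_of_real p powr (1/2)"
        using p powr_of_real[of p "1/2"] by (simp add: powr_half_sqrt)
      then have "complex_of_real (sqrt p) * complex_of_real p powr (z - 1) = complex_of_real p powr (z + 1/2 - 1)"
        by (simp add: powr_add[symmetric] algebra_simps)
      then show ?thesis by (simp add: \<phi>_def \<psi>_def mult_ac)
    qed
    moreover have "(\<Sum>n. complex_of_real (u n p) * \<phi> p) = complex_of_real (\<Sum>n. u n p) * \<phi> p"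
      using suminf_mult2[OF summable_of_real[OF su, where 'a = complex], of "\<phi> p"] suminf_of_real[OF su, where 'a = complex] by simp
    moreover have "(\<Sum>n. complex_of_real (v n p) * \<psi> p) = complex_of_real (\<Sum>n. v n p) * \<psi> p"
      using suminf_mult2[OF summable_of_real[OF sv, where 'a = complex], of "\<psi> p"] suminf_of_real[OF sv, where 'a = complex] by simp
    ultimately show ?thesis by simp
  qed
  have "((\<lambda>p. of_real (sqrt pi) * \<psi> p - 1 / 2 * \<phi> p + 2 * of_real (sqrt pi) * (\<Sum>m. complex_of_real (v m p) * \<psi> p)) has_integral
     of_real (sqrt pi) * (Gamma (z + 1/2) * of_real Y powr (- (z + 1/2))) - 1 / 2 * (Gamma z * of_real Y powr (- z)) + 2 * of_real (sqrt pi) * R) {0<..}"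
    unfolding R_def
    by (intro has_integral_add has_integral_diff has_integral_mult_right I\<phi> I\<psi> integrable_integral sums2(1))
  then have "((\<lambda>p. \<Sum>n. complex_of_real (u n p) * \<phi> p) has_integral
     of_real (sqrt pi) * (Gamma (z + 1/2) * of_real Y powr (- (z + 1/2))) - 1 / 2 * (Gamma z * of_real Y powr (- z)) + 2 * of_real (sqrt pi) * R) {0<..}"
    by (rule has_integral_eq[rotated]) (simp add: theta)
  then have total: "integral {0<..} (\<lambda>p. \<Sum>n. complex_of_real (u n p) * \<phi> p) =
     of_real (sqrt pi) * (Gamma (z + 1/2) * of_real Y powr (- (z + 1/2))) - 1 / 2 * (Gamma z * of_real Y powr (- z)) + 2 * of_real (sqrt pi) * R"
    by (rule integral_unique)
  have sA: "(\<lambda>n. scaled_bessel_K z (of_real (real (Suc n) * y))) sums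
      (of_real Y powr z * integral {0<..} (\<lambda>p. \<Sum>n. complex_of_real (u n p) * \<phi> p))"
    unfolding K(2) by (rule sums_mult[OF sums1(2)])
  have sB: "(\<lambda>m. of_real Y powr z * (2 * of_real (sqrt pi) * Gamma (z + 1/2) *
       of_real (Y + 4 * pi\<^sup>2 * (real (Suc m))\<^sup>2) powr (- (z + 1/2)))) sums (of_real Y powr z * (2 * of_real (sqrt pi) * R))"
  proof -
    have "(\<lambda>m. Gamma (z + 1/2) * of_real (Y + 4 * pi\<^sup>2 * (real (Suc m))\<^sup>2) powr (- (z + 1/2))) sums R"
      using sums2(2) unfolding R_def integral_unique[OF V] .
    from sums_mult[OF sums_mult[OF this, of "2 * of_real (sqrt pi)"], of "of_real Y powr z"]
    show ?thesis by (simp only: mult.assoc)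
  qed
  have p1: "complex_of_real Y powr z * of_real Y powr (- z) = 1"
    using Y by (simp add: powr_add[symmetric])
  have p2: "complex_of_real Y powr z * of_real Y powr (- (z + 1/2)) = 1 / of_real y"
  proof -
    have "complex_of_real Y powr z * of_real Y powr (- (z + 1/2)) = of_real Y powr (of_real (- (1/2)))"
      using Y by (simp add: powr_add[symmetric])
    also have "\<dots> = of_real (Y powr (- (1/2)))" using Y by (intro powr_of_real) auto
    also have "Y powr (- (1/2)) = 1 / y"
    proof -
      have "Y powr (1/2) = y" using y by (simp add: Y_def powr_half_sqrt)
      then show ?thesis by (simp only: powr_minus inverse_eq_divide)
    qed
    finally show ?thesis by simp
  qed
  have "of_real Y powr z * integral {0<..} (\<lambda>p. \<Sum>n. complex_of_real (u n p) * \<phi> p) =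
     of_real (sqrt pi) * Gamma (z + 1/2) * (of_real Y powr z * of_real Y powr (- (z + 1/2)))
     - 1 / 2 * Gamma z * (of_real Y powr z * of_real Y powr (- z)) + of_real Y powr z * (2 * of_real (sqrt pi) * R)"
    unfolding total by (simp add: algebra_simps)
  then have "of_real Y powr z * integral {0<..} (\<lambda>p. \<Sum>n. complex_of_real (u n p) * \<phi> p)
      + Gamma z / 2 - of_real (sqrt pi) * Gamma (z + 1/2) / of_real y = of_real Y powr z * (2 * of_real (sqrt pi) * R)"
    unfolding p1 p2 by simp
  with sA sB show ?thesis unfolding Y_def by blast
qed

section \<open>Beta integrals of Bessel functions\<close>

lemma Gamma_nonzero_Re_pos:
  assumes "Re s > 0"
  shows "Gamma s \<noteq> 0"
  using assms by (auto simp: Gamma_eq_zero_iff elim!: nonpos_Ints_cases)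

definition beta_weight :: "complex \<Rightarrow> complex \<Rightarrow> real \<Rightarrow> complex" where
  "beta_weight a d t = complex_of_real t powr (a - 1) * (1 - complex_of_real t) powr (d - 1)"

lemma beta_weight_has_integral:
  assumes "Re a > 0" "Re d > 0"
  shows "(beta_weight a d has_integral Gamma a * Gamma d * rGamma (a + d)) {0<..<1}"
  using integrable_integral[OF euler_integrand_integrable[of 0 a d 0]] euler_integral_zero[OF assms, of 0] assms
  by (simp add: euler_integral_Ioo beta_weight_def[abs_def])

lemma beta_weight_mult_powr:
  assumes "t \<in> {0<..<1}"
  shows "beta_weight a d t * complex_of_real t powr s = beta_weight (a + s) d t"
  using assms by (simp add: beta_weight_def powr_add[symmetric] mult_ac) (simp add: powr_add[symmetric] mult.assoc[symmetric] algebra_simps)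

lemma norm_beta_weight':
  "t \<in> {0<..<1} \<Longrightarrow> norm (beta_weight a d t) = beta_density (Re a) (Re d) t"
  unfolding beta_weight_def by (rule norm_beta_weight)

text \<open>Termwise, t^n raises a to a + n in the beta integral, whose value then contains Gamma (a
  + n) rGamma (a + d + n): this inserts the numerator parameter a and the regularized denominator
  parameter a + d into the series.\<close>

lemma integral_beta_weight_bessel_E:
  assumes a: "Re a > 0" and d: "Re d > 0" and b: "b \<notin> \<int>\<^sub>\<le>\<^sub>0"
  shows "((\<lambda>t. beta_weight a d t * bessel_E b (q * of_real t)) has_integral
    Gamma a * Gamma d * rGamma b * hyp1F2_reg a (a + d) b q) {0<..<1}"
proof -
  let ?e = "hyp1F2_coeff 1 b 1"
  define f where "f = (\<lambda>n t. beta_weight a d t * (?e n * (q * complex_of_real t) ^ n))"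
  have fI: "(f n has_integral ?e n * q ^ n * (Gamma (a + of_nat n) * Gamma d * rGamma (a + of_nat n + d))) {0<..<1}" for n
  proof -
    have eq: "?e n * q ^ n * beta_weight (a + of_nat n) d t = f n t" if "t \<in> {0<..<1}" for t
    proof -
      have "complex_of_real t powr of_nat n = complex_of_real t ^ n" using that by (intro powr_nat') auto
      then show ?thesis unfolding beta_weight_mult_powr[OF that, symmetric] by (simp add: f_def power_mult_distrib mult_ac)
    qed
    have "((\<lambda>t. ?e n * q ^ n * beta_weight (a + of_nat n) d t) has_integral
        ?e n * q ^ n * (Gamma (a + of_nat n) * Gamma d * rGamma (a + of_nat n + d))) {0<..<1}"
      using a d by (intro has_integral_mult_right beta_weight_has_integral) auto
    from has_integral_eq[OF eq this] show ?thesis .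
  qed
  have dom: "norm (f n t) \<le> norm (?e n * q ^ n) * (1 * beta_density (Re a) (Re d) t)" if t: "t \<in> {0<..<1}" for n t
  proof -
    have "norm (f n t) = norm (?e n * q ^ n) * norm (beta_weight a d t) * t ^ n"
      using t by (simp add: f_def norm_mult norm_power power_mult_distrib)
    also have "\<dots> \<le> norm (?e n * q ^ n) * norm (beta_weight a d t) * 1"
      using t by (intro mult_left_mono power_le_one) auto
    finally show ?thesis unfolding norm_beta_weight'[OF t] by simp
  qed
  have fi: "f n integrable_on {0<..<1}" for n using fI by blast
  have nn: "0 \<le> 1 * beta_density (Re a) (Re d) t" for t by simp
  note S = sums_integral_majorized[OF fi beta_weight_integrable[OF a d, of 1] summable_norm_hyp1F2_coeff dom norm_ge_zero nn]
  have eq: "(\<Sum>n. f n t) = beta_weight a d t * bessel_E b (q * of_real t)" for t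
    unfolding f_def bessel_E_def hyp1F2_reg_altdef by (rule suminf_mult[OF summable_hyp1F2_coeff])
  have coeffs: "?e n * q ^ n * (Gamma (a + of_nat n) * Gamma d * rGamma (a + of_nat n + d)) =
      Gamma a * Gamma d * rGamma b * (hyp1F2_coeff a (a + d) b n * q ^ n)" for n
  proof -
    have "a \<notin> \<int>\<^sub>\<le>\<^sub>0" using a by (auto elim!: nonpos_Ints_cases)
    then have 1: "Gamma (a + of_nat n) = pochhammer a n * Gamma a"
      by (simp add: pochhammer_Gamma Gamma_eq_zero_iff)
    have "pochhammer b n \<noteq> 0" using b by (auto simp: pochhammer_eq_0_iff)
    then have 2: "rGamma (b + of_nat n) = rGamma b / pochhammer b n"
      by (simp add: pochhammer_rGamma[of b n] field_simps)
    have 3: "a + of_nat n + d = a + d + of_nat n" by simp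
    show ?thesis unfolding bessel_E_coeff unfolding hyp1F2_coeff_def 1 2 3 by simp
  qed
  have "(\<lambda>n. Gamma a * Gamma d * rGamma b * (hyp1F2_coeff a (a + d) b n * q ^ n)) sums integral {0<..<1} (\<lambda>t. \<Sum>n. f n t)"
    using S(2) unfolding integral_unique[OF fI] coeffs .
  moreover have "(\<lambda>n. Gamma a * Gamma d * rGamma b * (hyp1F2_coeff a (a + d) b n * q ^ n)) sums
      (Gamma a * Gamma d * rGamma b * hyp1F2_reg a (a + d) b q)"
    unfolding hyp1F2_reg_altdef by (intro sums_mult summable_sums summable_hyp1F2_coeff)
  ultimately have "integral {0<..<1} (\<lambda>t. \<Sum>n. f n t) = Gamma a * Gamma d * rGamma b * hyp1F2_reg a (a + d) b q"
    using sums_unique2 by blast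
  then show ?thesis using integrable_integral[OF S(1)] by (simp add: eq)
qed

text \<open>With \<open>a = \<mu> + \<lambda> + 1/2\<close> and \<open>c = \<lambda> + 1/2 - z\<close>, this is
  \<open>2\<^bsup>1-\<mu>-\<lambda>-z\<^esup> (w/2)\<^bsup>z-\<lambda>\<^esup> \<^sub>\<mu>K\<^sub>z(w, \<lambda>)\<close>.\<close>
definition gen_K :: "complex \<Rightarrow> complex \<Rightarrow> complex \<Rightarrow> complex \<Rightarrow> complex" where
  "gen_K a z c w = of_real pi / sin (z * of_real pi) *
    (Gamma a * rGamma (1 - z) * hyp1F2_reg a c (1 - z) (w\<^sup>2 / 4) -
     (w / 2) powr (2 * z) * (Gamma (a + z) * rGamma (1 + z) * hyp1F2_reg (a + z) (c + z) (1 + z) (w\<^sup>2 / 4)))"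

text \<open>Insert the series for K at w sqrt t: both power series become functions of q t, and
  (w/2)^(2z) is multiplied by t^z, which shifts a to a + z and hence c to c + z in the second
  part.\<close>

lemma gen_K_has_integral:
  assumes a: "Re a > 0" and d: "Re (c - a) > 0" and z: "Re z > 0" "z \<notin> \<int>" and w: "Re w > 0"
  shows "((\<lambda>t. beta_weight a (c - a) t * scaled_bessel_K z (w * of_real (sqrt t))) has_integral Gamma (c - a) * gen_K a z c w) {0<..<1}"
proof -
  let ?d = "c - a" and ?q = "w\<^sup>2 / 4" and ?k = "complex_of_real pi / sin (z * of_real pi)"
  have z1: "1 - z \<notin> \<int>\<^sub>\<le>\<^sub>0" "1 + z \<notin> \<int>\<^sub>\<le>\<^sub>0"
  proof -
    show "1 - z \<notin> \<int>\<^sub>\<le>\<^sub>0"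
    proof
      assume "1 - z \<in> \<int>\<^sub>\<le>\<^sub>0"
      then have "1 - (1 - z) \<in> \<int>" using nonpos_Ints_Int Ints_1 Ints_diff by blast
      then show False using z(2) by simp
    qed
    show "1 + z \<notin> \<int>\<^sub>\<le>\<^sub>0" using z(1) by (auto elim!: nonpos_Ints_cases simp: complex_eq_iff)
  qed
  have az: "Re (a + z) > 0" using a z by simp
  have "((\<lambda>t. ?k * (beta_weight a ?d t * bessel_E (1 - z) (?q * of_real t) -
      (w / 2) powr (2 * z) * (beta_weight (a + z) ?d t * bessel_E (1 + z) (?q * of_real t)))) has_integral
      ?k * (Gamma a * Gamma ?d * rGamma (1 - z) * hyp1F2_reg a (a + ?d) (1 - z) ?q -
        (w / 2) powr (2 * z) * (Gamma (a + z) * Gamma ?d * rGamma (1 + z) * hyp1F2_reg (a + z) (a + z + ?d) (1 + z) ?q))) {0<..<1}"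
    by (intro has_integral_mult_right has_integral_diff integral_beta_weight_bessel_E a az d z1)
  also have "?k * (Gamma a * Gamma ?d * rGamma (1 - z) * hyp1F2_reg a (a + ?d) (1 - z) ?q -
        (w / 2) powr (2 * z) * (Gamma (a + z) * Gamma ?d * rGamma (1 + z) * hyp1F2_reg (a + z) (a + z + ?d) (1 + z) ?q))
      = Gamma ?d * gen_K a z c w"
  proof -
    have "a + ?d = c" "a + z + ?d = c + z" by auto
    then show ?thesis by (simp add: gen_K_def algebra_simps)
  qed
  finally show ?thesis
  proof (rule has_integral_eq[rotated])
    fix t :: real assume t: "t \<in> {0<..<1}"
    let ?w = "w * of_real (sqrt t)"
    have "Re ?w > 0" using w t by simp
    have 1: "?w\<^sup>2 / 4 = ?q * of_real t"
      using t by (simp add: power_mult_distrib of_real_power[symmetric] del: of_real_power)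
    have 2: "(?w / 2) powr (2 * z) = (w / 2) powr (2 * z) * of_real t powr z"
    proof -
      have "(?w / 2) powr (2 * z) = (of_real (sqrt t) * (w / 2)) powr (2 * z)" by (simp add: mult.commute)
      also have "\<dots> = of_real (sqrt t) powr (2 * z) * (w / 2) powr (2 * z)"
        using t by (intro powr_times_real_left) auto
      also have "of_real (sqrt t) powr (2 * z) = complex_of_real t powr z"
        using t by (simp add: powr_def Ln_of_real ln_sqrt)
      finally show ?thesis by (simp add: mult.commute)
    qed
    show "?k * (beta_weight a ?d t * bessel_E (1 - z) (?q * of_real t) -
      (w / 2) powr (2 * z) * (beta_weight (a + z) ?d t * bessel_E (1 + z) (?q * of_real t))) =
      beta_weight a ?d t * scaled_bessel_K z ?w"
      unfolding scaled_bessel_K_series[OF \<open>Re ?w > 0\<close> z(2)] 1 2 beta_weight_mult_powr[OF t, symmetric]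
      by (simp add: algebra_simps)
  qed
qed

text \<open>The decay of K at w sqrt t contributes t^(-p), which the beta density absorbs by
  lowering Re a to Re a - p; hence p < Re a.\<close>

lemma gen_K_bound:
  assumes a: "Re a > p" and d: "Re (c - a) > 0" and z: "Re z > 0" "z \<notin> \<int>" and p: "p > 0" and M: "M > 0"
  obtains C where "\<And>w. Re w > 0 \<Longrightarrow> norm w \<le> M * Re w \<Longrightarrow> norm (gen_K a z c w) \<le> C * norm w powr (- (2 * p))"
proof -
  obtain C where C: "C > 0" "\<And>w. Re w > 0 \<Longrightarrow> norm w \<le> M * Re w \<Longrightarrow> norm (scaled_bessel_K z w) \<le> C * norm w powr (- (2 * p))"
    using scaled_bessel_K_bound[OF z(1) p M] by blast
  have dpos: "Gamma (c - a) \<noteq> 0" by (rule Gamma_nonzero_Re_pos[OF d])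
  define I where "I = integral {0<..<1} (\<lambda>t. beta_density (Re a - p) (Re (c - a)) t)"
  show thesis
  proof (rule that[of "C * I / norm (Gamma (c - a))"])
    fix w assume w: "Re w > 0" "norm w \<le> M * Re w"
    have "norm (Gamma (c - a) * gen_K a z c w) = norm (integral {0<..<1} (\<lambda>t. beta_weight a (c - a) t * scaled_bessel_K z (w * of_real (sqrt t))))"
      using integral_unique[OF gen_K_has_integral[OF _ d z w(1)]] a p by simp
    also have "\<dots> \<le> integral {0<..<1} (\<lambda>t. C * norm w powr (- (2 * p)) * beta_density (Re a - p) (Re (c - a)) t)"
    proof (rule integral_norm_bound_integral)
      show "(\<lambda>t. beta_weight a (c - a) t * scaled_bessel_K z (w * of_real (sqrt t))) integrable_on {0<..<1}"
        using gen_K_has_integral[OF _ d z w(1)] a p by (meson has_integral_integrable order_less_trans)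
      show "(\<lambda>t. C * norm w powr (- (2 * p)) * beta_density (Re a - p) (Re (c - a)) t) integrable_on {0<..<1}"
        using a d by (intro beta_weight_integrable) auto
      fix t :: real assume t: "t \<in> {0<..<1}"
      have "norm (scaled_bessel_K z (w * of_real (sqrt t))) \<le> C * norm (w * of_real (sqrt t)) powr (- (2 * p))"
        using t w by (intro C(2)) (auto simp: norm_mult mult_ac)
      also have "norm (w * of_real (sqrt t)) powr (- (2 * p)) = norm w powr (- (2 * p)) * t powr (- p)"
      proof -
        have "sqrt t powr (- (2 * p)) = t powr (- p)" using t by (simp add: powr_half_sqrt[symmetric] powr_powr)
        then show ?thesis using t by (simp add: norm_mult powr_mult)
      qed
      finally have "norm (beta_weight a (c - a) t * scaled_bessel_K z (w * of_real (sqrt t)))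
          \<le> beta_density (Re a) (Re (c - a)) t * (C * (norm w powr (- (2 * p)) * t powr (- p)))"
        unfolding norm_mult norm_beta_weight'[OF t] by (intro mult_left_mono) auto
      also have "\<dots> = C * norm w powr (- (2 * p)) * ((t powr (Re a - 1) * t powr (- p)) * (1 - t) powr (Re (c - a) - 1))"
        by (simp only: mult_ac)
      also have "t powr (Re a - 1) * t powr (- p) = t powr (Re a - p - 1)"
        by (simp add: powr_add[symmetric] algebra_simps)
      finally show "norm (beta_weight a (c - a) t * scaled_bessel_K z (w * of_real (sqrt t)))
          \<le> C * norm w powr (- (2 * p)) * beta_density (Re a - p) (Re (c - a)) t" .
    qed
    also have "\<dots> = C * norm w powr (- (2 * p)) * I"
      unfolding I_def by simp
    finally show "norm (gen_K a z c w) \<le> C * I / norm (Gamma (c - a)) * norm w powr (- (2 * p))"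
      using dpos by (simp add: norm_mult field_simps)
  qed
qed

section \<open>The terms of both sides as holomorphic functions of x in the right half-plane\<close>

abbreviation right_half_plane :: "complex set" where
  "right_half_plane \<equiv> {x. 0 < Re x}"

lemma locally_dominated_gen_K:
  assumes a: "Re a > 1 / 2" and d: "Re (c - a) > 0" and z: "Re z > 0" "z \<notin> \<int>"
  shows "locally_dominated right_half_plane (\<lambda>n x. gen_K a z c (of_nat (Suc n) * x))"
  unfolding locally_dominated_def
proof
  fix x assume "x \<in> right_half_plane"
  then have x: "Re x > 0" by simp
  \<comment> \<open>The midpoint of 1/2 and Re a: p < Re a for the bound of \<open>gen_K\<close>, 2
    p > 1 for summability over n.\<close>
  define p where "p = (1 / 2 + Re a) / 2"
  have p: "p > 1 / 2" "p < Re a" using a by (auto simp: p_def)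
  define \<delta> where "\<delta> = Re x / 2"
  have \<delta>: "\<delta> > 0" using x by (simp add: \<delta>_def)
  \<comment> \<open>On the ball norm y \<le> norm x + \<delta> and Re y \<ge> \<delta>, so that y
    and all its positive multiples lie in one sector.\<close>
  define M where "M = (norm x + \<delta>) / \<delta>"
  have M: "M > 0" using \<delta> by (simp add: M_def add_nonneg_pos)
  have p0: "p > 0" using p by simp
  obtain C where C: "\<And>w. Re w > 0 \<Longrightarrow> norm w \<le> M * Re w \<Longrightarrow> norm (gen_K a z c w) \<le> C * norm w powr (- (2 * p))"
    using gen_K_bound[OF p(2) d z p0 M] by blast
  have near: "Re y \<ge> \<delta>" "norm y \<le> norm x + \<delta>" "norm y \<ge> \<delta>" if "y \<in> ball x \<delta>" for y
  proof -
    have n: "norm (x - y) < \<delta>" using that by (simp add: dist_norm)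
    have "Re x - Re y \<le> norm (x - y)" using complex_Re_le_cmod[of "x - y"] by simp
    then show 1: "Re y \<ge> \<delta>" using n by (simp add: \<delta>_def)
    show "norm y \<le> norm x + \<delta>" using n norm_triangle_ineq2[of y x] by (simp add: norm_minus_commute)
    show "norm y \<ge> \<delta>" using 1 complex_Re_le_cmod[of y] by linarith
  qed
  show "\<exists>d>0. \<exists>h. summable h \<and> ball x d \<subseteq> right_half_plane \<and> (\<forall>n. \<forall>y\<in>ball x d. norm (gen_K a z c (of_nat (Suc n) * y)) \<le> h n)"
  proof (intro exI[of _ \<delta>] exI[of _ "\<lambda>n. \<bar>C\<bar> * \<delta> powr (- (2 * p)) * real (Suc n) powr (- (2 * p))"] conjI allI ballI)
    show "summable (\<lambda>n. \<bar>C\<bar> * \<delta> powr (- (2 * p)) * real (Suc n) powr (- (2 * p)))"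
      using p by (intro summable_mult summable_Suc_powr) auto
    show "ball x \<delta> \<subseteq> right_half_plane"
    proof
      fix y assume "y \<in> ball x \<delta>"
      from near(1)[OF this] \<delta> show "y \<in> right_half_plane" by simp
    qed
    fix n y assume y: "y \<in> ball x \<delta>"
    let ?w = "of_nat (Suc n) * y"
    have nw: "norm ?w = real (Suc n) * norm y" by (simp only: norm_mult norm_of_nat)
    have rw: "Re ?w = real (Suc n) * Re y" by (simp del: of_nat_Suc)
    have "norm y \<le> M * Re y"
    proof -
      have "norm y \<le> M * \<delta>" using near(2)[OF y] \<delta> by (simp add: M_def)
      also have "\<dots> \<le> M * Re y" using near(1)[OF y] M by (intro mult_left_mono) auto
      finally show ?thesis .
    qed
    then have "real (Suc n) * norm y \<le> real (Suc n) * (M * Re y)" by (intro mult_left_mono) auto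
    then have "norm ?w \<le> M * Re ?w" unfolding nw rw by (simp only: mult_ac)
    moreover have "Re ?w > 0" unfolding rw using near(1)[OF y] \<delta> by (intro mult_pos_pos) auto
    ultimately have "norm (gen_K a z c ?w) \<le> C * norm ?w powr (- (2 * p))" by (intro C)
    also have "\<dots> \<le> \<bar>C\<bar> * norm ?w powr (- (2 * p))" by (intro mult_right_mono) auto
    also have "norm ?w powr (- (2 * p)) = real (Suc n) powr (- (2 * p)) * norm y powr (- (2 * p))"
      unfolding nw by (rule powr_mult)
    also have "\<bar>C\<bar> * (real (Suc n) powr (- (2 * p)) * norm y powr (- (2 * p))) \<le> \<bar>C\<bar> * (real (Suc n) powr (- (2 * p)) * \<delta> powr (- (2 * p)))"
      using near(3)[OF y] \<delta> p by (intro mult_left_mono powr_mono2') auto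
    finally show "norm (gen_K a z c ?w) \<le> \<bar>C\<bar> * \<delta> powr (- (2 * p)) * real (Suc n) powr (- (2 * p))"
      by (simp only: mult_ac)
  qed (rule \<delta>)
qed

lemma holomorphic_gen_K:
  "(\<lambda>x. gen_K a z c (of_nat (Suc n) * x)) holomorphic_on right_half_plane"
proof -
  have slit: "of_nat (Suc n) * x / 2 \<notin> \<real>\<^sub>\<le>\<^sub>0" if "x \<in> right_half_plane" for x :: complex
    using that half_plane_slit[of "of_nat (Suc n) * x"] by (simp del: of_nat_Suc)
  have "(\<lambda>x. hyp1F2_reg a' c' b' ((of_nat (Suc n) * x)\<^sup>2 / 4)) holomorphic_on right_half_plane" for a' b' c'
  proof -
    have "(\<lambda>x. (of_nat (Suc n) * x)\<^sup>2 / 4 :: complex) holomorphic_on right_half_plane" by (intro holomorphic_intros) auto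
    from holomorphic_on_compose_gen[OF this holomorphic_hyp1F2_reg] show ?thesis by (simp add: o_def)
  qed
  then show ?thesis unfolding gen_K_def by (intro holomorphic_intros) (use slit in auto)
qed

definition lattice_arg :: "nat \<Rightarrow> complex \<Rightarrow> complex" where
  "lattice_arg n x = - (x\<^sup>2 / (4 * (of_real pi)\<^sup>2 * (of_nat (Suc n))\<^sup>2))"

definition lattice_term :: "complex \<Rightarrow> complex \<Rightarrow> complex \<Rightarrow> nat \<Rightarrow> complex \<Rightarrow> complex" where
  "lattice_term b z c n x = 1 / of_nat (Suc n) powr (2 * z + 1) * hyp2F1_reg (1/2 + z) b c (lattice_arg n x)"

text \<open>The value is real only if r = 0 or y is real, as Re y > 0; then it is at least
  1.\<close>

lemma one_plus_mult_square_slit: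
  assumes "Re y > 0" "r \<ge> 0"
  shows "1 + complex_of_real r * y\<^sup>2 \<notin> \<real>\<^sub>\<le>\<^sub>0"
proof
  assume *: "1 + complex_of_real r * y\<^sup>2 \<in> \<real>\<^sub>\<le>\<^sub>0"
  then have im: "r * (Re y * Im y) = 0" and re: "1 + r * (Re y * Re y - Im y * Im y) \<le> 0"
    by (auto simp: complex_nonpos_Reals_iff power2_eq_square)
  from im assms have "r = 0 \<or> Im y = 0" by auto
  then have "r * (Re y * Re y - Im y * Im y) \<ge> 0" using assms(2) by auto
  then show False using re by simp
qed

lemma lattice_arg_slit:
  assumes "Re x > 0"
  shows "1 - lattice_arg n x \<notin> \<real>\<^sub>\<le>\<^sub>0"
proof -
  have eq: "1 - lattice_arg n x = 1 + of_real (1 / (4 * pi\<^sup>2 * (real (Suc n))\<^sup>2)) * x\<^sup>2"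
    by (simp add: lattice_arg_def del: of_nat_Suc)
  show ?thesis unfolding eq by (rule one_plus_mult_square_slit[OF assms]) simp
qed

text \<open>Poisson summation at y = x sqrt t, integrated against
  \<open>beta_weight a (c - a)\<close>. The constant term gives a beta integral, the term in 1/y
  carries t^(-1/2) and gives the one with a - 1/2 and c - 1/2, and each term of the transformed
  series gives an Euler integral.\<close>

lemma base_identity:
  fixes x :: real
  assumes a: "Re a > 1 / 2" and d: "Re (c - a) > 0" and z: "Re z > 0" "z \<notin> \<int>" and x: "x > 0"
  shows "(\<Sum>n. gen_K a z c (of_nat (Suc n) * of_real x)) + Gamma z * Gamma a * rGamma c / 2
      - of_real (sqrt pi) * Gamma (z + 1/2) * Gamma (a - 1/2) * rGamma (c - 1/2) / of_real x
    = 2 * of_real (sqrt pi) * Gamma (z + 1/2) * Gamma (a + z) * of_real (2 * pi) powr (- (2 * z + 1)) *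
      (of_real x powr (2 * z) * (\<Sum>n. lattice_term (a + z) z (c + z) n (of_real x)))"
proof -
  let ?d = "c - a" and ?D = "beta_weight a (c - a)"
  have a0: "Re a > 0" and az: "Re (a + z) > 0" and ah: "Re (a - 1/2) > 0" using a z by auto
  have \<Gamma>d: "Gamma ?d \<noteq> 0" by (rule Gamma_nonzero_Re_pos[OF d])
  define f where "f = (\<lambda>n t. ?D t * scaled_bessel_K z (of_nat (Suc n) * of_real x * of_real (sqrt t)))"
  have fI: "(f n has_integral Gamma ?d * gen_K a z c (of_nat (Suc n) * of_real x)) {0<..<1}" for n
    unfolding f_def by (rule gen_K_has_integral[OF a0 d z]) (use x in \<open>simp del: of_nat_Suc\<close>)
  define p where "p = (1 / 2 + Re a) / 2"
  have p: "p > 1 / 2" "p < Re a" "p > 0" using a by (auto simp: p_def)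
  obtain C where C: "C > 0" "\<And>w. Re w > 0 \<Longrightarrow> norm w \<le> 1 * Re w \<Longrightarrow> norm (scaled_bessel_K z w) \<le> C * norm w powr (- (2 * p))"
    using scaled_bessel_K_bound[OF z(1) p(3), of 1] by auto
  have sm: "summable (\<lambda>n. real (Suc n) powr (- (2 * p)))" using p by (intro summable_Suc_powr) auto
  have arg: "of_nat (Suc n) * complex_of_real x * of_real (sqrt t) = of_real (real (Suc n) * (x * sqrt t))" for n t
    by (simp del: of_nat_Suc add: mult.assoc)
  have fdom: "norm (f n t) \<le> real (Suc n) powr (- (2 * p)) * (C * x powr (- (2 * p)) * beta_density (Re a - p) (Re ?d) t)"
    if t: "t \<in> {0<..<1}" for n t
  proof -
    have r: "real (Suc n) * (x * sqrt t) > 0" using t x by simp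
    have "norm (scaled_bessel_K z (of_real (real (Suc n) * (x * sqrt t)))) \<le> C * norm (complex_of_real (real (Suc n) * (x * sqrt t))) powr (- (2 * p))"
      using r by (intro C(2)) (simp_all only: Re_complex_of_real norm_of_real abs_of_pos mult_1)
    also have "norm (complex_of_real (real (Suc n) * (x * sqrt t))) = real (Suc n) * (x * sqrt t)"
      using r by (simp only: norm_of_real abs_of_pos)
    also have "(real (Suc n) * (x * sqrt t)) powr (- (2 * p)) = real (Suc n) powr (- (2 * p)) * (x powr (- (2 * p)) * sqrt t powr (- (2 * p)))"
      by (simp only: powr_mult)
    also have "sqrt t powr (- (2 * p)) = t powr (- p)"
      using t by (simp add: powr_half_sqrt[symmetric] powr_powr)
    finally have "norm (f n t) \<le> beta_density (Re a) (Re ?d) t * (C * (real (Suc n) powr (- (2 * p)) * (x powr (- (2 * p)) * t powr (- p))))"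
      unfolding f_def arg norm_mult norm_beta_weight'[OF t] by (intro mult_left_mono) auto
    also have "\<dots> = real (Suc n) powr (- (2 * p)) * (C * x powr (- (2 * p)) * ((t powr (Re a - 1) * t powr (- p)) * (1 - t) powr (Re ?d - 1)))"
      by (simp only: mult_ac)
    also have "t powr (Re a - 1) * t powr (- p) = t powr (Re a - p - 1)"
      by (simp add: powr_add[symmetric] algebra_simps)
    finally show ?thesis .
  qed
  have fi: "f n integrable_on {0<..<1}" for n using fI by blast
  have pint: "(\<lambda>t. C * x powr (- (2 * p)) * beta_density (Re a - p) (Re ?d) t) integrable_on {0<..<1}"
    using p d by (intro beta_weight_integrable) auto
  have nn: "0 \<le> C * x powr (- (2 * p)) * beta_density (Re a - p) (Re ?d) t" for t using C(1) by simp
  note F = sums_integral_majorized[OF fi pint sm fdom powr_ge_zero nn]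
  define K0 where "K0 = 2 * of_real (sqrt pi) * Gamma (z + 1/2)"
  define T where "T = (\<lambda>y m. of_real (y\<^sup>2) powr z * (2 * of_real (sqrt pi) * Gamma (z + 1/2) *
       complex_of_real (y\<^sup>2 + 4 * pi\<^sup>2 * (real (Suc m))\<^sup>2) powr (- (z + 1/2))))"
  define g where "g = (\<lambda>m t. ?D t * T (x * sqrt t) m)"
  define K1 where "K1 = (\<lambda>m. of_real (x\<^sup>2) powr z * K0 * complex_of_real (4 * pi\<^sup>2 * (real (Suc m))\<^sup>2) powr (- (z + 1/2)))"
  define \<xi> where "\<xi> = (\<lambda>m. lattice_arg m (of_real x))"
  have slit: "1 - \<xi> m \<notin> \<real>\<^sub>\<le>\<^sub>0" for m unfolding \<xi>_def by (rule lattice_arg_slit) (use x in simp)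
  \<comment> \<open>Taking k = 4 pi^2 (m + 1)^2 out of x^2 t + k leaves 1 + t x^2 / k = 1 - t \<xi>,
    Euler's third factor; the power t^z raises a to a + z.\<close>
  have g_eq: "g m t = K1 m * euler_integrand (\<xi> m) (1/2 + z) (a + z) ?d t" if t: "t \<in> {0<..<1}" for m t
  proof -
    define k where "k = 4 * pi\<^sup>2 * (real (Suc m))\<^sup>2"
    have k: "k > 0" by (simp add: k_def del: of_nat_Suc)
    have 1: "complex_of_real ((x * sqrt t)\<^sup>2) powr z = of_real (x\<^sup>2) powr z * of_real t powr z"
    proof -
      have "(x * sqrt t)\<^sup>2 = x\<^sup>2 * t" using t by (simp add: power_mult_distrib)
      then show ?thesis using t by (simp add: powr_times_real)
    qed
    have \<xi>: "1 - complex_of_real t * \<xi> m = of_real (1 + t * x\<^sup>2 / k)"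
      by (simp add: \<xi>_def lattice_arg_def k_def del: of_nat_Suc)
    have 2: "complex_of_real ((x * sqrt t)\<^sup>2 + k) powr (- (z + 1/2)) =
        of_real k powr (- (z + 1/2)) * (1 - complex_of_real t * \<xi> m) powr (- (1/2 + z))"
    proof -
      have "(x * sqrt t)\<^sup>2 + k = k * (1 + t * x\<^sup>2 / k)" using t k by (simp add: power_mult_distrib field_simps)
      then have "complex_of_real ((x * sqrt t)\<^sup>2 + k) powr (- (z + 1/2)) = (complex_of_real k * complex_of_real (1 + t * x\<^sup>2 / k)) powr (- (z + 1/2))"
        by (simp only: of_real_mult)
      also have "\<dots> = of_real k powr (- (z + 1/2)) * complex_of_real (1 + t * x\<^sup>2 / k) powr (- (z + 1/2))"
        using k t by (intro powr_times_real) (auto simp: add_nonneg_nonneg)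
      finally show ?thesis unfolding \<xi> by (simp only: add.commute)
    qed
    have 3: "?D t * complex_of_real t powr z = complex_of_real t powr (a + z - 1) * (1 - complex_of_real t) powr (?d - 1)"
      by (simp only: beta_weight_mult_powr[OF t]) (simp only: beta_weight_def)
    have "g m t = K1 m * ((?D t * complex_of_real t powr z) * (1 - complex_of_real t * \<xi> m) powr (- (1/2 + z)))"
      unfolding g_def T_def k_def[symmetric] 1 2 K1_def K0_def by (simp only: mult_ac)
    then show ?thesis unfolding 3 .
  qed
  have gI: "(g m has_integral K1 m * euler_integral (\<xi> m) (1/2 + z) (a + z) ?d) {0<..<1}" for m
  proof -
    have "((\<lambda>t. K1 m * euler_integrand (\<xi> m) (1/2 + z) (a + z) ?d t) has_integral K1 m * euler_integral (\<xi> m) (1/2 + z) (a + z) ?d) {0<..<1}"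
      unfolding euler_integral_Ioo by (intro has_integral_mult_right integrable_integral euler_integrand_integrable slit az d)
    then show ?thesis by (rule has_integral_eq[rotated]) (simp add: g_eq)
  qed
  \<comment> \<open>The positive power of x^2 t is estimated by its value at t = 1, the negative
    power of x^2 t + k by its value at t = 0.\<close>
  define C2 where "C2 = (x\<^sup>2) powr Re z * norm K0 * (4 * pi\<^sup>2) powr (- (Re z + 1/2))"
  have sm2: "summable (\<lambda>n. real (Suc n) powr (- (2 * (Re z + 1/2))))" using z by (intro summable_Suc_powr) auto
  have gdom: "norm (g m t) \<le> real (Suc m) powr (- (2 * (Re z + 1/2))) * (C2 * beta_density (Re a) (Re ?d) t)"
    if t: "t \<in> {0<..<1}" for m t
  proof -
    have "norm (T (x * sqrt t) m) \<le> C2 * real (Suc m) powr (- (2 * (Re z + 1/2)))"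
    proof -
      define k where "k = 4 * pi\<^sup>2 * (real (Suc m))\<^sup>2"
      have k: "k > 0" by (simp add: k_def del: of_nat_Suc)
      have y: "(x * sqrt t)\<^sup>2 = x\<^sup>2 * t" using t by (simp add: power_mult_distrib)
      have npr: "norm (complex_of_real r powr s) = r powr Re s" if "r \<ge> 0" for r s
        using norm_powr_real_powr[of "of_real r" s] that by simp
      have n1: "norm (complex_of_real (x\<^sup>2 * t) powr z) = (x\<^sup>2 * t) powr Re z"
        using t x by (intro npr) auto
      have "x\<^sup>2 * t + k \<ge> 0" using t k by (intro add_nonneg_nonneg) auto
      then have n2: "norm (complex_of_real (x\<^sup>2 * t + k) powr (- (z + 1/2))) = (x\<^sup>2 * t + k) powr (- (Re z + 1/2))"
        using npr[of "x\<^sup>2 * t + k" "- (z + 1/2)"] by (simp only: uminus_complex.sel plus_complex.sel one_complex.sel Re_divide_numeral)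
      have "norm (T (x * sqrt t) m) = (x\<^sup>2 * t) powr Re z * (norm K0 * (x\<^sup>2 * t + k) powr (- (Re z + 1/2)))"
        unfolding T_def y k_def[symmetric] K0_def[symmetric] norm_mult n1 n2 ..
      also have "\<dots> \<le> (x\<^sup>2) powr Re z * (norm K0 * k powr (- (Re z + 1/2)))"
        using t x k z by (intro mult_mono powr_mono2 powr_mono2' mult_left_mono) (auto simp: mult_left_le)
      also have "k powr (- (Re z + 1/2)) = (4 * pi\<^sup>2) powr (- (Re z + 1/2)) * real (Suc m) powr (- (2 * (Re z + 1/2)))"
      proof -
        have "((real (Suc m))\<^sup>2) powr (- (Re z + 1/2)) = (real (Suc m) powr 2) powr (- (Re z + 1/2))"
          by (simp del: of_nat_Suc)
        also have "\<dots> = real (Suc m) powr (- (2 * (Re z + 1/2)))"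
          unfolding powr_powr by (simp only: mult_minus_right)
        finally show ?thesis unfolding k_def powr_mult by (simp only:)
      qed
      finally show ?thesis unfolding C2_def by (simp only: mult_ac)
    qed
    then have "norm (g m t) \<le> beta_density (Re a) (Re ?d) t * (C2 * real (Suc m) powr (- (2 * (Re z + 1/2))))"
      unfolding g_def norm_mult norm_beta_weight'[OF t] by (intro mult_left_mono) auto
    then show ?thesis by (simp only: mult_ac)
  qed
  have gi: "g m integrable_on {0<..<1}" for m using gI by blast
  have nn2: "0 \<le> C2 * beta_density (Re a) (Re ?d) t" for t by (simp add: C2_def)
  note G = sums_integral_majorized[OF gi beta_weight_integrable[OF a0 d, of C2] sm2 gdom powr_ge_zero nn2]
  have pointwise: "(\<Sum>n. f n t) = (\<Sum>m. g m t) - Gamma z / 2 * ?D t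
      + of_real (sqrt pi) * Gamma (z + 1/2) / of_real x * beta_weight (a - 1/2) ?d t" if t: "t \<in> {0<..<1}" for t
  proof -
    have y: "x * sqrt t > 0" using t x by simp
    obtain A B where AB: "(\<lambda>n. scaled_bessel_K z (of_real (real (Suc n) * (x * sqrt t)))) sums A"
        "(\<lambda>m. T (x * sqrt t) m) sums B"
        "A + Gamma z / 2 - of_real (sqrt pi) * Gamma (z + 1/2) / of_real (x * sqrt t) = B"
      using scaled_bessel_K_Poisson[OF y z(1)] unfolding T_def by blast
    have fA: "(\<Sum>n. f n t) = ?D t * A"
      using sums_unique[OF sums_mult[OF AB(1), of "?D t"]] by (simp only: f_def arg)
    have gB: "(\<Sum>m. g m t) = ?D t * B"
      using sums_unique[OF sums_mult[OF AB(2), of "?D t"]] by (simp only: g_def)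
    have "?D t / of_real (sqrt t) = beta_weight (a - 1/2) ?d t"
    proof -
      have "complex_of_real t powr (- (1/2)) = of_real (t powr (- (1/2)))"
        using powr_of_real[of t "- (1/2)"] t by simp
      also have "t powr (- (1/2)) = 1 / sqrt t"
      proof -
        have "t powr (1/2) = sqrt t" using t by (simp add: powr_half_sqrt)
        then show ?thesis by (simp only: powr_minus inverse_eq_divide)
      qed
      finally have "?D t / of_real (sqrt t) = ?D t * complex_of_real t powr (- (1/2))" by simp
      also have "\<dots> = beta_weight (a + - (1/2)) ?d t" by (rule beta_weight_mult_powr[OF t])
      finally show ?thesis by simp
    qed
    moreover have "?D t * A = ?D t * B - Gamma z / 2 * ?D t + of_real (sqrt pi) * Gamma (z + 1/2) / of_real x * (?D t / of_real (sqrt t))"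
    proof -
      have A: "A = B - Gamma z / 2 + of_real (sqrt pi) * Gamma (z + 1/2) / of_real (x * sqrt t)"
        using AB(3) by (simp add: algebra_simps)
      show ?thesis unfolding A by (simp add: algebra_simps)
    qed
    ultimately show ?thesis unfolding fA gB by simp
  qed
  have "((\<lambda>t. (\<Sum>m. g m t) - Gamma z / 2 * ?D t + of_real (sqrt pi) * Gamma (z + 1/2) / of_real x * beta_weight (a - 1/2) ?d t)
    has_integral integral {0<..<1} (\<lambda>t. \<Sum>m. g m t) - Gamma z / 2 * (Gamma a * Gamma ?d * rGamma (a + ?d))
      + of_real (sqrt pi) * Gamma (z + 1/2) / of_real x * (Gamma (a - 1/2) * Gamma ?d * rGamma (a - 1/2 + ?d))) {0<..<1}"
    by (intro has_integral_add has_integral_diff has_integral_mult_right integrable_integral G(1) beta_weight_has_integral a0 ah d)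
  then have "((\<lambda>t. \<Sum>n. f n t)
    has_integral integral {0<..<1} (\<lambda>t. \<Sum>m. g m t) - Gamma z / 2 * (Gamma a * Gamma ?d * rGamma (a + ?d))
      + of_real (sqrt pi) * Gamma (z + 1/2) / of_real x * (Gamma (a - 1/2) * Gamma ?d * rGamma (a - 1/2 + ?d))) {0<..<1}"
    by (rule has_integral_eq[rotated]) (simp add: pointwise)
  then have I1: "integral {0<..<1} (\<lambda>t. \<Sum>n. f n t) = integral {0<..<1} (\<lambda>t. \<Sum>m. g m t) - Gamma z / 2 * (Gamma a * Gamma ?d * rGamma c)
      + of_real (sqrt pi) * Gamma (z + 1/2) / of_real x * (Gamma (a - 1/2) * Gamma ?d * rGamma (c - 1/2))"
    by (simp add: integral_unique algebra_simps)
  have "(\<lambda>n. Gamma ?d * gen_K a z c (of_nat (Suc n) * of_real x)) sums integral {0<..<1} (\<lambda>t. \<Sum>n. f n t)"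
    using F(2) unfolding integral_unique[OF fI] .
  \<comment> \<open>The factor Gamma (c - a), common to all beta integrals, is divided out on both
    sides.\<close>
  from sums_mult[OF this, of "inverse (Gamma ?d)"]
  have L: "(\<Sum>n. gen_K a z c (of_nat (Suc n) * of_real x)) = inverse (Gamma ?d) * integral {0<..<1} (\<lambda>t. \<Sum>n. f n t)"
    using \<Gamma>d by (simp add: sums_iff mult.assoc[symmetric] del: of_nat_Suc)
  define R where "R = 2 * of_real (sqrt pi) * Gamma (z + 1/2) * Gamma (a + z) * of_real (2 * pi) powr (- (2 * z + 1)) * of_real x powr (2 * z)"
  have trm: "inverse (Gamma ?d) * (K1 m * euler_integral (\<xi> m) (1/2 + z) (a + z) ?d) = R * lattice_term (a + z) z (c + z) m (of_real x)" for m
  proof -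
    have \<Gamma>az: "Gamma (a + z) * rGamma (a + z) = 1"
      using Gamma_nonzero_Re_pos[OF az] by (simp add: rGamma_inverse_Gamma)
    have \<xi>m: "lattice_arg m (of_real x) = \<xi> m" by (simp add: \<xi>_def)
    have e: "c + z - (a + z) = ?d" by simp
    have E: "hyp2F1_reg (1/2 + z) (a + z) (c + z) (\<xi> m) = rGamma (a + z) * inverse (Gamma ?d) * euler_integral (\<xi> m) (1/2 + z) (a + z) ?d"
      using hyp2F1_reg_Euler[OF slit az, of "c + z" "1/2 + z" m] d unfolding e by (simp add: rGamma_inverse_Gamma)
    have sq: "complex_of_real (y\<^sup>2) powr s = of_real y powr (2 * s)" if "y > 0" for y s
      using that by (simp add: powr_def Ln_of_real ln_realpow of_real_power[symmetric] mult_ac del: of_real_power)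
    have "complex_of_real (4 * pi\<^sup>2 * (real (Suc m))\<^sup>2) powr (- (z + 1/2)) = of_real (2 * pi * real (Suc m)) powr (2 * (- (z + 1/2)))"
    proof -
      have "4 * pi\<^sup>2 * (real (Suc m))\<^sup>2 = (2 * pi * real (Suc m))\<^sup>2" by (simp add: power_mult_distrib del: of_nat_Suc)
      moreover have "2 * pi * real (Suc m) > 0" by simp
      ultimately show ?thesis using sq by metis
    qed
    also have "2 * (- (z + 1/2)) = - (2 * z + 1)" by simp
    also have "complex_of_real (2 * pi * real (Suc m)) powr (- (2 * z + 1)) = of_real (2 * pi) powr (- (2 * z + 1)) * of_real (real (Suc m)) powr (- (2 * z + 1))"
      using powr_times_real[of "of_real (2 * pi)" "of_real (real (Suc m))" "- (2 * z + 1)"] by (simp del: of_nat_Suc)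
    also have "complex_of_real (real (Suc m)) powr (- (2 * z + 1)) = 1 / of_nat (Suc m) powr (2 * z + 1)"
      by (simp only: powr_minus of_real_of_nat_eq inverse_eq_divide)
    finally have K1: "K1 m = of_real x powr (2 * z) * K0 * (of_real (2 * pi) powr (- (2 * z + 1)) * (1 / of_nat (Suc m) powr (2 * z + 1)))"
      unfolding K1_def using sq[OF x, of z] by (simp only:)
    have "R * lattice_term (a + z) z (c + z) m (of_real x) =
        K1 m * (Gamma (a + z) * rGamma (a + z)) * inverse (Gamma ?d) * euler_integral (\<xi> m) (1/2 + z) (a + z) ?d"
      unfolding R_def lattice_term_def \<xi>m E K1 K0_def by (simp only: mult_ac)
    also have "\<dots> = inverse (Gamma ?d) * (K1 m * euler_integral (\<xi> m) (1/2 + z) (a + z) ?d)"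
      unfolding \<Gamma>az by (simp add: mult_ac)
    finally show ?thesis ..
  qed
  have "(\<lambda>m. K1 m * euler_integral (\<xi> m) (1/2 + z) (a + z) ?d) sums integral {0<..<1} (\<lambda>t. \<Sum>m. g m t)"
    using G(2) unfolding integral_unique[OF gI] .
  from sums_mult[OF this, of "inverse (Gamma ?d)"]
  have s1: "(\<lambda>m. R * lattice_term (a + z) z (c + z) m (of_real x)) sums (inverse (Gamma ?d) * integral {0<..<1} (\<lambda>t. \<Sum>m. g m t))"
    unfolding trm .
  \<comment> \<open>Summability is known for the terms multiplied by R and passes to the terms
    themselves because R is nonzero.\<close>
  have R0: "R \<noteq> 0"
  proof -
    have "Re (z + 1/2) > 0" using z by simp
    then have "Gamma (z + 1/2) \<noteq> 0" by (rule Gamma_nonzero_Re_pos)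
    moreover have "Gamma (a + z) \<noteq> 0" by (rule Gamma_nonzero_Re_pos[OF az])
    ultimately show ?thesis using x by (simp add: R_def)
  qed
  have "summable (\<lambda>m. R * lattice_term (a + z) z (c + z) m (of_real x))" using s1 by (simp add: sums_iff)
  then have "summable (\<lambda>m. lattice_term (a + z) z (c + z) m (of_real x))" using R0 by (simp add: summable_cmult_iff)
  then have RR: "R * (\<Sum>m. lattice_term (a + z) z (c + z) m (of_real x)) = inverse (Gamma ?d) * integral {0<..<1} (\<lambda>t. \<Sum>m. g m t)"
    using s1 by (simp add: sums_iff suminf_mult)
  have "inverse (Gamma ?d) * integral {0<..<1} (\<lambda>t. \<Sum>n. f n t) =
     inverse (Gamma ?d) * integral {0<..<1} (\<lambda>t. \<Sum>m. g m t) - Gamma z / 2 * (Gamma a * rGamma c)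
      + of_real (sqrt pi) * Gamma (z + 1/2) / of_real x * (Gamma (a - 1/2) * rGamma (c - 1/2))"
    unfolding I1 using \<Gamma>d by (simp add: field_simps)
  then have "(\<Sum>n. gen_K a z c (of_nat (Suc n) * of_real x)) + Gamma z * Gamma a * rGamma c / 2
      - of_real (sqrt pi) * Gamma (z + 1/2) * Gamma (a - 1/2) * rGamma (c - 1/2) / of_real x
    = R * (\<Sum>m. lattice_term (a + z) z (c + z) m (of_real x))"
    unfolding L RR by simp
  then show ?thesis unfolding R_def by (simp only: mult.assoc)
qed

section \<open>Lowering the parameter c\<close>

lemma right_half_plane_ball:
  assumes "Re x > 0" "y \<in> cball x (Re x / 2)"
  shows "Re y \<ge> Re x / 2"
proof -
  have "Re x - Re y \<le> norm (x - y)" using complex_Re_le_cmod[of "x - y"] by simp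
  also have "\<dots> \<le> Re x / 2" using assms(2) by (simp add: dist_norm)
  finally show ?thesis by simp
qed

text \<open>The Euler integrals are bounded uniformly in n: their third factor has base 1 + (t/k)
  y^2 with t/k in [0, 1] whatever n is, so one compact set contains all cases. The sum then
  converges by the factor n^(-2z-1).\<close>

lemma locally_dominated_lattice_term:
  assumes b: "Re b > 0" and d: "Re (c - b) > 0" and z: "Re z > 0"
  shows "locally_dominated right_half_plane (lattice_term b z c)"
  unfolding locally_dominated_def
proof
  fix x assume "x \<in> right_half_plane"
  then have x: "Re x > 0" by simp
  define \<delta> where "\<delta> = Re x / 2"
  have \<delta>: "\<delta> > 0" using x by (simp add: \<delta>_def)
  have H: "Re y > 0" if "y \<in> cball x \<delta>" for y
    using right_half_plane_ball[OF x, of y] that x by (simp add: \<delta>_def)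
  let ?\<Phi> = "\<lambda>p. (1 + complex_of_real (fst p) * (snd p)\<^sup>2) powr (- (1/2 + z))"
  have "continuous_on ({0..1} \<times> cball x \<delta>) ?\<Phi>"
  proof (rule continuous_on_powr_slit)
    show "1 + complex_of_real (fst p) * (snd p)\<^sup>2 \<notin> \<real>\<^sub>\<le>\<^sub>0" if "p \<in> {0..1} \<times> cball x \<delta>" for p
      using that H by (intro one_plus_mult_square_slit) auto
  qed (intro continuous_intros)+
  then have "bounded (?\<Phi> ` ({0..1} \<times> cball x \<delta>))"
    by (intro compact_imp_bounded compact_continuous_image compact_Times) auto
  then obtain M where M0: "\<And>p. p \<in> {0..1} \<times> cball x \<delta> \<Longrightarrow> norm (?\<Phi> p) \<le> M"
    unfolding bounded_iff by blast
  define B where "B = integral {0<..<1} (\<lambda>t. beta_density (Re b) (Re (c - b)) t)"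
  define C where "C = norm (rGamma b * rGamma (c - b)) * (M * B)"
  show "\<exists>d>0. \<exists>h. summable h \<and> ball x d \<subseteq> right_half_plane \<and> (\<forall>n. \<forall>y\<in>ball x d. norm (lattice_term b z c n y) \<le> h n)"
  proof (intro exI[of _ \<delta>] exI[of _ "\<lambda>n. C * real (Suc n) powr (- (2 * Re z + 1))"] conjI allI ballI)
    show "summable (\<lambda>n. C * real (Suc n) powr (- (2 * Re z + 1)))"
      using z by (intro summable_mult summable_Suc_powr) auto
    show "ball x \<delta> \<subseteq> right_half_plane" using H by (auto simp: subset_iff)
    fix n y assume "y \<in> ball x \<delta>"
    then have y: "y \<in> cball x \<delta>" by simp
    have slit: "1 - lattice_arg n y \<notin> \<real>\<^sub>\<le>\<^sub>0" by (rule lattice_arg_slit) (rule H[OF y])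
    define k where "k = 4 * pi\<^sup>2 * (real (Suc n))\<^sup>2"
    have k: "k \<ge> 1"
    proof -
      have "1 \<le> pi\<^sup>2" using pi_gt3 by (simp add: one_le_power)
      moreover have "1 \<le> (real (Suc n))\<^sup>2" by (simp add: one_le_power)
      ultimately have "1 * 1 \<le> pi\<^sup>2 * (real (Suc n))\<^sup>2" by (intro mult_mono) auto
      then show ?thesis unfolding k_def by linarith
    qed
    have "norm (euler_integral (lattice_arg n y) (1/2 + z) b (c - b)) \<le>
        integral {0<..<1} (\<lambda>t. M * beta_density (Re b) (Re (c - b)) t)"
      unfolding euler_integral_Ioo
    proof (rule integral_norm_bound_integral)
      show "(\<lambda>t. euler_integrand (lattice_arg n y) (1/2 + z) b (c - b) t) integrable_on {0<..<1}"
        by (rule euler_integrand_integrable[OF slit b d])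
      show "(\<lambda>t. M * beta_density (Re b) (Re (c - b)) t) integrable_on {0<..<1}"
        using b d by (rule beta_weight_integrable)
      fix t :: real assume t: "t \<in> {0<..<1}"
      have e: "1 - complex_of_real t * lattice_arg n y = 1 + complex_of_real (t / k) * y\<^sup>2"
        by (simp add: lattice_arg_def k_def del: of_nat_Suc)
      have "t / k \<le> 1" using t k by (simp add: field_simps)
      then have "(t / k, y) \<in> {0..1} \<times> cball x \<delta>" using t k y by auto
      from M0[OF this] have "norm ((1 - complex_of_real t * lattice_arg n y) powr (- (1/2 + z))) \<le> M"
        unfolding e by simp
      then show "norm (euler_integrand (lattice_arg n y) (1/2 + z) b (c - b) t) \<le> M * beta_density (Re b) (Re (c - b)) t"
        unfolding norm_mult[of "_ * _"] norm_beta_weight[OF t] mult.commute[of M] by (intro mult_left_mono) auto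
    qed
    also have "\<dots> = M * B" by (simp add: B_def)
    finally have E: "norm (euler_integral (lattice_arg n y) (1/2 + z) b (c - b)) \<le> M * B" .
    have "norm (1 / of_nat (Suc n) powr (2 * z + 1)) = real (Suc n) powr (- (2 * Re z + 1))"
    proof -
      have e: "real (Suc n) powr (- (2 * Re z + 1)) = 1 / real (Suc n) powr (2 * Re z + 1)"
        by (simp only: powr_minus inverse_eq_divide)
      show ?thesis unfolding e
        using norm_powr_real_powr[of "of_nat (Suc n)" "2 * z + 1"] by (simp add: norm_divide del: of_nat_Suc)
    qed
    moreover have "Re b < Re c" using d by simp
    ultimately have "norm (lattice_term b z c n y) = real (Suc n) powr (- (2 * Re z + 1)) *
        (norm (rGamma b * rGamma (c - b)) * norm (euler_integral (lattice_arg n y) (1/2 + z) b (c - b)))"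
      by (simp only: lattice_term_def norm_mult hyp2F1_reg_Euler[OF slit b] mult.assoc)
    also have "\<dots> \<le> real (Suc n) powr (- (2 * Re z + 1)) * C"
      unfolding C_def using E by (intro mult_left_mono) auto
    finally show "norm (lattice_term b z c n y) \<le> C * real (Suc n) powr (- (2 * Re z + 1))"
      by (simp only: mult.commute)
  qed (rule \<delta>)
qed

text \<open>The argument is homogeneous of degree 2 in x, so x d/dx is 2 \<xi> d/d\<xi>; the
  derivative with its raised parameters is replaced through the contiguous relation at c -
  1.\<close>

lemma lattice_term_has_field_derivative:
  assumes b: "Re b > 0" and x: "Re x > 0"
  shows "(lattice_term b z c n has_field_derivative
    2 / x * (lattice_term b z (c - 1) n x - (c - 1) * lattice_term b z c n x)) (at x)"
proof -
  let ?A = "1/2 + z" and ?\<xi> = "lattice_arg n x"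
  have x0: "x \<noteq> 0" using x by auto
  have slit: "1 - ?\<xi> \<notin> \<real>\<^sub>\<le>\<^sub>0" by (rule lattice_arg_slit[OF x])
  have D\<xi>: "(lattice_arg n has_field_derivative 2 * ?\<xi> / x) (at x)"
    unfolding lattice_arg_def[abs_def] using x0
    by (auto intro!: derivative_eq_intros simp: power2_eq_square simp del: of_nat_Suc)
  have "hyp2F1_reg ?A b (c - 1) ?\<xi> = (c - 1) * hyp2F1_reg ?A b c ?\<xi> + ?A * b * ?\<xi> * hyp2F1_reg (?A + 1) (b + 1) (c + 1) ?\<xi>"
    using hyp2F1_reg_contiguous[OF slit b, of ?A "c - 1"] by (simp add: add.commute)
  then have e: "?A * b * hyp2F1_reg (?A + 1) (b + 1) (c + 1) ?\<xi> * (2 * ?\<xi> / x) =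
      2 / x * (hyp2F1_reg ?A b (c - 1) ?\<xi> - (c - 1) * hyp2F1_reg ?A b c ?\<xi>)"
    by simp
  have "((\<lambda>x. hyp2F1_reg ?A b c (lattice_arg n x)) has_field_derivative
      2 / x * (hyp2F1_reg ?A b (c - 1) ?\<xi> - (c - 1) * hyp2F1_reg ?A b c ?\<xi>)) (at x)"
    using DERIV_chain2[OF hyp2F1_reg_has_field_derivative[OF slit b, of ?A c] D\<xi>] unfolding e .
  from DERIV_cmult[OF this, of "1 / of_nat (Suc n) powr (2 * z + 1)"]
  show ?thesis unfolding lattice_term_def[abs_def] by (simp only: right_diff_distrib mult_ac)
qed

text \<open>Both parts of \<open>gen_K\<close> obey the same relation: in the second, the power
  (w/2)^(2z) contributes z, which makes up for the parameter c + z in place of c.\<close>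

lemma gen_K_has_field_derivative:
  assumes x: "Re x > 0"
  shows "((\<lambda>x. gen_K a z c (of_nat (Suc n) * x)) has_field_derivative
    2 / x * (gen_K a z (c - 1) (of_nat (Suc n) * x) - (c - 1) * gen_K a z c (of_nat (Suc n) * x))) (at x)"
proof -
  define w where "w = of_nat (Suc n) * x"
  let ?q = "w\<^sup>2 / 4" and ?k = "complex_of_real pi / sin (z * of_real pi)"
  have x0: "x \<noteq> 0" using x by auto
  have slit: "w / 2 \<notin> \<real>\<^sub>\<le>\<^sub>0" using x unfolding w_def by (intro half_plane_slit) (simp del: of_nat_Suc)
  have Q: "((\<lambda>x. (of_nat (Suc n) * x)\<^sup>2 / 4) has_field_derivative 2 / x * ?q) (at x)"
    unfolding w_def using x0 by (auto intro!: derivative_eq_intros simp: power2_eq_square simp del: of_nat_Suc)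
  have H: "((\<lambda>x. hyp1F2_reg a' c' b' ((of_nat (Suc n) * x)\<^sup>2 / 4)) has_field_derivative
      2 / x * (hyp1F2_reg a' (c' - 1) b' ?q - (c' - 1) * hyp1F2_reg a' c' b' ?q)) (at x)" for a' c' b'
  proof -
    have "(hyp1F2_reg a' c' b' has_field_derivative deriv (hyp1F2_reg a' c' b') ?q) (at ?q)"
      using holomorphic_derivI[OF holomorphic_hyp1F2_reg open_UNIV UNIV_I] .
    from DERIV_chain2[OF this[unfolded w_def] Q]
    show ?thesis using hyp1F2_reg_lower[of a' c' b' ?q] by (simp add: w_def mult_ac del: of_nat_Suc)
  qed
  have P: "((\<lambda>x. (of_nat (Suc n) * x / 2) powr (2 * z)) has_field_derivative 2 / x * (z * (w / 2) powr (2 * z))) (at x)"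
  proof -
    have "((\<lambda>x. (of_nat (Suc n) * x / 2) powr (2 * z)) has_field_derivative
        (2 * z * (w / 2) powr (2 * z - 1)) * (of_nat (Suc n) / 2)) (at x)"
      using slit unfolding w_def
      by (intro DERIV_chain2[where f = "\<lambda>u. u powr (2 * z)", OF has_field_derivative_powr])
        (auto intro!: derivative_eq_intros simp del: of_nat_Suc)
    also have "(w / 2) powr (2 * z - 1) = (w / 2) powr (2 * z) / (w / 2)"
      using x0 by (simp add: powr_diff w_def del: of_nat_Suc)
    also have "2 * z * ((w / 2) powr (2 * z) / (w / 2)) * (of_nat (Suc n) / 2) = 2 / x * (z * (w / 2) powr (2 * z))"
      using x0 by (simp add: w_def del: of_nat_Suc)
    finally show ?thesis .
  qed
  let ?g1 = "Gamma a * rGamma (1 - z)" and ?g2 = "Gamma (a + z) * rGamma (1 + z)"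
  let ?h = "\<lambda>c. hyp1F2_reg a c (1 - z) ?q" and ?h2 = "\<lambda>c. hyp1F2_reg (a + z) (c + z) (1 + z) ?q"
  let ?P = "(w / 2) powr (2 * z)"
  have "((\<lambda>x. gen_K a z c (of_nat (Suc n) * x)) has_field_derivative
     ?k * (?g1 * (2 / x * (?h (c - 1) - (c - 1) * ?h c)) -
      (2 / x * (z * ?P) * (?g2 * ?h2 c) +
        (?g2 * (2 / x * (hyp1F2_reg (a + z) (c + z - 1) (1 + z) ?q - (c + z - 1) * ?h2 c))) * ?P))) (at x)"
    unfolding gen_K_def w_def
    by (intro DERIV_cmult DERIV_diff DERIV_mult H[unfolded w_def] P[unfolded w_def])
  also have "?k * (?g1 * (2 / x * (?h (c - 1) - (c - 1) * ?h c)) -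
      (2 / x * (z * ?P) * (?g2 * ?h2 c) +
        (?g2 * (2 / x * (hyp1F2_reg (a + z) (c + z - 1) (1 + z) ?q - (c + z - 1) * ?h2 c))) * ?P))
    = 2 / x * (?k * (?g1 * ?h (c - 1) - ?P * (?g2 * ?h2 (c - 1))) - (c - 1) * (?k * (?g1 * ?h c - ?P * (?g2 * ?h2 c))))"
  proof -
    have *: "k * (g1 * (y * (h' - (c - 1) * h)) - (y * (z * P) * (g2 * h2) + (g2 * (y * (h2' - (c + z - 1) * h2))) * P))
      = y * (k * (g1 * h' - P * (g2 * h2')) - (c - 1) * (k * (g1 * h - P * (g2 * h2))))"
      for k g1 y h' h P g2 h2 h2' :: complex
      by (simp add: algebra_simps)
    have "c + z - 1 = c - 1 + z" by simp
    then show ?thesis using * by metis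
  qed
  finally show ?thesis unfolding gen_K_def w_def .
qed

lemma locally_dominated_combine:
  assumes "locally_dominated S f" "locally_dominated S g"
  shows "locally_dominated S (\<lambda>n x. \<alpha> * f n x + x / 2 * g n x)"
  unfolding locally_dominated_def
proof
  fix x assume x: "x \<in> S"
  obtain d1 h1 where d1: "d1 > 0" "summable h1" "ball x d1 \<subseteq> S" "\<forall>n. \<forall>y\<in>ball x d1. norm (f n y) \<le> h1 n"
    using assms(1) x by (rule locally_dominatedE)
  obtain d2 h2 where d2: "d2 > 0" "summable h2" "ball x d2 \<subseteq> S" "\<forall>n. \<forall>y\<in>ball x d2. norm (g n y) \<le> h2 n"
    using assms(2) x by (rule locally_dominatedE)
  show "\<exists>d>0. \<exists>h. summable h \<and> ball x d \<subseteq> S \<and> (\<forall>n. \<forall>y\<in>ball x d. norm (\<alpha> * f n y + y / 2 * g n y) \<le> h n)"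
  proof (intro exI[of _ "min d1 d2"] exI[of _ "\<lambda>n. norm \<alpha> * h1 n + (norm x + d2) * h2 n"] conjI allI ballI)
    show "summable (\<lambda>n. norm \<alpha> * h1 n + (norm x + d2) * h2 n)"
      using d1 d2 by (intro summable_add summable_mult)
    show "ball x (min d1 d2) \<subseteq> S" using d1(3) by auto
    fix n y assume y: "y \<in> ball x (min d1 d2)"
    have "norm (y / 2) \<le> norm y" by (simp add: norm_divide)
    also have "norm y \<le> norm x + d2"
      using y norm_triangle_ineq2[of y x] by (simp add: dist_norm norm_minus_commute)
    finally have ny: "norm (y / 2) \<le> norm x + d2" .
    have "norm (\<alpha> * f n y + y / 2 * g n y) \<le> norm \<alpha> * norm (f n y) + norm (y / 2) * norm (g n y)"
      by (metis norm_mult norm_triangle_ineq)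
    also have "\<dots> \<le> norm \<alpha> * h1 n + (norm x + d2) * h2 n"
    proof (intro add_mono mult_left_mono mult_mono)
      show "norm (f n y) \<le> h1 n" using d1(4) y by simp
      show "norm (g n y) \<le> h2 n" using d2(4) y by simp
    qed (use ny d2(1) in auto)
    finally show "norm (\<alpha> * f n y + y / 2 * g n y) \<le> norm \<alpha> * h1 n + (norm x + d2) * h2 n" .
  qed (use d1(1) d2(1) in simp)
qed

text \<open>The majorants belong to the statement because lowering c differentiates both series
  termwise and has to hand the majorants on to the next step.\<close>

definition lattice_identity :: "complex \<Rightarrow> complex \<Rightarrow> complex \<Rightarrow> bool" where
  "lattice_identity a z c \<longleftrightarrow>
     locally_dominated right_half_plane (\<lambda>n x. gen_K a z c (of_nat (Suc n) * x)) \<and>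
     locally_dominated right_half_plane (lattice_term (a + z) z (c + z)) \<and>
     (\<forall>x\<in>right_half_plane. (\<Sum>n. gen_K a z c (of_nat (Suc n) * x)) + Gamma z * Gamma a * rGamma c / 2
       - of_real (sqrt pi) * Gamma (z + 1/2) * Gamma (a - 1/2) * rGamma (c - 1/2) / x
     = 2 * of_real (sqrt pi) * Gamma (z + 1/2) * Gamma (a + z) * of_real (2 * pi) powr (- (2 * z + 1)) *
       (x powr (2 * z) * (\<Sum>n. lattice_term (a + z) z (c + z) n x)))"

lemma holomorphic_lattice_term:
  assumes "Re b > 0"
  shows "lattice_term b z c n holomorphic_on right_half_plane"
proof (rule holomorphic_onI)
  fix x assume "x \<in> right_half_plane"
  then have "Re x > 0" by simp
  from lattice_term_has_field_derivative[OF assms this]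
  show "lattice_term b z c n field_differentiable at x within right_half_plane"
    by (meson field_differentiable_at_within field_differentiable_def)
qed

lemma lattice_identity_base:
  assumes a: "Re a > 1 / 2" and d: "Re (c - a) > 0" and z: "Re z > 0" "z \<notin> \<int>"
  shows "lattice_identity a z c"
proof -
  have az: "Re (a + z) > 0" using a z by simp
  have e: "c + z - (a + z) = c - a" by simp
  have dz: "Re (c + z - (a + z)) > 0" unfolding e by (rule d)
  note dom1 = locally_dominated_gen_K[OF a d z] and dom2 = locally_dominated_lattice_term[OF az dz z(1)]
  have op: "open right_half_plane" "connected right_half_plane"
    by (auto intro: open_halfspace_Re_gt convex_connected convex_halfspace_Re_gt)
  let ?L = "\<lambda>x. (\<Sum>n. gen_K a z c (of_nat (Suc n) * x)) + Gamma z * Gamma a * rGamma c / 2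
       - of_real (sqrt pi) * Gamma (z + 1/2) * Gamma (a - 1/2) * rGamma (c - 1/2) / x"
  let ?R = "\<lambda>x. 2 * of_real (sqrt pi) * Gamma (z + 1/2) * Gamma (a + z) * of_real (2 * pi) powr (- (2 * z + 1)) *
       (x powr (2 * z) * (\<Sum>n. lattice_term (a + z) z (c + z) n x))"
  have hol1: "(\<lambda>x. \<Sum>n. gen_K a z c (of_nat (Suc n) * x)) holomorphic_on right_half_plane"
    by (rule locally_dominated_holomorphic[OF op(1) holomorphic_gen_K dom1])
  have hol2: "(\<lambda>x. \<Sum>n. lattice_term (a + z) z (c + z) n x) holomorphic_on right_half_plane"
    by (rule locally_dominated_holomorphic[OF op(1) holomorphic_lattice_term[OF az] dom2])
  have "?L x - ?R x = 0" if x: "x \<in> right_half_plane" for x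
  proof (rule analytic_continuation[OF _ op, where U = "of_real ` {0<..}" and \<xi> = 1 and w = x and f = "\<lambda>x. ?L x - ?R x"])
    have nz: "x \<noteq> 0" "x \<notin> \<real>\<^sub>\<le>\<^sub>0" if "x \<in> right_half_plane" for x
      using that by (auto simp: complex_nonpos_Reals_iff)
    show "(\<lambda>x. ?L x - ?R x) holomorphic_on right_half_plane"
      by (intro holomorphic_intros hol1 hol2) (use nz in auto)
    show "?L y - ?R y = 0" if "y \<in> of_real ` {0<..}" for y
    proof -
      from that obtain r where "y = of_real r" "r > 0" by auto
      then show ?thesis using base_identity[OF a d z, of r] by simp
    qed
  qed (use x one_islimpt_pos_reals in auto)
  then show ?thesis unfolding lattice_identity_def using dom1 dom2 by simp
qed

text \<open>The operator (c - 1) + (x/2) d/dx respects every part: on constants it is c - 1, which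
  lowers rGamma c; on 1/x it is c - 3/2, which lowers rGamma (c - 1/2); and commuting it past x^(2z)
  adds z, which is the shift from c to c + z in the hypergeometric terms.\<close>

lemma lattice_identity_lower:
  assumes az: "Re (a + z) > 0" and P: "lattice_identity a z c"
  shows "lattice_identity a z (c - 1)"
proof -
  let ?H = right_half_plane
  define f where "f = (\<lambda>c n x. gen_K a z c (of_nat (Suc n) * x))"
  define g where "g = (\<lambda>c. lattice_term (a + z) z (c + z))"
  define k1 where "k1 = (\<lambda>c. Gamma z * Gamma a * rGamma c / 2)"
  define k2 where "k2 = (\<lambda>c. of_real (sqrt pi) * Gamma (z + 1/2) * Gamma (a - 1/2) * rGamma (c - 1/2))"
  define R where "R = 2 * of_real (sqrt pi) * Gamma (z + 1/2) * Gamma (a + z) * complex_of_real (2 * pi) powr (- (2 * z + 1))"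
  have dom: "locally_dominated ?H (f c)" "locally_dominated ?H (g c)"
    and id: "\<And>x. x \<in> ?H \<Longrightarrow> (\<Sum>n. f c n x) + k1 c - k2 c / x = R * (x powr (2 * z) * (\<Sum>n. g c n x))"
    using P unfolding lattice_identity_def f_def g_def k1_def k2_def R_def by auto
  have op: "open ?H" by (rule open_halfspace_Re_gt)
  have hol: "f c n holomorphic_on ?H" "g c n holomorphic_on ?H" for n
    unfolding f_def g_def by (rule holomorphic_gen_K holomorphic_lattice_term[OF az])+
  have fd: "f (c - 1) n x = (c - 1) * f c n x + x / 2 * deriv (f c n) x" if "x \<in> ?H" for n x
  proof -
    from that have "x \<noteq> 0" "Re x > 0" by auto
    then show ?thesis
      using DERIV_imp_deriv[OF gen_K_has_field_derivative[of x a z c n]] unfolding f_def by (simp add: field_simps del: of_nat_Suc)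
  qed
  have gd: "g (c - 1) n x = (c + z - 1) * g c n x + x / 2 * deriv (g c n) x" if "x \<in> ?H" for n x
  proof -
    from that have "x \<noteq> 0" "Re x > 0" by auto
    moreover have "c + z - 1 = c - 1 + z" by simp
    ultimately show ?thesis
      using DERIV_imp_deriv[OF lattice_term_has_field_derivative[OF az, of x z "c + z" n]] unfolding g_def by (simp add: field_simps)
  qed
  note derf = locally_dominated_deriv[OF hol(1) dom(1)] and derg = locally_dominated_deriv[OF hol(2) dom(2)]
  have dom': "locally_dominated ?H (f (c - 1))" "locally_dominated ?H (g (c - 1))"
    using locally_dominated_cong[OF locally_dominated_combine[OF dom(1) derf], of "f (c - 1)" "c - 1", OF fd]
      locally_dominated_cong[OF locally_dominated_combine[OF dom(2) derg], of "g (c - 1)" "c + z - 1", OF gd]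
    by simp_all
  have "(\<Sum>n. f (c - 1) n x) + k1 (c - 1) - k2 (c - 1) / x = R * (x powr (2 * z) * (\<Sum>n. g (c - 1) n x))" if x: "x \<in> ?H" for x
  proof -
    have x0: "x \<noteq> 0" and slit: "x \<notin> \<real>\<^sub>\<le>\<^sub>0" using x by (auto simp: complex_nonpos_Reals_iff)
    define F F' G G' where "F = (\<Sum>n. f c n x)" and "F' = (\<Sum>n. deriv (f c n) x)"
      and "G = (\<Sum>n. g c n x)" and "G' = (\<Sum>n. deriv (g c n) x)"
    have sf: "summable (\<lambda>n. f c n x)" "summable (\<lambda>n. deriv (f c n) x)" "summable (\<lambda>n. g c n x)" "summable (\<lambda>n. deriv (g c n) x)"
      using locally_dominated_summable[OF _ x] dom derf derg by blast+
    have F: "(\<Sum>n. f (c - 1) n x) = (c - 1) * F + x / 2 * F'"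
    proof -
      have "(\<lambda>n. (c - 1) * f c n x + x / 2 * deriv (f c n) x) sums ((c - 1) * F + x / 2 * F')"
        unfolding F_def F'_def by (intro sums_add sums_mult summable_sums sf)
      then show ?thesis using fd[OF x] by (simp add: sums_iff)
    qed
    have G: "(\<Sum>n. g (c - 1) n x) = (c + z - 1) * G + x / 2 * G'"
    proof -
      have "(\<lambda>n. (c + z - 1) * g c n x + x / 2 * deriv (g c n) x) sums ((c + z - 1) * G + x / 2 * G')"
        unfolding G_def G'_def by (intro sums_add sums_mult summable_sums sf)
      then show ?thesis using gd[OF x] by (simp add: sums_iff)
    qed
    have DF: "((\<lambda>x. \<Sum>n. f c n x) has_field_derivative F') (at x)"
      unfolding F'_def by (rule locally_dominated_has_derivative[OF op hol(1) dom(1) x])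
    have DG: "((\<lambda>x. \<Sum>n. g c n x) has_field_derivative G') (at x)"
      unfolding G'_def by (rule locally_dominated_has_derivative[OF op hol(2) dom(2) x])
    have DP: "((\<lambda>x. x powr (2 * z)) has_field_derivative 2 * z * x powr (2 * z) / x) (at x)"
      using has_field_derivative_powr[OF slit, of "2 * z"] x0 by (simp add: powr_diff)
    have DL: "((\<lambda>x. (\<Sum>n. f c n x) + k1 c - k2 c / x) has_field_derivative F' + k2 c / (x * x)) (at x)"
      using x0 by (auto intro!: derivative_eq_intros DF)
    have DR: "((\<lambda>x. R * (x powr (2 * z) * (\<Sum>n. g c n x))) has_field_derivative
        R * (2 * z * x powr (2 * z) / x * G + G' * x powr (2 * z))) (at x)"
      unfolding G_def by (intro DERIV_cmult DERIV_mult DP DG)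
    have "((\<lambda>x. R * (x powr (2 * z) * (\<Sum>n. g c n x))) has_field_derivative F' + k2 c / (x * x)) (at x)"
      by (rule has_field_derivative_transform_within_open[OF DL op x]) (rule id)
    then have D: "F' + k2 c / (x * x) = R * (2 * z * x powr (2 * z) / x * G + G' * x powr (2 * z))"
      using DR DERIV_unique by blast
    have I: "F + k1 c - k2 c / x = R * (x powr (2 * z) * G)"
      using id[OF x] by (simp add: F_def G_def)
    have r1: "k1 (c - 1) = (c - 1) * k1 c"
      using rGamma_plus1[of "c - 1"] by (simp add: k1_def)
    have r2: "k2 (c - 1) = (c - 3/2) * k2 c"
    proof -
      have "c - 1 - 1/2 = c - 3/2" "c - 3/2 + 1 = c - 1/2" by simp_all
      then have "rGamma (c - 1 - 1/2) = (c - 3/2) * rGamma (c - 1/2)"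
        using rGamma_plus1[of "c - 3/2"] by metis
      then show ?thesis by (simp add: k2_def)
    qed
    have "(\<Sum>n. f (c - 1) n x) + k1 (c - 1) - k2 (c - 1) / x =
        (c - 1) * (F + k1 c - k2 c / x) + x / 2 * (F' + k2 c / (x * x))"
      unfolding F r1 r2 using x0 by (simp add: field_simps)
    also have "\<dots> = R * (x powr (2 * z) * ((c + z - 1) * G + x / 2 * G'))"
      unfolding I D using x0 by (simp add: field_simps)
    finally show ?thesis unfolding G .
  qed
  then show ?thesis
    using dom' unfolding lattice_identity_def f_def g_def k1_def k2_def R_def by blast
qed

text \<open>Start at c + N, beyond Re a, where the beta integrals converge, and descend N
  times.\<close>

lemma lattice_identity:
  assumes a: "Re a > 1 / 2" and z: "Re z > 0" "z \<notin> \<int>"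
  shows "lattice_identity a z c"
proof -
  have az: "Re (a + z) > 0" using a z by simp
  obtain N :: nat where N: "Re a - Re c < real N" using reals_Archimedean2 by blast
  have "lattice_identity a z (c + of_nat N - of_nat k)" for k
  proof (induction k)
    case 0
    then show ?case using N by (intro lattice_identity_base a z) simp
  next
    case (Suc k)
    then show ?case using lattice_identity_lower[OF az Suc] by (simp add: algebra_simps)
  qed
  from this[of N] show ?thesis by simp
qed

section \<open>Back to the original parameters\<close>

lemma gen_bessel_K_eq:
  assumes w: "Re w > 0"
  shows "(w / 2) powr (z - lam) * gen_bessel_K \<mu> z w lam =
    2 powr (\<mu> + lam + z - 1) * gen_K (1/2 + lam + \<mu>) z (1/2 + lam - z) w"
proof -
  have w0: "w / 2 \<noteq> 0" using w by auto
  have p1: "w powr lam = 2 powr lam * (w / 2) powr lam"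
    using powr_times_real_left[of 2 "w / 2" lam] by simp
  have p2: "(w / 2) powr (z - lam) * (w / 2) powr lam = (w / 2) powr z"
    by (simp add: powr_add[symmetric])
  have p3: "(w / 2) powr z * (w / 2) powr (- z) = 1"
    using w0 by (simp add: powr_add[symmetric])
  have p4: "(w / 2) powr z * (w / 2) powr z = (w / 2) powr (2 * z)"
    by (simp add: powr_add[symmetric])
  have p5: "2 powr lam * 2 powr (\<mu> + z - 1) = (2 :: complex) powr (\<mu> + lam + z - 1)"
    by (simp add: powr_add[symmetric] algebra_simps)
  have args: "\<mu> + lam + 1/2 = 1/2 + lam + \<mu>" "\<mu> + z + lam + 1/2 = 1/2 + lam + \<mu> + z"
    "1/2 + lam - z = lam + 1/2 - z" "lam + 1/2 - z + z = lam + 1/2" by simp_all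
  \<comment> \<open>Powers, Gamma values and series are replaced by letters, so that only the four
    relations between the powers enter.\<close>
  have *: "A * (pie * (two * B) * D / s * (C * (g1 / g2) * h - A' * (g3 / g4) * h')) =
      E * (pie / s * (g1 * inverse g2 * h - A'' * (g3 * inverse g4 * h')))"
    if "A * B = A'" "A' * C = 1" "A' * A' = A''" "two * D = E"
    for A B C D E A' A'' pie two s g1 g2 g3 g4 h h' :: complex
  proof -
    have "A * (pie * (two * B) * D / s * (C * (g1 / g2) * h - A' * (g3 / g4) * h'))
      = (two * D) * (pie / s * ((A * B * C) * (g1 * inverse g2) * h - (A * B * A') * (g3 * inverse g4) * h'))"
      by (simp add: algebra_simps divide_inverse)
    then show ?thesis unfolding that by (simp only: mult_1 mult.assoc)
  qed
  show ?thesis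
    unfolding gen_bessel_K_def gen_K_def rGamma_inverse_Gamma p1 args
    by (rule *[OF p2 p3 p4 p5])
qed

text \<open>Convergence of both series is part of the conclusion, since an infinite sum has a value
  here in any case. The quotient by Gamma (1/2 + \<lambda>) is contained in
  \<open>hyp2F1_reg\<close>.\<close>

theorem theorem1p6:
  fixes x z \<mu> lam :: complex
  assumes "Re x > 0" and "Re z > 0" and "z \<notin> \<int>" and "Re (\<mu> + lam) > 0"
  shows "summable (\<lambda>n. (of_nat (Suc n) * x / 2) powr (z - lam) *
                        gen_bessel_K \<mu> z (of_nat (Suc n) * x) lam) \<and>
         summable (\<lambda>n. 1 / of_nat (Suc n) powr (2 * z + 1) *
                        hyp2F1_reg (1/2 + z) (1/2 + lam + \<mu> + z) (1/2 + lam)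
                          (- (x\<^sup>2 / (4 * (of_real pi)\<^sup>2 * (of_nat (Suc n))\<^sup>2)))) \<and>
         2 * (\<Sum>n. (of_nat (Suc n) * x / 2) powr (z - lam) *
                    gen_bessel_K \<mu> z (of_nat (Suc n) * x) lam)
         + 2 powr (z + \<mu> + lam - 1) * Gamma z * Gamma (1/2 + lam + \<mu>) * rGamma (1/2 + lam - z)
         - of_real (sqrt pi) * 2 powr (\<mu> + z + lam) * Gamma (lam + \<mu>) * Gamma (1/2 + z)
             * rGamma (lam - z) / x
         = 2 powr (\<mu> + lam - z) / of_real (sqrt pi) * (x / of_real pi) powr (2 * z) *
           Gamma (z + 1/2) * Gamma (1/2 + lam + \<mu> + z) *
           (\<Sum>n. 1 / of_nat (Suc n) powr (2 * z + 1) *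
                    hyp2F1_reg (1/2 + z) (1/2 + lam + \<mu> + z) (1/2 + lam)
                      (- (x\<^sup>2 / (4 * (of_real pi)\<^sup>2 * (of_nat (Suc n))\<^sup>2))))"
proof -
  define a where "a = 1/2 + lam + \<mu>"
  define c where "c = 1/2 + lam - z"
  define E where "E = (2 :: complex) powr (\<mu> + lam + z - 1)"
  have a: "Re a > 1 / 2" using assms(4) by (simp add: a_def)
  have x: "x \<in> right_half_plane" using assms(1) by simp
  have "lattice_identity a z c" by (rule lattice_identity[OF a assms(2,3)])
  then have dom: "locally_dominated right_half_plane (\<lambda>n x. gen_K a z c (of_nat (Suc n) * x))"
      "locally_dominated right_half_plane (lattice_term (a + z) z (c + z))"
    and id: "(\<Sum>n. gen_K a z c (of_nat (Suc n) * x)) + Gamma z * Gamma a * rGamma c / 2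
       - of_real (sqrt pi) * Gamma (z + 1/2) * Gamma (a - 1/2) * rGamma (c - 1/2) / x
     = 2 * of_real (sqrt pi) * Gamma (z + 1/2) * Gamma (a + z) * of_real (2 * pi) powr (- (2 * z + 1)) *
       (x powr (2 * z) * (\<Sum>n. lattice_term (a + z) z (c + z) n x))"
    using x unfolding lattice_identity_def by auto
  have s1: "summable (\<lambda>n. gen_K a z c (of_nat (Suc n) * x))"
    using locally_dominated_summable[OF dom(1) x] .
  have s2: "summable (\<lambda>n. lattice_term (a + z) z (c + z) n x)"
    using locally_dominated_summable[OF dom(2) x] .
  have t1: "(of_nat (Suc n) * x / 2) powr (z - lam) * gen_bessel_K \<mu> z (of_nat (Suc n) * x) lam
      = E * gen_K a z c (of_nat (Suc n) * x)" for n
  proof -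
    have "Re (of_nat (Suc n) * x) > 0" using assms(1) by (simp del: of_nat_Suc)
    then show ?thesis unfolding E_def a_def c_def by (rule gen_bessel_K_eq)
  qed
  have t2: "1 / of_nat (Suc n) powr (2 * z + 1) *
      hyp2F1_reg (1/2 + z) (1/2 + lam + \<mu> + z) (1/2 + lam) (- (x\<^sup>2 / (4 * (of_real pi)\<^sup>2 * (of_nat (Suc n))\<^sup>2)))
      = lattice_term (a + z) z (c + z) n x" for n
    unfolding lattice_term_def lattice_arg_def a_def c_def by simp
  have E2: "2 * E = 2 powr (\<mu> + z + lam)"
    using powr_add[of 2 1 "\<mu> + lam + z - 1"] by (simp add: E_def add_ac)
  \<comment> \<open>Powers of 2 combine to exponent (\<mu> + \<lambda> + z) - 2 z, and (2
    pi)^(-2z-1) supplies the 1/pi that turns sqrt pi into 1 / sqrt pi.\<close>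
  have const: "2 * E * (2 * of_real (sqrt pi) * of_real (2 * pi) powr (- (2 * z + 1)) * x powr (2 * z)) =
      2 powr (\<mu> + lam - z) / of_real (sqrt pi) * (x / of_real pi) powr (2 * z)"
  proof -
    have 1: "complex_of_real (2 * pi) powr (- (2 * z + 1)) = 2 powr (- (2 * z + 1)) * of_real pi powr (- (2 * z + 1))"
      using powr_times_real[of 2 "of_real pi" "- (2 * z + 1)"] by simp
    have 2: "complex_of_real pi powr (- (2 * z + 1)) = of_real pi powr (- (2 * z)) / of_real pi"
    proof -
      have "- (2 * z + 1) = - (2 * z) - 1" by simp
      then show ?thesis by (simp only: powr_diff) simp
    qed
    have 3: "(x / of_real pi) powr (2 * z) = x powr (2 * z) * of_real pi powr (- (2 * z))"
    proof -
      have "x powr (2 * z) = of_real pi powr (2 * z) * (x / of_real pi) powr (2 * z)"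
        using powr_times_real_left[of "of_real pi" "x / of_real pi" "2 * z"] by simp
      moreover have "complex_of_real pi powr (2 * z) * of_real pi powr (- (2 * z)) = 1"
        by (simp add: powr_add[symmetric])
      ultimately show ?thesis by (simp add: mult_ac)
    qed
    have 4: "2 * E * 2 * 2 powr (- (2 * z + 1)) = 2 powr (\<mu> + lam - z)"
    proof -
      have "2 * 2 powr (- (2 * z + 1)) = (2 :: complex) powr (- (2 * z))"
        using powr_add[of "2 :: complex" 1 "- (2 * z + 1)"] by simp
      then have "2 * E * 2 * 2 powr (- (2 * z + 1)) = 2 powr (\<mu> + z + lam) * 2 powr (- (2 * z))"
        unfolding E2 by (simp add: mult.assoc)
      also have "\<dots> = 2 powr (\<mu> + lam - z)" by (simp add: powr_add[symmetric] algebra_simps)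
      finally show ?thesis .
    qed
    have sq: "complex_of_real (sqrt pi) / of_real pi = 1 / of_real (sqrt pi)"
    proof -
      have "complex_of_real pi = of_real (sqrt pi) * of_real (sqrt pi)"
        by (simp flip: of_real_mult)
      then show ?thesis by simp
    qed
    have "2 * E * (2 * of_real (sqrt pi) * of_real (2 * pi) powr (- (2 * z + 1)) * x powr (2 * z)) =
      (2 * E * 2 * 2 powr (- (2 * z + 1))) * (of_real (sqrt pi) / of_real pi) * (x powr (2 * z) * of_real pi powr (- (2 * z)))"
      unfolding 1 2 by simp
    then show ?thesis unfolding 4 sq 3[symmetric] by simp
  qed
  have args: "a - 1/2 = lam + \<mu>" "c - 1/2 = lam - z" by (simp_all add: a_def c_def)
  let ?F = "\<Sum>n. gen_K a z c (of_nat (Suc n) * x)" and ?S = "\<Sum>n. lattice_term (a + z) z (c + z) n x"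
  have "2 * (E * ?F) + E * Gamma z * Gamma a * rGamma c
      - of_real (sqrt pi) * (2 * E) * Gamma (lam + \<mu>) * Gamma (1/2 + z) * rGamma (lam - z) / x
    = 2 * E * (?F + Gamma z * Gamma a * rGamma c / 2
       - of_real (sqrt pi) * Gamma (z + 1/2) * Gamma (a - 1/2) * rGamma (c - 1/2) / x)"
    unfolding args add.commute[of "1/2" z] by (simp add: algebra_simps)
  also have "\<dots> = (2 * E * (2 * of_real (sqrt pi) * of_real (2 * pi) powr (- (2 * z + 1)) * x powr (2 * z))) *
      Gamma (z + 1/2) * Gamma (a + z) * ?S"
    unfolding id by (simp only: mult_ac)
  also have "\<dots> = 2 powr (\<mu> + lam - z) / of_real (sqrt pi) * (x / of_real pi) powr (2 * z) *
      Gamma (z + 1/2) * Gamma (a + z) * ?S"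
    unfolding const ..
  finally have main: "2 * (E * ?F) + E * Gamma z * Gamma a * rGamma c
      - of_real (sqrt pi) * (2 * E) * Gamma (lam + \<mu>) * Gamma (1/2 + z) * rGamma (lam - z) / x = \<dots>" .
  have Ez: "2 powr (z + \<mu> + lam - 1) = E" by (simp add: E_def add_ac)
  show ?thesis
    unfolding t1 t2 unfolding suminf_mult[OF s1] Ez a_def[symmetric] c_def[symmetric] E2[symmetric]
    using s2 summable_mult[OF s1, of E] main by blast
qed

end
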